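(* Let $n\ge 1$ and $d\ge 0$ be integers. The space $\mathbb{P}\mathrm{S}^d_n$ of all homogeneous degree-$d$ real stable polynomials $f\in\mathbb{R}[w_1,\ldots,w_n]$ with nonnegative coefficients and $f(1,\ldots,1)=1$ (with the Euclidean topology on coefficients) is homeomorphic to a closed Euclidean ball.
   Context: A polynomial $f\in\mathbb{R}[w_1,\ldots,w_n]$ is real stable if $f(\mathbf{w})\neq 0$ whenever $\mathrm{Im}(w_j)>0$ for all $j\in[n]$. A closed Euclidean ball of dimension $0$ is a point. *)

theory Defs
  imports "HOL-Analysis.Analysis" "HOL-Library.Poly_Mapping"
begin

text \<open>
  Real polynomials are finitely supported maps from exponent vectors to coefficients; the exponent
  vectors are in turn finitely supported maps from variable indices to exponents. The variables
  $w_1, \ldots, w_n$ carry the indices \<open>0, \<dots>, n - 1\<close>.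
\<close>

type_synonym exponent = "nat \<Rightarrow>\<^sub>0 nat"

type_synonym real_mpoly = "exponent \<Rightarrow>\<^sub>0 real"

definition monom_degree :: "exponent \<Rightarrow> nat"
  where "monom_degree \<alpha> = (\<Sum>i\<in>Poly_Mapping.keys \<alpha>. Poly_Mapping.lookup \<alpha> i)"

definition mpolys :: "nat \<Rightarrow> real_mpoly set"
  where "mpolys n = {f. \<forall>\<alpha>\<in>Poly_Mapping.keys f. Poly_Mapping.keys \<alpha> \<subseteq> {..<n}}"

text \<open>One evaluation map serves both for real points (\<open>'a = real\<close>, where \<^const>\<open>of_real\<close> is the
  identity) and for complex points.\<close>

definition mpoly_eval :: "real_mpoly \<Rightarrow> (nat \<Rightarrow> 'a::real_field) \<Rightarrow> 'a"
  where "mpoly_eval f w =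
    (\<Sum>\<alpha>\<in>Poly_Mapping.keys f. of_real (Poly_Mapping.lookup f \<alpha>) *
      (\<Prod>i\<in>Poly_Mapping.keys \<alpha>. w i ^ Poly_Mapping.lookup \<alpha> i))"

definition homogeneous :: "nat \<Rightarrow> real_mpoly \<Rightarrow> bool"
  where "homogeneous d f \<longleftrightarrow> (\<forall>\<alpha>\<in>Poly_Mapping.keys f. monom_degree \<alpha> = d)"

definition real_stable :: "nat \<Rightarrow> real_mpoly \<Rightarrow> bool"
  where "real_stable n f \<longleftrightarrow> f \<in> mpolys n \<and>
    (\<forall>w :: nat \<Rightarrow> complex. (\<forall>j<n. Im (w j) > 0) \<longrightarrow> mpoly_eval f w \<noteq> 0)"

definition PS :: "nat \<Rightarrow> nat \<Rightarrow> real_mpoly set"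
  where "PS n d = {f. real_stable n f \<and> homogeneous d f \<and> (\<forall>\<alpha>. Poly_Mapping.lookup f \<alpha> \<ge> 0) \<and>
    mpoly_eval f (\<lambda>_. 1 :: real) = 1}"

text \<open>The exponent vectors of the degree-\<open>d\<close> monomials in $n$ variables. This set is finite, so the
  product topology on real families indexed by it is the Euclidean one.\<close>

definition exponents :: "nat \<Rightarrow> nat \<Rightarrow> exponent set"
  where "exponents n d = {\<alpha>. Poly_Mapping.keys \<alpha> \<subseteq> {..<n} \<and> monom_degree \<alpha> = d}"

definition PS_topology :: "nat \<Rightarrow> nat \<Rightarrow> real_mpoly topology"
  where "PS_topology n d =
    pullback_topology (PS n d) (\<lambda>f. restrict (Poly_Mapping.lookup f) (exponents n d))
      (powertop_real (exponents n d))"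

text \<open>The closed unit ball of $\mathbb{R}^m$, with the dimension as a term so that it can be
  quantified; for \<open>m = 0\<close> it is a point.\<close>

definition closed_unit_ball :: "nat \<Rightarrow> (nat \<Rightarrow> real) topology"
  where "closed_unit_ball m =
    subtopology (Euclidean_space m) {x. (\<Sum>i<m. (x i)\<^sup>2) \<le> 1}"

end

theory Submission
  imports Defs "HOL-Computational_Algebra.Fundamental_Theorem_Algebra"
begin

text \<open>
  Consider the linear operator
  \<open>L = (\<Sum>k l. w\<^sub>k \<partial>\<^sub>l) - (\<Sum>k. (w\<^sub>k \<partial>\<^sub>k)\<^sup>2)\<close>
  on homogeneous polynomials of degree \<open>d\<close>. The operators \<open>1 + s w\<^sub>k \<partial>\<^sub>l\<close>
  and \<open>1 - s (w\<^sub>k \<partial>\<^sub>k)\<^sup>2\<close> preserve stability for small \<open>s > 0\<close>, hence so does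
  the semigroup \<open>exp (t L)\<close>. With respect to the inner product in which the monomials are orthogonal
  with squared norms \<open>\<alpha>!\<close>, \<open>L\<close> is symmetric; it is irreducible with nonnegative off-diagonal
  entries, so by Perron's theorem its top eigenvalue is simple with a positive eigenvector. On the
  affine slice of polynomials whose component along this eigenvector is \<open>1\<close>, the suitably rescaled
  semigroup is therefore a linear contraction towards the eigenvector.

  The semigroup moves stable polynomials into the interior. If \<open>f\<^sub>t = exp (t L) f\<close> had a real zero
  \<open>y \<noteq> 0\<close> of multiplicity \<open>m \<ge> 2\<close> along some coordinate direction with \<open>y\<^sub>j \<noteq> 0\<close>, then, as
  \<open>f\<^sub>s\<close> is real rooted along that line for \<open>s\<close> on both sides of \<open>t\<close>, Newton's inequality would force
  the \<open>(m - 2)\<close>-nd derivative of \<open>L f\<^sub>t\<close> at \<open>y\<close> to vanish; but up to terms of higher order this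
  derivative comes from \<open>- (\<Sum>k. y\<^sub>k\<^sup>2 \<partial>\<^sub>k\<^sup>2 f\<^sub>t)\<close>, which has a definite sign. Hence all real zeros are
  simple, and a compactness argument shows that all nearby polynomials are stable.

  A compact set that a linear contraction flow moves into its interior is homeomorphic to a ball.
\<close>

section \<open>Univariate polynomials and the upper half plane\<close>

text \<open>The first-order part of \<open>L\<close> alone generates linear substitutions of the
  variables, which carry singular real zeros to singular real zeros; the second-order part is there
  to separate them. It is diagonal on monomials, so the first-order part in turn supplies the
  irreducibility. The factorial weights make \<open>w\<^sub>k \<partial>\<^sub>l\<close> and
  \<open>w\<^sub>l \<partial>\<^sub>k\<close> adjoint to each other.

  Limits of Euler steps require a closed cone, whereas stability is a nonvanishing condition; the
  proof therefore moves to \<open>stable_cone\<close>, which also contains the zero polynomial. The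
  theorem cuts this cone by coefficient sum \<open>1\<close>, the contraction argument by component
  \<open>1\<close> along the eigenvector. Both functionals are positive on nonzero members, so
  rescaling identifies the two sections; the dimension is the number of monomials minus one.

  The set of stable polynomials is in general not convex, so rays give no evident coordinates.
  Trajectories replace them: each point other than the eigenvector is recorded by where its
  trajectory, continued to all times, meets a unit sphere, and by the time measured from the entry
  into the set.\<close>

lemma cmod_add_sq_le:
  fixes A B :: complex and D h a b :: real
  assumes "D > 0" "h > 0" "h * (cmod A)\<^sup>2 \<le> D * a" "h * (cmod B)\<^sup>2 \<le> b"
  shows "h * (cmod (A + B))\<^sup>2 \<le> (D + 1) * (a + b)"
proof -
  let ?x = "cmod A" and ?y = "cmod B"
  have "(cmod (A + B))\<^sup>2 \<le> (?x + ?y)\<^sup>2"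
    by (intro power_mono norm_triangle_ineq) auto
  \<comment> \<open>Weighted Cauchy-Schwarz with weights \<open>D\<close> and \<open>1\<close>:
    \<open>A\<close> will collect \<open>D\<close> roots and \<open>B\<close> a single new
    one.\<close>
  also have "\<dots> \<le> (D + 1) * (?x\<^sup>2 / D + ?y\<^sup>2)"
  proof -
    have "(D + 1) * (?x\<^sup>2 / D + ?y\<^sup>2) - (?x + ?y)\<^sup>2 = (?x - D * ?y)\<^sup>2 / D"
      using assms(1) by (simp add: field_simps power2_eq_square)
    moreover have "(?x - D * ?y)\<^sup>2 / D \<ge> 0" using assms(1) by auto
    ultimately show ?thesis by linarith
  qed
  finally have "h * (cmod (A + B))\<^sup>2 \<le> h * ((D + 1) * (?x\<^sup>2 / D + ?y\<^sup>2))"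
    using assms(2) by (simp add: mult_left_mono)
  also have "\<dots> = (D + 1) * (h * ?x\<^sup>2 / D + h * ?y\<^sup>2)"
    by (simp add: algebra_simps)
  also have "\<dots> \<le> (D + 1) * (a + b)"
    using assms by (intro mult_left_mono add_mono) (auto simp: field_simps)
  finally show ?thesis .
qed

text \<open>\<open>V\<close> is the logarithmic derivative, the sum of \<open>1 / (w - r)\<close>
  over the roots \<open>r\<close>. As \<open>Im r \<le> 0\<close>, each summand \<open>B\<close>
  satisfies \<open>Im w * (cmod B)\<^sup>2 \<le> - Im B\<close>; adding \<open>degree p\<close> of
  them by Cauchy-Schwarz costs the factor \<open>degree p\<close>. The last conjunct gives
  \<open>Im V < 0\<close> as soon as there is a root.\<close>

lemma logderiv_upper_half_plane:
  fixes p :: "complex poly"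
  assumes "\<And>z. Im z > 0 \<Longrightarrow> poly p z \<noteq> 0" "Im w > 0"
  shows "\<exists>V. poly (pderiv p) w = V * poly p w \<and> Im w * (cmod V)\<^sup>2 \<le> real (degree p) * - Im V \<and>
    Im V \<le> 0 \<and> (Im V = 0 \<longrightarrow> degree p = 0)"
  using assms
proof (induction "degree p" arbitrary: p)
  case 0
  then obtain c where "p = [:c:]" by (metis degree_eq_zeroE)
  then show ?case by (intro exI[of _ 0]) auto
next
  case (Suc D)
  have "\<not> constant (poly p)" using Suc(2) by (simp add: constant_degree)
  then obtain r where r: "poly p r = 0" using fundamental_theorem_of_algebra by blast
  then obtain q where q: "p = [:-r, 1:] * q" by (auto simp: poly_eq_0_iff_dvd)
  have q0: "q \<noteq> 0" using Suc(2) q by auto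
  have dq: "D = degree q"
    using Suc(2) q q0 by (simp add: degree_mult_eq del: mult_pCons_left)
  have qn: "poly q z \<noteq> 0" if "Im z > 0" for z using Suc.prems(1)[OF that] q by auto
  obtain V where V: "poly (pderiv q) w = V * poly q w" "Im w * (cmod V)\<^sup>2 \<le> real (degree q) * - Im V"
    "Im V \<le> 0" "Im V = 0 \<longrightarrow> degree q = 0"
    using Suc(1)[OF dq qn Suc.prems(2)] by blast
  have ir: "Im r \<le> 0" using Suc.prems(1) r by (meson not_le)
  define B where "B = 1 / (w - r)"
  have wr: "w - r \<noteq> 0" using ir Suc.prems(2) by auto
  have imB: "Im B = - (Im w - Im r) * (cmod B)\<^sup>2"
  proof -
    have "B = cnj (w - r) / (cmod (w - r))\<^sup>2" "cmod B = 1 / cmod (w - r)"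
      unfolding B_def complex_div_cnj[of 1 "w - r"] mult_1
      by simp (metis complex_div_cnj[of 1 "w - r"] mult_1 norm_divide norm_one)
    then show ?thesis by (simp add: power_divide)
  qed
  have B0: "(cmod B)\<^sup>2 > 0" using wr by (simp add: B_def)
  have B1: "Im w * (cmod B)\<^sup>2 \<le> - Im B" unfolding imB using ir by (simp add: algebra_simps mult_nonpos_nonneg)
  have B2: "Im B < 0" using B1 B0 Suc.prems(2) by (smt (verit) mult_pos_pos)
  have eq: "poly (pderiv p) w = (V + B) * poly p w"
    using wr V(1) unfolding q B_def pderiv_mult poly_add poly_mult
    by (simp add: pderiv_pCons field_simps)
  have "Im w * (cmod (V + B))\<^sup>2 \<le> real (degree p) * - Im (V + B)"
  proof (cases "D = 0")
    case True
    then have "V = 0" using V(2) dq Suc.prems(2) by (auto simp: mult_le_0_iff)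
    then show ?thesis using B1 True Suc(2)[symmetric] by simp
  next
    case False
    have "Im w * (cmod (V + B))\<^sup>2 \<le> (real D + 1) * (- Im V + - Im B)"
      by (rule cmod_add_sq_le) (use False Suc.prems V B1 dq in auto)
    then show ?thesis using Suc(2)[symmetric] by (simp add: algebra_simps)
  qed
  then show ?case using eq V(3) B2 by (intro exI[of _ "V + B"]) auto
qed

lemma pderiv_upper_half_plane:
  fixes p :: "complex poly"
  assumes "\<And>z. Im z > 0 \<Longrightarrow> poly p z \<noteq> 0" "Im w > 0" "degree p > 0"
  shows "poly (pderiv p) w \<noteq> 0"
  using logderiv_upper_half_plane[of p w] assms by fastforce

text \<open>This is \<open>Im V \<le> 0\<close> multiplied by
  \<open>(cmod (poly p w))\<^sup>2\<close>. Free of division, it survives limits to points where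
  \<open>p\<close> vanishes.\<close>

lemma Im_pderiv_le:
  fixes p :: "complex poly"
  assumes "\<And>z. Im z > 0 \<Longrightarrow> poly p z \<noteq> 0" "Im w > 0"
  shows "Im (poly (pderiv p) w * cnj (poly p w)) \<le> 0"
proof -
  obtain V where V: "poly (pderiv p) w = V * poly p w" "Im V \<le> 0"
    using logderiv_upper_half_plane[of p w] assms by blast
  have "poly (pderiv p) w * cnj (poly p w) = V * of_real ((cmod (poly p w))\<^sup>2)"
    unfolding V(1) by (simp only: complex_norm_square mult.assoc)
  then show ?thesis using V(2) by (simp add: mult_le_0_iff)
qed

lemma Im_pderiv2_le:
  fixes p :: "complex poly"
  assumes "\<And>z. Im z > 0 \<Longrightarrow> poly p z \<noteq> 0" "Im w > 0"
  shows "Im (poly (pderiv (pderiv p)) w * cnj (poly (pderiv p) w)) \<le> 0"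
proof (cases "degree p = 0")
  case True
  then have "pderiv p = 0" by (simp add: pderiv_eq_0_iff)
  then show ?thesis by simp
next
  case False
  then show ?thesis using Im_pderiv_le[of "pderiv p" w] pderiv_upper_half_plane[of p] assms by auto
qed

text \<open>A zero would give \<open>a * v * V = -1\<close>, so \<open>V\<close> would be a positive
  multiple of \<open>- cnj v\<close> and have positive imaginary part. The number \<open>v\<close>
  stands for the value of \<open>w\<^sub>k\<close> in
  \<open>1 + s w\<^sub>k \<partial>\<^sub>l\<close>.\<close>

lemma poly_add_mult_pderiv_neq_0:
  fixes p :: "complex poly"
  assumes "\<And>z. Im z > 0 \<Longrightarrow> poly p z \<noteq> 0" "Im w > 0" "Im v > 0" "a \<ge> 0"
  shows "poly p w + of_real a * v * poly (pderiv p) w \<noteq> 0"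
proof
  assume z: "poly p w + of_real a * v * poly (pderiv p) w = 0"
  obtain V where V: "poly (pderiv p) w = V * poly p w" "Im V \<le> 0"
    using logderiv_upper_half_plane[of p w] assms by blast
  have "(1 + of_real a * v * V) * poly p w = 0" using z V by (simp add: algebra_simps)
  then have e: "of_real a * v * V = -1" using assms(1,2) by (simp add: add_eq_0_iff)
  have "of_real (a * (cmod v)\<^sup>2) * V = cnj v * (of_real a * v * V)"
    unfolding of_real_mult complex_norm_square by simp
  then have "of_real (a * (cmod v)\<^sup>2) * V = - cnj v" unfolding e by simp
  then have "Im (of_real (a * (cmod v)\<^sup>2) * V) = Im v" by simp
  then have "a * (cmod v)\<^sup>2 * Im V = Im v" by (simp only: times_complex.sel) simp
  then show False using assms(3,4) V(2) by (smt (verit) mult_nonneg_nonneg mult_nonneg_nonpos zero_le_power2)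
qed

text \<open>A zero would give \<open>a * w * V = 1\<close>, hence
  \<open>a * (cmod V)\<^sup>2 * Im w = - Im V\<close>, against the bound on the logarithmic
  derivative once \<open>a * d < 1\<close>. The threshold is visible on \<open>w ^ d\<close>, which
  becomes \<open>(1 - a * d) * w ^ d\<close>.\<close>

lemma poly_diff_mult_pderiv_neq_0:
  fixes p :: "complex poly"
  assumes "\<And>z. Im z > 0 \<Longrightarrow> poly p z \<noteq> 0" "Im w > 0" "a \<ge> 0" "a * real d < 1" "degree p \<le> d"
  shows "poly p w - of_real a * w * poly (pderiv p) w \<noteq> 0"
proof
  assume z: "poly p w - of_real a * w * poly (pderiv p) w = 0"
  obtain V where V: "poly (pderiv p) w = V * poly p w" "Im w * (cmod V)\<^sup>2 \<le> real (degree p) * - Im V" "Im V \<le> 0"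
    using logderiv_upper_half_plane[of p w] assms by blast
  have "(1 - of_real a * w * V) * poly p w = 0" using z V by (simp add: algebra_simps)
  then have e: "of_real a * w * V = 1" using assms(1,2) by simp
  have "of_real (a * (cmod V)\<^sup>2) * w = cnj V * (of_real a * w * V)"
    unfolding of_real_mult complex_norm_square by simp
  then have "of_real (a * (cmod V)\<^sup>2) * w = cnj V" unfolding e by simp
  then have "Im (of_real (a * (cmod V)\<^sup>2) * w) = - Im V" by simp
  then have 1: "a * (cmod V)\<^sup>2 * Im w = - Im V" by (simp only: times_complex.sel) simp
  have V0: "V \<noteq> 0" using e by auto
  have "Im w * (cmod V)\<^sup>2 \<le> (a * real (degree p)) * (Im w * (cmod V)\<^sup>2)"
    using V(2) unfolding 1[symmetric] by (simp add: mult_ac)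
  moreover have "a * real (degree p) < 1" using assms(3,4,5)
    by (smt (verit) mult_left_mono of_nat_mono)
  moreover have "Im w * (cmod V)\<^sup>2 > 0" using V0 assms(2) by simp
  ultimately show False by (smt (verit) mult_less_cancel_right2)
qed

section \<open>Real polynomials with only real zeros\<close>

abbreviation cpoly :: "real poly \<Rightarrow> complex \<Rightarrow> complex" where
  "cpoly p \<equiv> poly (map_poly of_real p)"

lemma cpoly_pCons [simp]: "cpoly (pCons a p) z = of_real a + z * cpoly p z"
  by (subst map_poly_pCons) auto

lemma cpoly_of_real [simp]: "cpoly p (of_real x) = of_real (poly p x)"
  by (induction p) auto

lemma cpoly_add [simp]: "cpoly (p + q) z = cpoly p z + cpoly q z"
  by (induction p q rule: poly_induct2) (auto simp: algebra_simps)

lemma cpoly_smult [simp]: "cpoly (smult a p) z = of_real a * cpoly p z"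
  by (induction p) (auto simp: algebra_simps)

lemma cpoly_mult [simp]: "cpoly (p * q) z = cpoly p z * cpoly q z"
  by (induction p) (auto simp: algebra_simps)

lemma cpoly_cnj: "cpoly p (cnj z) = cnj (cpoly p z)"
  by (induction p) auto

lemma pderiv_map_poly_of_real:
  "pderiv (map_poly (of_real :: real \<Rightarrow> complex) p) = map_poly of_real (pderiv p)"
  by (intro poly_eqI) (auto simp: coeff_pderiv coeff_map_poly)

lemma degree_map_poly_of_real [simp]: "degree (map_poly (of_real :: real \<Rightarrow> complex) p) = degree p"
  by (intro degree_map_poly) auto

text \<open>Nonreal zeros of a real polynomial come in conjugate pairs, so without zeros in the
  upper half plane it splits into real linear factors.\<close>

lemma real_rooted_induct [consumes 1, case_names const factor]:
  fixes p :: "real poly"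
  assumes rr: "\<forall>z. Im z > 0 \<longrightarrow> cpoly p z \<noteq> 0"
    and const: "\<And>c. P [:c:]"
    and factor: "\<And>q r. P q \<Longrightarrow> P ([:-r, 1:] * q)"
  shows "P p"
  using rr
proof (induction "degree p" arbitrary: p)
  case 0
  then show ?case using const by (metis degree_eq_zeroE)
next
  case (Suc D)
  have "\<not> constant (cpoly p)" using Suc(2) by (simp add: constant_degree)
  then obtain z where z: "cpoly p z = 0" using fundamental_theorem_of_algebra by blast
  have "Im z = 0"
    using Suc.prems[rule_format, of z] Suc.prems[rule_format, of "cnj z"] z by (cases "Im z" "0::real" rule: linorder_cases) (auto simp: cpoly_cnj)
  then have "z = of_real (Re z)" by (simp add: complex_eq_iff)
  then have "poly p (Re z) = 0" using z cpoly_of_real[of p "Re z"] by (metis of_real_eq_0_iff)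
  then obtain q where q: "p = [:-Re z, 1:] * q" by (auto simp: poly_eq_0_iff_dvd)
  have "q \<noteq> 0" using Suc(2) q by auto
  then have "D = degree q" using Suc(2) q by (simp add: degree_mult_eq del: mult_pCons_left)
  moreover have "cpoly q z \<noteq> 0" if "Im z > 0" for z using Suc.prems that unfolding q cpoly_mult by auto
  ultimately show ?case using factor Suc(1) q by blast
qed

text \<open>Logarithmic concavity between the real zeros. Attaching a factor \<open>x - r\<close> to
  \<open>q\<close> turns the defect \<open>\<Delta>\<close> of \<open>q\<close> into
  \<open>q\<^sup>2 + (x - r)\<^sup>2 * \<Delta>\<close>, which stays nonnegative.\<close>

lemma laguerre_inequality:
  fixes p :: "real poly"
  assumes "\<And>z. Im z > 0 \<Longrightarrow> cpoly p z \<noteq> 0"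
  shows "poly p x * poly (pderiv (pderiv p)) x \<le> (poly (pderiv p) x)\<^sup>2"
proof -
  have "\<forall>z. Im z > 0 \<longrightarrow> cpoly p z \<noteq> 0" using assms by blast
  then show ?thesis
  proof (induction p rule: real_rooted_induct)
    case (factor q r)
    let ?q = "poly q x" and ?q1 = "poly (pderiv q) x" and ?q2 = "poly (pderiv (pderiv q)) x"
    have "(poly (pderiv ([:-r, 1:] * q)) x)\<^sup>2
        - poly ([:-r, 1:] * q) x * poly (pderiv (pderiv ([:-r, 1:] * q))) x
        = ?q\<^sup>2 + (x - r)\<^sup>2 * (?q1\<^sup>2 - ?q * ?q2)"
      by (simp add: pderiv_mult pderiv_pCons pderiv_add pderiv_diff pderiv_minus pderiv_smult algebra_simps power2_eq_square)
    moreover have "\<dots> \<ge> 0" using factor by simp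
    ultimately show ?case by linarith
  qed (simp add: pderiv_pCons)
qed

text \<open>Each real root is no farther from \<open>0\<close> than from \<open>- \<i>\<close>. This
  turns nonvanishing into the closed inequality that defines \<open>stable_cone\<close>.\<close>

lemma cmod_poly_ge_real_rooted:
  fixes p :: "real poly"
  assumes "\<And>z. Im z > 0 \<Longrightarrow> cpoly p z \<noteq> 0"
  shows "\<bar>poly p 0\<bar> \<le> cmod (cpoly p (- \<i>))"
proof -
  have "\<forall>z. Im z > 0 \<longrightarrow> cpoly p z \<noteq> 0" using assms by blast
  then show ?thesis
  proof (induction p rule: real_rooted_induct)
    case (factor q r)
    have "\<bar>r\<bar> \<le> cmod (- \<i> - of_real r)"
      using abs_Re_le_cmod[of "- \<i> - of_real r"] by simp
    then have "\<bar>r\<bar> * \<bar>poly q 0\<bar> \<le> cmod (- \<i> - of_real r) * cmod (cpoly q (- \<i>))"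
      using factor by (intro mult_mono) auto
    moreover have "cpoly ([:-r, 1:] * q) (- \<i>) = (- \<i> - of_real r) * cpoly q (- \<i>)"
      unfolding cpoly_mult by simp
    ultimately show ?case by (simp add: abs_mult norm_mult)
  qed auto
qed

text \<open>Gauss-Lucas, iterated. Once a derivative is constant the next one vanishes identically,
  hence the alternative.\<close>

lemma higher_pderiv_real_rooted:
  fixes p :: "real poly"
  assumes "\<And>z. Im z > 0 \<Longrightarrow> cpoly p z \<noteq> 0"
  shows "(pderiv ^^ k) p = 0 \<or> (\<forall>z. Im z > 0 \<longrightarrow> cpoly ((pderiv ^^ k) p) z \<noteq> 0)"
proof (induction k)
  case (Suc k)
  let ?q = "(pderiv ^^ k) p"
  show ?case
  proof (cases "degree ?q = 0")
    case True
    then show ?thesis by (simp add: pderiv_eq_0_iff)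
  next
    case False
    then have "\<forall>z. Im z > 0 \<longrightarrow> cpoly ?q z \<noteq> 0" using Suc by auto
    then show ?thesis
      using pderiv_upper_half_plane[of "map_poly of_real ?q"] False by (auto simp: pderiv_map_poly_of_real)
  qed
qed (use assms in auto)

text \<open>Laguerre's inequality at \<open>0\<close> for the \<open>k\<close>-th derivative; the
  factorials convert coefficients into derivatives. The constant is thus independent of the degree,
  unlike in the sharp form of Newton's inequality.\<close>

lemma newton_inequality:
  fixes p :: "real poly"
  assumes "\<And>z. Im z > 0 \<Longrightarrow> cpoly p z \<noteq> 0"
  shows "fact k * fact (k + 2) * (coeff p k * coeff p (k + 2)) \<le> (fact (k + 1) * coeff p (k + 1))\<^sup>2"
proof -
  have c: "poly ((pderiv ^^ j) p) 0 = fact j * coeff p j" for j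
    by (simp add: poly_0_coeff_0 coeff_higher_pderiv pochhammer_fact)
  have "poly ((pderiv ^^ k) p) 0 * poly ((pderiv ^^ (k + 2)) p) 0 \<le> (poly ((pderiv ^^ (k + 1)) p) 0)\<^sup>2"
    using higher_pderiv_real_rooted[OF assms, of k] laguerre_inequality[of "(pderiv ^^ k) p" 0] by auto
  then show ?thesis unfolding c by (simp add: algebra_simps)
qed

text \<open>Near the origin \<open>q / p\<close> behaves like a constant times \<open>z ^ (order q - order p)\<close>, whose
  argument sweeps out an angle of at least \<open>2 * pi\<close> on the upper half plane unless the two orders
  differ by at most one.\<close>

lemma order_lemma:
  fixes p q :: "real poly"
  assumes ineq: "\<And>z. Im z > 0 \<Longrightarrow> Im (cpoly q z * cnj (cpoly p z)) \<le> 0"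
    and p: "p = monom 1 m * p'" "coeff p' 0 \<noteq> 0"
  shows "\<And>k. Suc k < m \<Longrightarrow> coeff q k = 0" and "m > 0 \<Longrightarrow> 0 \<le> coeff q (m - 1) * coeff p m"
proof -
  have cm: "cpoly (monom 1 j) z = z ^ j" for j z
    by (simp add: map_poly_monom poly_monom)
  \<comment> \<open>On the ray \<open>z = e * \<omega>\<close>, dividing by
    \<open>e ^ (r + m)\<close> and letting \<open>e\<close> tend to \<open>0\<close> leaves the
    lowest coefficients times \<open>cnj \<omega> ^ (m - r)\<close>. As \<open>coeff q' 0\<close>
    may be zero, \<open>r\<close> is only a lower bound for the order of \<open>q\<close>.\<close>
  have main: "- sin (real (m - r) * t) * (coeff q' 0 * coeff p' 0) \<le> 0"
    if q: "q = monom 1 r * q'" and r: "r \<le> m" and t: "0 < t" "t < pi" for r q' t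
  proof -
    define \<omega> where "\<omega> = cis t"
    let ?h = "\<lambda>e. Im (cnj \<omega> ^ (m - r) * (cpoly q' (of_real e * \<omega>) * cnj (cpoly p' (of_real e * \<omega>))))"
    have le: "?h e \<le> 0" if e: "e > 0" for e :: real
    proof -
      let ?z = "of_real e * \<omega>"
      have "Im ?z > 0" using e t sin_gt_zero by (simp add: \<omega>_def)
      then have "Im (cpoly q ?z * cnj (cpoly p ?z)) \<le> 0" by (rule ineq)
      also have "cpoly q ?z * cnj (cpoly p ?z) =
          of_real (e ^ (r + m)) * (\<omega> ^ r * cnj \<omega> ^ m * (cpoly q' ?z * cnj (cpoly p' ?z)))"
        unfolding q p(1) cpoly_mult cm
        by (simp add: power_mult_distrib power_add algebra_simps)
      also have "\<omega> ^ r * cnj \<omega> ^ m = (\<omega> * cnj \<omega>) ^ r * cnj \<omega> ^ (m - r)"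
        using r by (simp add: power_mult_distrib mult.assoc flip: power_add)
      also have "\<omega> * cnj \<omega> = 1" by (simp add: \<omega>_def cis_cnj cis_mult)
      finally have "e ^ (r + m) * ?h e \<le> 0" by (simp only: power_one mult_1 times_complex.sel(2)[of "of_real _"] Re_complex_of_real Im_complex_of_real mult_zero_left add_0_right)
      moreover have "e ^ (r + m) > 0" using e by simp
      ultimately show ?thesis by (meson mult_pos_pos not_le)
    qed
    have "(?h \<longlongrightarrow> ?h 0) (at_right 0)"
      by (intro tendsto_intros)
    moreover have "eventually (\<lambda>e. ?h e \<le> 0) (at_right 0)"
      using eventually_at_right_less[of 0] by eventually_elim (rule le)
    ultimately have "?h 0 \<le> 0" by (rule tendsto_upperbound) auto
    moreover have "cnj \<omega> ^ (m - r) = cis (- (real (m - r) * t))"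
      by (simp only: \<omega>_def cis_cnj Complex.DeMoivre mult_minus_right)
    moreover have "cpoly s 0 = of_real (coeff s 0)" for s
      by (simp add: poly_0_coeff_0 coeff_map_poly)
    ultimately show ?thesis by (simp flip: of_real_mult)
  qed
  have fac: "q = monom 1 r * (poly_shift r q)" if "\<And>k. k < r \<Longrightarrow> coeff q k = 0" for r
    by (intro poly_eqI) (use that in \<open>auto simp: coeff_monom_mult coeff_poly_shift\<close>)
  show *: "coeff q k = 0" if "Suc k < m" for k
    using that
  proof (induction k rule: less_induct)
    case (less k)
    let ?c = "coeff q k * coeff p' 0"
    define J where "J = real (m - k)"
    have j: "J \<ge> 2" using less.prems by (auto simp: J_def)
    have s: "- sin (J * t) * ?c \<le> 0" if "0 < t" "t < pi" for t
      using main[OF fac, of k t] less that by (simp add: coeff_poly_shift J_def)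
    \<comment> \<open>The sine has opposite signs at \<open>pi / 2\<close> and
      \<open>3 / 2 * pi\<close>; both angles are reached with \<open>t < pi\<close> because
      \<open>J \<ge> 2\<close>.\<close>
    have e: "J * (pi / (2 * J)) = pi / 2" "J * (3 * pi / (2 * J)) = 3 / 2 * pi"
      using j by auto
    have "- sin (J * (pi / (2 * J))) * ?c \<le> 0"
      using j pi_gt_zero by (intro s) (auto simp: field_simps)
    then have "?c \<ge> 0" unfolding e by simp
    moreover have "- sin (J * (3 * pi / (2 * J))) * ?c \<le> 0"
      using j pi_gt_zero by (intro s) (auto simp: field_simps)
    then have "?c \<le> 0" unfolding e sin_3over2_pi by simp
    ultimately have "?c = 0" by linarith
    then show ?case using p by simp
  qed
  show "0 \<le> coeff q (m - 1) * coeff p m" if m: "m > 0"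
  proof -
    \<comment> \<open>When the orders differ by one only half a turn is swept, so the sign is
      determined but may be nonzero.\<close>
    have "- sin (real (m - (m - 1)) * (pi / 2)) * (coeff (poly_shift (m - 1) q) 0 * coeff p' 0) \<le> 0"
      using m pi_gt_zero by (intro main fac *) auto
    moreover have "coeff p m = coeff p' 0" unfolding p(1) by (simp add: coeff_monom_mult)
    ultimately show ?thesis using m by (simp add: coeff_poly_shift)
  qed
qed

section \<open>Stable homogeneous polynomials\<close>

text \<open>Exponent vectors as plain functions; vanishing from \<open>n\<close> on makes them
  finitely many. \<open>lookup_exponents\<close> identifies them with the finitely supported
  maps.\<close>

definition expos :: "nat \<Rightarrow> nat \<Rightarrow> (nat \<Rightarrow> nat) set" where
  "expos n d = {a. (\<forall>i\<ge>n. a i = 0) \<and> (\<Sum>i<n. a i) = d}"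

definition mon :: "nat \<Rightarrow> (nat \<Rightarrow> nat) \<Rightarrow> (nat \<Rightarrow> 'a) \<Rightarrow> 'a::real_field" where
  "mon n a w = (\<Prod>i<n. w i ^ a i)"

text \<open>Coefficients and exponents are separate families, so partial derivatives keep the index
  set \<open>expos n d\<close> and no reindexing arises.\<close>

definition msum :: "nat \<Rightarrow> 'i set \<Rightarrow> ('i \<Rightarrow> real) \<Rightarrow> ('i \<Rightarrow> nat \<Rightarrow> nat) \<Rightarrow> (nat \<Rightarrow> 'a) \<Rightarrow> 'a::real_field" where
  "msum n I c e w = (\<Sum>i\<in>I. of_real (c i) * mon n (e i) w)"

text \<open>The polynomial with coefficients \<open>x\<close> and its first and second partial derivatives in the
  \<open>l\<close>-th variable. Truncated subtraction in the exponents is harmless, because the coefficient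
  vanishes when it truncates.\<close>

abbreviation ev :: "nat \<Rightarrow> nat \<Rightarrow> ((nat \<Rightarrow> nat) \<Rightarrow> real) \<Rightarrow> (nat \<Rightarrow> 'a) \<Rightarrow> 'a::real_field" where
  "ev n d x \<equiv> msum n (expos n d) x (\<lambda>a. a)"

abbreviation dev :: "nat \<Rightarrow> nat \<Rightarrow> nat \<Rightarrow> ((nat \<Rightarrow> nat) \<Rightarrow> real) \<Rightarrow> (nat \<Rightarrow> 'a) \<Rightarrow> 'a::real_field" where
  "dev n d l x \<equiv> msum n (expos n d) (\<lambda>a. x a * real (a l)) (\<lambda>a. a(l := a l - 1))"

abbreviation ddev :: "nat \<Rightarrow> nat \<Rightarrow> nat \<Rightarrow> ((nat \<Rightarrow> nat) \<Rightarrow> real) \<Rightarrow> (nat \<Rightarrow> 'a) \<Rightarrow> 'a::real_field" where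
  "ddev n d l x \<equiv> msum n (expos n d) (\<lambda>a. x a * real (a l * (a l - 1))) (\<lambda>a. a(l := a l - 1 - 1))"

definition line_poly :: "nat \<Rightarrow> 'i set \<Rightarrow> ('i \<Rightarrow> real) \<Rightarrow> ('i \<Rightarrow> nat \<Rightarrow> nat) \<Rightarrow> (nat \<Rightarrow> 'a) \<Rightarrow> nat \<Rightarrow> 'a::real_field poly" where
  "line_poly n I c e w j = (\<Sum>i\<in>I. monom (of_real (c i) * (\<Prod>k\<in>{..<n} - {j}. w k ^ e i k)) (e i j))"

lemma finite_expos [simp]: "finite (expos n d)"
proof -
  have "expos n d \<subseteq> {a. \<forall>i. (i \<in> {..<n} \<longrightarrow> a i \<in> {..d}) \<and> (i \<notin> {..<n} \<longrightarrow> a i = 0)}"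
    by (auto simp: expos_def intro: member_le_sum)
  then show ?thesis using finite_set_of_finite_funs[of "{..<n}" "{..d}"] by (simp add: finite_subset)
qed

lemma expos_le: "a \<in> expos n d \<Longrightarrow> a i \<le> d"
  by (cases "i < n") (auto simp: expos_def intro: member_le_sum)

lemma mon_split: "j < n \<Longrightarrow> mon n a w = w j ^ a j * (\<Prod>k\<in>{..<n} - {j}. w k ^ a k)"
  unfolding mon_def by (subst prod.remove[of _ j]) auto

lemma mon_of_real: "mon n a (\<lambda>i. of_real (w i)) = of_real (mon n a w)"
  by (simp add: mon_def)

lemma msum_of_real: "msum n I c e (\<lambda>i. of_real (w i)) = of_real (msum n I c e w)"
  by (simp add: msum_def mon_of_real)

lemma mon_cong: "(\<And>i. i < n \<Longrightarrow> w i = w' i) \<Longrightarrow> mon n a w = mon n a w'"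
  by (simp add: mon_def)

lemma msum_cong: "(\<And>i. i < n \<Longrightarrow> w i = w' i) \<Longrightarrow> msum n I c e w = msum n I c e w'"
  unfolding msum_def by (intro sum.cong refl arg_cong2[where f="(*)"] mon_cong) auto

lemma mon_scale: "mon n a (\<lambda>i. c * w i) = c ^ (\<Sum>i<n. a i) * mon n a w"
  by (simp add: mon_def power_mult_distrib prod.distrib power_sum)

lemma ev_scale: "ev n d x (\<lambda>i. c * w i) = c ^ d * ev n d x w"
  unfolding msum_def sum_distrib_left
  by (intro sum.cong refl) (simp add: mon_scale expos_def)

lemma tendsto_msum [tendsto_intros]:
  assumes "\<And>i. i < n \<Longrightarrow> ((\<lambda>t. w t i) \<longlongrightarrow> w' i) F"
  shows "((\<lambda>t. msum n I c e (w t)) \<longlongrightarrow> msum n I c e (w' :: nat \<Rightarrow> 'a::{real_field,real_normed_field})) F"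
  unfolding msum_def mon_def using assms by (intro tendsto_intros) auto

lemma tendsto_msum_coeffs:
  assumes "\<And>i. i < n \<Longrightarrow> ((\<lambda>t. w t i) \<longlongrightarrow> w' i) F" "\<And>a. a \<in> I \<Longrightarrow> ((\<lambda>t. x t a) \<longlongrightarrow> x' a) F"
  shows "((\<lambda>t. msum n I (x t) e (w t)) \<longlongrightarrow> msum n I x' e (w' :: nat \<Rightarrow> 'a::{real_field,real_normed_field})) F"
  unfolding msum_def mon_def using assms by (intro tendsto_intros) auto

lemma poly_line_poly:
  assumes "j < n"
  shows "poly (line_poly n I c e w j) z = msum n I c e (w(j := z))"
  unfolding line_poly_def msum_def poly_sum poly_monom
  by (intro sum.cong refl) (simp add: mon_split[OF assms])

lemma pderiv_line_poly:
  fixes I :: "'i set" and w :: "nat \<Rightarrow> 'a::real_field"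
  shows "pderiv (line_poly n I c e w j) = line_poly n I (\<lambda>i. c i * real (e i j)) (\<lambda>i. (e i)(j := e i j - 1)) w j"
proof -
  have pr: "(\<Prod>k\<in>{..<n} - {j}. w k ^ ((e i)(j := v)) k) = (\<Prod>k\<in>{..<n} - {j}. w k ^ e i k)" for i v
    by (intro prod.cong) auto
  have ps: "pderiv (sum f J) = (\<Sum>i\<in>J. pderiv (f i))" for f :: "'i \<Rightarrow> 'a poly" and J
    by (induction J rule: infinite_finite_induct) (auto simp: pderiv_add)
  show ?thesis
    unfolding line_poly_def ps pderiv_monom pr fun_upd_same of_real_mult of_real_of_nat_eq
    by (simp only: mult_ac)
qed

lemma degree_line_poly:
  assumes "\<And>i. i \<in> I \<Longrightarrow> e i j \<le> d"
  shows "degree (line_poly n I c e w j) \<le> d"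
  unfolding line_poly_def
proof (cases "finite I")
  case True
  then show "degree (\<Sum>i\<in>I. monom (of_real (c i) * (\<Prod>k\<in>{..<n} - {j}. w k ^ e i k)) (e i j)) \<le> d"
    by (rule degree_sum_le) (use assms degree_monom_le order_trans in blast)
qed auto

text \<open>Recentring at \<open>y\<close> lets the order of a zero at \<open>y\<close> be read off
  the low coefficients.\<close>

definition shifted_line_poly :: "nat \<Rightarrow> 'i set \<Rightarrow> ('i \<Rightarrow> real) \<Rightarrow> ('i \<Rightarrow> nat \<Rightarrow> nat) \<Rightarrow> (nat \<Rightarrow> real) \<Rightarrow> nat \<Rightarrow> real poly" where
  "shifted_line_poly n I c e y j = pcompose (line_poly n I c e y j) [:y j, 1:]"

lemma poly_shifted_line_poly:
  "j < n \<Longrightarrow> poly (shifted_line_poly n I c e y j) z = msum n I c e (y(j := y j + z))"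
  by (simp add: shifted_line_poly_def poly_pcompose poly_line_poly)

lemma map_poly_line_poly: "map_poly of_real (line_poly n I c e y j) = (line_poly n I c e (\<lambda>i. of_real (y i)) j :: complex poly)"
  by (intro poly_eqI) (simp add: coeff_map_poly line_poly_def coeff_sum if_distrib cong: if_cong)

lemma cpoly_pcompose: "cpoly (pcompose p q) z = cpoly p (cpoly q z)"
  by (induction p) (auto simp: pcompose_pCons)

lemma cpoly_shifted_line_poly:
  "j < n \<Longrightarrow> cpoly (shifted_line_poly n I c e y j) z = msum n I c e ((\<lambda>i. of_real (y i))(j := of_real (y j) + z))"
  by (simp add: shifted_line_poly_def cpoly_pcompose map_poly_line_poly poly_line_poly)

lemma pderiv_shifted_line_poly:
  "pderiv (shifted_line_poly n I c e y j) = shifted_line_poly n I (\<lambda>i. c i * real (e i j)) (\<lambda>i. (e i)(j := e i j - 1)) y j"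
  by (simp add: shifted_line_poly_def pderiv_pcompose pderiv_line_poly pderiv_pCons)

section \<open>First-order operators acting on coefficients\<close>

abbreviation inc :: "nat \<Rightarrow> (nat \<Rightarrow> nat) \<Rightarrow> nat \<Rightarrow> nat" where
  "inc l a \<equiv> a(l := Suc (a l))"

lemma inc_eq_iff [simp]: "inc l a = inc l b \<longleftrightarrow> a = b"
  by (auto simp: fun_eq_iff)

lemma inc_commute: "inc l (inc k a) = inc k (inc l a)"
  by (auto simp: fun_eq_iff)

lemma mon_inc: "l < n \<Longrightarrow> mon n (inc l a) w = w l * mon n a w"
  by (simp add: mon_split[of l])

lemma inc_expos: "l < n \<Longrightarrow> inc l a \<in> expos n (Suc d) \<longleftrightarrow> a \<in> expos n d"
proof -
  assume l: "l < n"
  have "(\<Sum>i<n. (inc l a) i) = Suc (\<Sum>i<n. a i)"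
    using l by (subst (1 2) sum.remove[of _ l]) (auto intro!: sum.cong)
  then show ?thesis using l by (auto simp: expos_def)
qed

lemma expos_Suc_D: "inc l c \<in> expos n d \<Longrightarrow> l < n \<Longrightarrow> \<exists>e. d = Suc e"
  using expos_le[of "inc l c" n d l] by (cases d) auto

text \<open>The action of \<open>w\<^sub>k \<partial>\<^sub>l\<close> on coefficients.\<close>

definition hop :: "nat \<Rightarrow> nat \<Rightarrow> nat \<Rightarrow> nat \<Rightarrow> ((nat \<Rightarrow> nat) \<Rightarrow> real) \<Rightarrow> (nat \<Rightarrow> nat) \<Rightarrow> real" where
  "hop n d k l x a = (\<Sum>b\<in>expos n d. if inc l a = inc k b then real (b l) * x b else 0)"

text \<open>The condition \<open>inc l a = inc k b\<close> says, without subtraction, that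
  \<open>a\<close> arises from \<open>b\<close> by moving one unit from \<open>l\<close> to
  \<open>k\<close>. If \<open>b l = 0\<close>, the factor \<open>b l\<close> kills the term on both
  sides.\<close>

lemma ev_hop:
  assumes "k < n" "l < n"
  shows "ev n d (hop n d k l x) w = w k * dev n d l x w"
proof -
  let ?E = "expos n d"
  have "ev n d (hop n d k l x) w =
      (\<Sum>b\<in>?E. \<Sum>a\<in>?E. if inc l a = inc k b then of_real (real (b l) * x b) * mon n a w else 0)"
    unfolding msum_def hop_def of_real_sum sum_distrib_right
    by (subst sum.swap) (auto intro!: sum.cong)
  also have "\<dots> = (\<Sum>b\<in>?E. w k * (of_real (x b * real (b l)) * mon n (b(l := b l - 1)) w))"
  proof (intro sum.cong refl)
    fix b assume b: "b \<in> ?E"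
    show "(\<Sum>a\<in>?E. if inc l a = inc k b then of_real (real (b l) * x b) * mon n a w else 0) =
       w k * (of_real (x b * real (b l)) * mon n (b(l := b l - 1)) w)"
    proof (cases "b l = 0")
      case False
      define c where "c = b(l := b l - 1)"
      have bc: "b = inc l c" using False by (auto simp: c_def)
      then obtain e where e: "d = Suc e" using b expos_Suc_D assms by blast
      have "inc k c \<in> ?E" using b bc assms inc_expos e by metis
      moreover have "inc l a = inc k b \<longleftrightarrow> a = inc k c" for a
        unfolding bc using inc_commute[where k=l and l=k and a=c] inc_eq_iff[where l=l] by metis
      ultimately have "(\<Sum>a\<in>?E. if inc l a = inc k b then of_real (real (b l) * x b) * mon n a w else 0)
          = of_real (real (b l) * x b) * mon n (inc k c) w"
        by (simp add: sum.delta)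
      then show ?thesis unfolding mon_inc[OF assms(1)] c_def[symmetric] by (simp add: mult_ac)
    qed (simp cong: if_cong)
  qed
  finally show ?thesis by (simp add: msum_def sum_distrib_left)
qed

lemma hop_self: "a \<in> expos n d \<Longrightarrow> hop n d k k x a = real (a k) * x a"
  by (simp add: hop_def sum.delta')

lemma hop_nonneg: "(\<And>b. b \<in> expos n d \<Longrightarrow> x b \<ge> 0) \<Longrightarrow> hop n d k l x a \<ge> 0"
  unfolding hop_def by (intro sum_nonneg) auto

lemma msum_add: "msum n I (\<lambda>a. x a + y a) e w = msum n I x e w + msum n I y e w"
  by (simp add: msum_def algebra_simps sum.distrib)

lemma msum_mult: "msum n I (\<lambda>a. c * x a) e w = of_real c * msum n I x e w"
  by (simp add: msum_def algebra_simps sum_distrib_left)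

lemma msum_coeff_cong: "(\<And>a. a \<in> I \<Longrightarrow> x a = y a) \<Longrightarrow> msum n I x e w = msum n I y e w"
  by (simp add: msum_def)

lemma msum_sum: "finite J \<Longrightarrow> msum n I (\<lambda>a. \<Sum>j\<in>J. x j a) e w = (\<Sum>j\<in>J. msum n I (x j) e w)"
  by (induction J rule: finite_induct) (auto simp: msum_add msum_def)

section \<open>The closed cone of stable polynomials with nonnegative coefficients\<close>

definition nonneg_coeffs :: "nat \<Rightarrow> nat \<Rightarrow> ((nat \<Rightarrow> nat) \<Rightarrow> real) \<Rightarrow> bool" where
  "nonneg_coeffs n d x \<longleftrightarrow> (\<forall>a\<in>expos n d. x a \<ge> 0)"

definition stable_coeffs :: "nat \<Rightarrow> nat \<Rightarrow> ((nat \<Rightarrow> nat) \<Rightarrow> real) \<Rightarrow> bool" where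
  "stable_coeffs n d x \<longleftrightarrow> (\<forall>w :: nat \<Rightarrow> complex. (\<forall>j<n. Im (w j) > 0) \<longrightarrow> ev n d x w \<noteq> 0)"

text \<open>For nonzero homogeneous polynomials with nonnegative coefficients, stability is equivalent to
  \<open>f v \<le> \<bar>f (u + \<i> v)\<bar>\<close> for all \<open>v > 0\<close>. Unlike nonvanishing, this condition is visibly
  closed under limits, so no form of Hurwitz's theorem is needed.\<close>

definition stable_cone :: "nat \<Rightarrow> nat \<Rightarrow> ((nat \<Rightarrow> nat) \<Rightarrow> real) \<Rightarrow> bool" where
  "stable_cone n d x \<longleftrightarrow> nonneg_coeffs n d x \<and> (\<forall>u v. (\<forall>k<n. v k > 0) \<longrightarrow>
     ev n d x v \<le> cmod (ev n d x (\<lambda>i. Complex (u i) (v i))))"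

lemma stable_coeffsD: "stable_coeffs n d x \<Longrightarrow> \<forall>j<n. Im (w j) > 0 \<Longrightarrow> ev n d x w \<noteq> 0"
  by (auto simp: stable_coeffs_def)

lemma stable_line:
  assumes "stable_coeffs n d x" "\<forall>i<n. Im (w i) > 0" "j < n" "Im z > 0"
  shows "poly (line_poly n (expos n d) x (\<lambda>a. a) w j) z \<noteq> 0"
proof -
  have "\<forall>i<n. Im ((w(j := z)) i) > 0" using assms by auto
  then show ?thesis unfolding poly_line_poly[OF assms(3)] by (rule stable_coeffsD[OF assms(1)])
qed

lemma stable_hop:
  assumes "stable_coeffs n d x" "k < n" "l < n" "s \<ge> 0"
  shows "stable_coeffs n d (\<lambda>a. x a + s * hop n d k l x a)"
  unfolding stable_coeffs_def
proof (intro allI impI)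
  fix w :: "nat \<Rightarrow> complex" assume w: "\<forall>j<n. Im (w j) > 0"
  let ?p = "line_poly n (expos n d) x (\<lambda>a. a) w l"
  have "poly ?p (w l) + of_real s * w k * poly (pderiv ?p) (w l) \<noteq> 0"
    by (rule poly_add_mult_pderiv_neq_0) (use stable_line assms w in auto)
  then show "ev n d (\<lambda>a. x a + s * hop n d k l x a) w \<noteq> 0"
    using assms by (simp add: pderiv_line_poly poly_line_poly msum_add msum_mult ev_hop mult.assoc)
qed

lemma stable_hop_minus:
  assumes "stable_coeffs n d x" "l < n" "s \<ge> 0" "s * real d < 1"
  shows "stable_coeffs n d (\<lambda>a. x a + (- s) * hop n d l l x a)"
  unfolding stable_coeffs_def
proof (intro allI impI)
  fix w :: "nat \<Rightarrow> complex" assume w: "\<forall>j<n. Im (w j) > 0"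
  let ?p = "line_poly n (expos n d) x (\<lambda>a. a) w l"
  have "poly ?p (w l) - of_real s * w l * poly (pderiv ?p) (w l) \<noteq> 0"
    by (rule poly_diff_mult_pderiv_neq_0[where d=d]) (use stable_line assms w in \<open>auto intro: degree_line_poly expos_le\<close>)
  then show "ev n d (\<lambda>a. x a + (- s) * hop n d l l x a) w \<noteq> 0"
    unfolding msum_add msum_mult using assms by (simp add: pderiv_line_poly poly_line_poly ev_hop mult.assoc)
qed

lemma stable_coeff_cong: "(\<And>a. a \<in> expos n d \<Longrightarrow> x a = y a) \<Longrightarrow> stable_coeffs n d x = stable_coeffs n d y"
  unfolding stable_coeffs_def by (simp cong: msum_coeff_cong)

text \<open>Difference of squares: \<open>1 - s (w \<partial>)\<^sup>2\<close> is the product of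
  \<open>1 - sqrt s w \<partial>\<close> and \<open>1 + sqrt s w \<partial>\<close>, and both
  factors preserve stability when \<open>sqrt s * d < 1\<close>.\<close>

lemma stable_diag:
  assumes "stable_coeffs n d x" "l < n" "s \<ge> 0" "s * (real d)\<^sup>2 < 1"
  shows "stable_coeffs n d (\<lambda>a. x a - s * (real (a l))\<^sup>2 * x a)"
proof -
  have "sqrt s * real d = sqrt (s * (real d)\<^sup>2)" by (simp add: real_sqrt_mult)
  also have "\<dots> < 1" using assms by simp
  finally have q: "sqrt s * real d < 1" .
  have "stable_coeffs n d (\<lambda>a. (x a + sqrt s * hop n d l l x a) +
      (- sqrt s) * hop n d l l (\<lambda>a. x a + sqrt s * hop n d l l x a) a)"
    using assms q by (intro stable_hop_minus stable_hop) auto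
  also have "?this \<longleftrightarrow> ?thesis"
    using assms by (intro stable_coeff_cong) (simp add: hop_self algebra_simps power2_eq_square)
  finally show ?thesis .
qed

lemma mon_pos: "(\<And>i. i < n \<Longrightarrow> v i > (0::real)) \<Longrightarrow> mon n a v > 0"
  unfolding mon_def by (intro prod_pos) auto

lemma mon_nonneg: "(\<And>i. i < n \<Longrightarrow> v i \<ge> (0::real)) \<Longrightarrow> mon n a v \<ge> 0"
  unfolding mon_def by (intro prod_nonneg) auto

lemma ev_pos:
  assumes "nonneg_coeffs n d x" "\<exists>a\<in>expos n d. x a \<noteq> 0" "\<And>i. i < n \<Longrightarrow> v i > (0::real)"
  shows "ev n d x v > 0"
proof -
  obtain a where a: "a \<in> expos n d" "x a \<noteq> 0" using assms by blast
  then have "x a > 0" using assms(1) by (force simp: nonneg_coeffs_def)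
  moreover have p: "mon n b v > 0" for b by (rule mon_pos) (rule assms)
  ultimately have "0 < of_real (x a) * mon n a v" by simp
  then show ?thesis unfolding msum_def using a
    by (intro sum_pos2[of _ a]) (use assms(1) p in \<open>auto simp: nonneg_coeffs_def intro!: mult_nonneg_nonneg less_imp_le[OF p]\<close>)
qed

lemma stable_coneD:
  "stable_cone n d x \<Longrightarrow> \<forall>k<n. v k > 0 \<Longrightarrow> ev n d x v \<le> cmod (ev n d x (\<lambda>i. Complex (u i) (v i)))"
  by (auto simp: stable_cone_def)

lemma stable_cone_imp_stable:
  assumes "stable_cone n d x" "\<exists>a\<in>expos n d. x a \<noteq> 0"
  shows "stable_coeffs n d x"
  unfolding stable_coeffs_def
proof (intro allI impI)
  fix w :: "nat \<Rightarrow> complex" assume w: "\<forall>j<n. Im (w j) > 0"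
  have "0 < ev n d x (\<lambda>i. Im (w i))" using assms w by (intro ev_pos) (auto simp: stable_cone_def)
  also have "\<dots> \<le> cmod (ev n d x (\<lambda>i. Complex (Re (w i)) (Im (w i))))"
    by (rule stable_coneD[OF assms(1)]) (rule w)
  finally show "ev n d x w \<noteq> 0" by auto
qed

text \<open>For \<open>v > 0\<close>, the univariate polynomial \<open>f (v + z u)\<close> is real rooted.\<close>

lemma stable_imp_stable_cone:
  assumes "stable_coeffs n d x" "nonneg_coeffs n d x"
  shows "stable_cone n d x"
  unfolding stable_cone_def
proof (intro conjI allI impI assms(2))
  fix u v :: "nat \<Rightarrow> real" assume v: "\<forall>k<n. v k > 0"
  define p where "p = (\<Sum>a\<in>expos n d. smult (x a) (\<Prod>i<n. [:v i, u i:] ^ a i))"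
  have cprod: "cpoly (\<Prod>i<n. [:v i, u i:] ^ a i) z = (\<Prod>i<n. (of_real (v i) + z * of_real (u i)) ^ a i)" for a z
  proof -
    have pw: "cpoly (q ^ m) z = cpoly q z ^ m" for q m by (induction m) auto
    have "cpoly (prod f I) z = (\<Prod>i\<in>I. cpoly (f i) z)" if "finite I" for f and I :: "nat set"
      using that by (induction I rule: finite_induct) auto
    then show ?thesis by (simp add: pw)
  qed
  have csum: "cpoly (sum f I) z = (\<Sum>i\<in>I. cpoly (f i) z)" if "finite I" for f z and I :: "(nat \<Rightarrow> nat) set"
    using that by (induction I rule: finite_induct) auto
  have cp: "cpoly p z = ev n d x (\<lambda>i. of_real (v i) + z * of_real (u i))" for z
    by (simp add: p_def csum cprod msum_def mon_def)
  have "cpoly p z \<noteq> 0" if z: "Im z > 0" for z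
  proof -
    have z0: "z \<noteq> 0" using z by auto
    have i: "Im (- 1 / z) > 0" using z by (simp add: Im_divide sum_power2_gt_zero_iff)
    \<comment> \<open>\<open>q\<close> lies in the upper half plane again, hence so does every
      coordinate of \<open>q * (v + z * u) = v * q - u\<close>; homogeneity moves the factor
      \<open>q ^ d\<close> outside.\<close>
    define q where "q = - 1 / z"
    let ?w = "\<lambda>i. q * (of_real (v i) + z * of_real (u i))"
    have w: "?w i = of_real (v i) * q - of_real (u i)" for i
      using z0 by (simp add: field_simps q_def)
    have im: "Im (?w i) = v i * Im q" for i unfolding w by simp
    have "Im q > 0" using i unfolding q_def .
    then have "\<forall>j<n. Im (?w j) > 0" unfolding im using v by simp
    then have "ev n d x ?w \<noteq> 0" by (rule stable_coeffsD[OF assms(1)])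
    then show ?thesis unfolding ev_scale cp by auto
  qed
  then have "\<bar>poly p 0\<bar> \<le> cmod (cpoly p (- \<i>))" by (rule cmod_poly_ge_real_rooted)
  moreover have "of_real (poly p 0) = (of_real (ev n d x v) :: complex)"
    using cp[of 0] cpoly_of_real[of p 0] by (simp add: msum_of_real)
  then have "poly p 0 = ev n d x v" by (simp only: of_real_eq_iff)
  moreover have "cmod (ev n d x (\<lambda>i. Complex (u i) (v i))) = cmod (cpoly p (- \<i>))"
  proof -
    \<comment> \<open>By homogeneity the unit factor \<open>\<i>\<close> does not change the
      modulus, so the value at \<open>u + \<i> v\<close> is that of \<open>p\<close> at
      \<open>- \<i>\<close>.\<close>
    have "(\<lambda>i. Complex (u i) (v i)) = (\<lambda>i. \<i> * (of_real (v i) + (- \<i>) * of_real (u i)))"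
      by (auto simp: fun_eq_iff complex_eq_iff)
    then show ?thesis unfolding cp by (simp only: ev_scale norm_mult norm_power norm_ii power_one mult_1)
  qed
  ultimately show "ev n d x v \<le> cmod (ev n d x (\<lambda>i. Complex (u i) (v i)))" by linarith
qed

text \<open>Raise every \<open>v k\<close> by \<open>e > 0\<close> and let \<open>e\<close> tend to
  \<open>0\<close>. Allowing \<open>v k = 0\<close> makes the estimate available on lines through
  real points, where a single coordinate has positive imaginary part.\<close>

lemma stable_cone_closed_orthant:
  assumes "stable_cone n d x" "\<And>k. k < n \<Longrightarrow> v k \<ge> 0"
  shows "ev n d x v \<le> cmod (ev n d x (\<lambda>i. Complex (u i) (v i)))"
proof (rule tendsto_le)
  let ?F = "at_right (0::real)"
  show "((\<lambda>e. ev n d x (\<lambda>i. v i + e)) \<longlongrightarrow> ev n d x v) ?F"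
    by (rule tendsto_msum) (auto intro!: tendsto_eq_intros)
  show "((\<lambda>e. cmod (ev n d x (\<lambda>i. Complex (u i) (v i + e)))) \<longlongrightarrow> cmod (ev n d x (\<lambda>i. Complex (u i) (v i)))) ?F"
    by (intro tendsto_norm tendsto_msum) (auto intro!: tendsto_eq_intros)
  show "eventually (\<lambda>e. ev n d x (\<lambda>i. v i + e) \<le> cmod (ev n d x (\<lambda>i. Complex (u i) (v i + e)))) ?F"
    using eventually_at_right_less[of 0]
  proof eventually_elim
    case (elim e)
    then have "\<forall>k<n. v k + e > 0" using assms(2) by (simp add: add_nonneg_pos)
    then show ?case by (rule stable_coneD[OF assms(1)])
  qed
qed auto

text \<open>Both inequalities hold in the open product of half planes by the univariate case, and
  pass to its closure because they contain no division.\<close>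

lemma stable_Im_dev_le:
  assumes "stable_coeffs n d x" "\<And>i. i < n \<Longrightarrow> Im (w i) \<ge> 0" "l < n"
  shows "Im (dev n d l x w * cnj (ev n d x w)) \<le> 0"
    and "Im (ddev n d l x w * cnj (dev n d l x w)) \<le> 0"
proof -
  let ?F = "at_right (0::real)" and ?w = "\<lambda>e i. w i + of_real e * \<i>"
  have ww: "((\<lambda>e. ?w e i) \<longlongrightarrow> w i) ?F" for i by (auto intro!: tendsto_eq_intros)
  have fu: "(?w e)(l := ?w e l) = ?w e" for e by (auto simp: fun_eq_iff)
  have ev: "eventually (\<lambda>e. \<forall>i<n. Im (?w e i) > 0) ?F"
    using eventually_at_right_less[of 0] by eventually_elim (simp add: assms(2) add_nonneg_pos)
  let ?p = "\<lambda>w. line_poly n (expos n d) x (\<lambda>a. a) w l"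
  have "eventually (\<lambda>e. Im (dev n d l x (?w e) * cnj (ev n d x (?w e))) \<le> 0) ?F"
    using ev
  proof eventually_elim
    case (elim e)
    then have "Im (poly (pderiv (?p (?w e))) (?w e l) * cnj (poly (?p (?w e)) (?w e l))) \<le> 0"
      by (intro Im_pderiv_le) (use stable_line assms elim in auto)
    then show ?case unfolding pderiv_line_poly poly_line_poly[OF assms(3)] fu .
  qed
  then show "Im (dev n d l x w * cnj (ev n d x w)) \<le> 0"
    by (rule tendsto_upperbound[rotated]) (auto intro!: tendsto_intros ww)
  have "eventually (\<lambda>e. Im (ddev n d l x (?w e) * cnj (dev n d l x (?w e))) \<le> 0) ?F"
    using ev
  proof eventually_elim
    case (elim e)
    then have "Im (poly (pderiv (pderiv (?p (?w e)))) (?w e l) * cnj (poly (pderiv (?p (?w e))) (?w e l))) \<le> 0"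
      by (intro Im_pderiv2_le) (use stable_line assms elim in auto)
    then show ?case unfolding pderiv_line_poly poly_line_poly[OF assms(3)] fu by (simp add: mult.assoc)
  qed
  then show "Im (ddev n d l x w * cnj (dev n d l x w)) \<le> 0"
    by (rule tendsto_upperbound[rotated]) (auto intro!: tendsto_intros ww)
qed

section \<open>Spectral theory of irreducible symmetric matrices\<close>

text \<open>Detailed balance: \<open>symm\<close> makes \<open>M\<close> self-adjoint for the
  weighted inner product \<open>ip\<close>.\<close>

locale weighted_symmetric =
  fixes I :: "'i set" and p :: "'i \<Rightarrow> real" and M :: "'i \<Rightarrow> 'i \<Rightarrow> real"
  assumes fin [simp]: "finite I"
    and p_pos: "i \<in> I \<Longrightarrow> p i > 0"
    and symm: "i \<in> I \<Longrightarrow> j \<in> I \<Longrightarrow> p i * M i j = p j * M j i"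
begin

definition ip :: "('i \<Rightarrow> real) \<Rightarrow> ('i \<Rightarrow> real) \<Rightarrow> real" where
  "ip x y = (\<Sum>i\<in>I. p i * x i * y i)"

definition app :: "('i \<Rightarrow> real) \<Rightarrow> 'i \<Rightarrow> real" where
  "app x i = (\<Sum>j\<in>I. M i j * x j)"

lemma ip_commute: "ip x y = ip y x"
  by (simp add: ip_def mult_ac)

lemma ip_add: "ip (\<lambda>i. x i + y i) z = ip x z + ip y z"
  by (simp add: ip_def sum.distrib algebra_simps)

lemma ip_mult: "ip (\<lambda>i. c * x i) z = c * ip x z"
  by (simp add: ip_def sum_distrib_left algebra_simps)

lemma ip_sum: "finite J \<Longrightarrow> ip (\<lambda>i. \<Sum>j\<in>J. x j i) z = (\<Sum>j\<in>J. ip (x j) z)"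
  by (simp add: ip_def sum_distrib_left sum_distrib_right sum.swap[of _ I])

lemma ip_mult2: "ip (\<lambda>i. a * x i) (\<lambda>i. b * y i) = a * b * ip x y"
  by (simp add: ip_def sum_distrib_left mult_ac)

lemma ip_lincomb: "finite J \<Longrightarrow> ip (\<lambda>i. \<Sum>j\<in>J. c j * x j i) z = (\<Sum>j\<in>J. c j * ip (x j) z)"
  by (simp add: ip_sum ip_mult)

lemma ip_cong: "(\<And>i. i \<in> I \<Longrightarrow> x i = x' i) \<Longrightarrow> (\<And>i. i \<in> I \<Longrightarrow> y i = y' i) \<Longrightarrow> ip x y = ip x' y'"
  by (simp add: ip_def)

lemma app_add: "app (\<lambda>i. x i + y i) i = app x i + app y i"
  by (simp add: app_def sum.distrib algebra_simps)

lemma app_mult: "app (\<lambda>i. c * x i) i = c * app x i"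
  by (simp add: app_def sum_distrib_left algebra_simps)

lemma app_cong: "(\<And>i. i \<in> I \<Longrightarrow> x i = y i) \<Longrightarrow> app x i = app y i"
  by (simp add: app_def)

lemma app_adjoint: "ip (app x) y = ip x (app y)"
proof -
  have "ip (app x) y = (\<Sum>i\<in>I. \<Sum>j\<in>I. p i * M i j * x j * y i)"
    by (simp add: ip_def app_def sum_distrib_left sum_distrib_right mult_ac)
  also have "\<dots> = (\<Sum>i\<in>I. \<Sum>j\<in>I. p j * M j i * x j * y i)"
    using symm by (intro sum.cong refl) auto
  also have "\<dots> = ip x (app y)"
    by (subst sum.swap) (simp add: ip_def app_def sum_distrib_left mult_ac)
  finally show ?thesis .
qed

lemma term_nonneg: "i \<in> I \<Longrightarrow> 0 \<le> p i * x i * x i"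
  using p_pos[of i] by (simp add: mult.assoc)

lemma ip_self_nonneg: "ip x x \<ge> 0"
  unfolding ip_def by (intro sum_nonneg term_nonneg)

lemma ip_self_eq_0: "ip x x = 0 \<Longrightarrow> i \<in> I \<Longrightarrow> x i = 0"
proof -
  assume 0: "ip x x = 0" and i: "i \<in> I"
  have "\<forall>i\<in>I. p i * x i * x i = 0"
    using 0 unfolding ip_def by (subst (asm) sum_nonneg_eq_0_iff)
      (use term_nonneg in auto)
  then show "x i = 0" using i p_pos[OF i] by auto
qed

definition eigen_family :: "nat \<Rightarrow> (nat \<Rightarrow> 'i \<Rightarrow> real) \<Rightarrow> (nat \<Rightarrow> real) \<Rightarrow> bool" where
  "eigen_family m v \<mu> \<longleftrightarrow> (\<forall>k<m. \<forall>l<m. ip (v k) (v l) = (if k = l then 1 else 0)) \<and>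
     (\<forall>k<m. \<forall>i\<in>I. app (v k) i = \<mu> k * v k i)"

text \<open>Trace argument: the sums of \<open>p i * (v k i)\<^sup>2\<close> over \<open>k\<close>
  add up to \<open>m < card I\<close>, so at some \<open>i0\<close> the sum is below
  \<open>1\<close>. The unit vector at \<open>i0\<close> minus its projection then has a positive
  entry at \<open>i0\<close>.\<close>

lemma exists_orthogonal:
  assumes "eigen_family m v \<mu>" "m < card I"
  shows "\<exists>x. (\<forall>k<m. ip x (v k) = 0) \<and> ip x x > 0"
proof -
  have "(\<Sum>i\<in>I. \<Sum>k<m. p i * (v k i)\<^sup>2) = (\<Sum>k<m. ip (v k) (v k))"
    by (subst sum.swap) (simp add: ip_def power2_eq_square mult_ac)
  also have "\<dots> = real m" using assms(1) by (simp add: eigen_family_def)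
  also have "\<dots> < (\<Sum>i\<in>I. 1)" using assms(2) by simp
  finally obtain i0 where i0: "i0 \<in> I" "(\<Sum>k<m. p i0 * (v k i0)\<^sup>2) < 1"
    by (meson not_le sum_mono)
  define x where "x = (\<lambda>i. (if i = i0 then 1 else 0) + (\<Sum>k<m. (- p i0 * v k i0) * v k i))"
  have d: "ip (\<lambda>i. if i = i0 then 1 else 0) z = p i0 * z i0" for z
    using i0 by (simp add: ip_def if_distrib if_distribR sum.delta cong: if_cong)
  have "ip x (v l) = 0" if l: "l < m" for l
  proof -
    have "ip x (v l) = p i0 * v l i0 + (\<Sum>k<m. (- p i0 * v k i0) * ip (v k) (v l))"
      unfolding x_def ip_add d by (subst ip_sum) (simp_all only: ip_mult finite_lessThan)
    also have "(\<Sum>k<m. (- p i0 * v k i0) * ip (v k) (v l)) = (\<Sum>k<m. if k = l then - p i0 * v l i0 else 0)"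
      using assms(1) l by (intro sum.cong) (auto simp: eigen_family_def)
    also have "\<dots> = - p i0 * v l i0" using l by simp
    finally show ?thesis by simp
  qed
  moreover have "x i0 > 0"
    using i0 by (simp add: x_def sum_negf power2_eq_square mult_ac)
  then have "ip x x > 0" using ip_self_eq_0[OF _ i0(1), of x] ip_self_nonneg[of x] by force
  ultimately show ?thesis by blast
qed

text \<open>Being zero outside \<open>I\<close> puts the sphere into a product of compact intervals
  of half-width \<open>1 / sqrt (p i)\<close>, so Tychonoff applies on the full function
  space.\<close>

lemma compact_sphere:
  "compact {x. (\<forall>i. i \<notin> I \<longrightarrow> x i = 0) \<and> ip x x = 1 \<and> (\<forall>k<m. ip x (v k) = 0)}" (is "compact ?S")
proof -
  define r where "r i = 1 / sqrt (p i)" for i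
  let ?B = "\<lambda>i. if i \<in> I then {- r i..r i} else {0}"
  have "compactin (product_topology (\<lambda>i. euclidean) UNIV) (PiE UNIV ?B)"
    by (subst compactin_PiE) auto
  then have C: "compact (PiE UNIV ?B)" by (simp add: euclidean_product_topology)
  have cl: "closed ?S"
    unfolding ip_def imp_conv_disj
    by (intro closed_Collect_conj closed_Collect_all closed_Collect_disj closed_Collect_eq closed_Collect_const
        continuous_intros continuous_on_product_coordinates)
  have sub: "?S \<subseteq> PiE UNIV ?B"
  proof
    fix x assume "x \<in> ?S"
    then have x: "\<forall>i. i \<notin> I \<longrightarrow> x i = 0" "ip x x = 1" by auto
    have "x i \<in> ?B i" for i
    proof (cases "i \<in> I")
      case True
      have "p i * x i * x i \<le> ip x x" unfolding ip_def
        by (intro member_le_sum[OF True]) (use term_nonneg in auto)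
      then have "(x i)\<^sup>2 \<le> 1 / p i" using x(2) p_pos[OF True] by (simp add: field_simps power2_eq_square)
      then have "\<bar>x i\<bar> \<le> sqrt (1 / p i)" by (metis real_sqrt_abs real_sqrt_le_mono)
      then show ?thesis using True by (auto simp: r_def real_sqrt_divide abs_le_iff)
    qed (use x in auto)
    then show "x \<in> PiE UNIV ?B" by (simp add: PiE_iff)
  qed
  show ?thesis using compact_Int_closed[OF C cl] sub by (simp add: Int_absorb1)
qed

lemma quadratic_nonpos:
  fixes b c :: real
  assumes "\<And>t. 2 * t * b + t\<^sup>2 * c \<le> 0"
  shows "b = 0"
proof (rule ccontr)
  assume b: "b \<noteq> 0"
  define C where "C = \<bar>c\<bar> + 1"
  have C: "C > 0" "c \<ge> - C" by (auto simp: C_def)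
  \<comment> \<open>With \<open>t = b / C\<close> the quadratic term is at most half the linear one
    in size, which leaves \<open>b\<^sup>2 / C \<le> 0\<close>.\<close>
  have "2 * (b / C) * b + (b / C)\<^sup>2 * (- C) \<le> 2 * (b / C) * b + (b / C)\<^sup>2 * c"
    using C by (intro add_left_mono mult_left_mono) auto
  also have "\<dots> \<le> 0" by (rule assms)
  also have "2 * (b / C) * b + (b / C)\<^sup>2 * (- C) = b\<^sup>2 / C"
    using C by (simp add: field_simps power2_eq_square)
  finally show False using C b by (simp add: divide_le_0_iff)
qed

text \<open>A maximiser \<open>x\<close> of the Rayleigh quotient on the orthogonal complement is an
  eigenvector: the residual \<open>r\<close> is orthogonal to the complement by first variation and
  lies in it because \<open>M\<close> is self-adjoint, so \<open>ip r r = 0\<close>.\<close>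

lemma eigen_family_extend:
  assumes F: "eigen_family m v \<mu>" and m: "m < card I"
  shows "\<exists>v \<mu>. eigen_family (Suc m) v \<mu>"
proof -
  let ?S = "{x. (\<forall>i. i \<notin> I \<longrightarrow> x i = 0) \<and> ip x x = 1 \<and> (\<forall>k<m. ip x (v k) = 0)}"
  \<comment> \<open>Values outside \<open>I\<close> are invisible to \<open>ip\<close> and
    \<open>app\<close>, but must be zero for membership in the compact sphere.\<close>
  define cut where "cut x i = (if i \<in> I then x i else 0)" for x :: "'i \<Rightarrow> real" and i
  have icut: "ip (cut x) y = ip x y" "ip y (cut x) = ip y x" "app (cut x) = app x" for x y
    by (auto simp: cut_def fun_eq_iff intro!: ip_cong app_cong)
  define nrm where "nrm x = cut (\<lambda>i. (1 / sqrt (ip x x)) * x i)" for x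
  have nrm: "nrm x \<in> ?S" "ip (nrm x) (app (nrm x)) = ip x (app x) / ip x x"
    if "ip x x > 0" "\<forall>k<m. ip x (v k) = 0" for x
  proof -
    have *: "ip (\<lambda>i. c * x i) (\<lambda>i. c * y i) = c\<^sup>2 * ip x y" for c y
      by (simp add: ip_mult ip_commute[of x] ip_commute[of _ "\<lambda>i. c * y i"] power2_eq_square)
    define c where "c = 1 / sqrt (ip x x)"
    have c: "c\<^sup>2 * ip x x = 1" using that by (simp add: c_def power_divide)
    show "nrm x \<in> ?S"
      using that c unfolding nrm_def c_def[symmetric] by (simp add: icut * ip_mult) (simp add: cut_def)
    have "app (\<lambda>i. c * x i) = (\<lambda>i. c * app x i)" for c by (auto simp: app_mult)
    then show "ip (nrm x) (app (nrm x)) = ip x (app x) / ip x x"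
      using that unfolding nrm_def icut by (simp only: *) (simp add: power_divide)
  qed
  have ne: "?S \<noteq> {}" using exists_orthogonal[OF F m] nrm(1) by blast
  have co: "continuous_on A (\<lambda>x. x i)" for i :: 'i and A :: "('i \<Rightarrow> real) set"
    by (rule continuous_on_subset[OF continuous_on_product_coordinates subset_UNIV])
  have "continuous_on ?S (\<lambda>x. ip x (app x))"
    unfolding ip_def app_def by (intro continuous_intros co)
  from continuous_attains_sup[OF compact_sphere ne this]
  obtain x where x: "x \<in> ?S" and mx: "\<forall>z\<in>?S. ip z (app z) \<le> ip x (app x)"
    by (elim bexE) (rule that)
  define \<nu> where "\<nu> = ip x (app x)"
  define r where "r i = app x i + (- \<nu>) * x i" for i
  have bd: "ip z (app z) \<le> \<nu> * ip z z" if "\<forall>k<m. ip z (v k) = 0" for z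
  proof (cases "ip z z = 0")
    case True
    have "ip z (app z) = 0"
      using ip_self_eq_0[OF True] by (simp add: ip_def)
    then show ?thesis using True by simp
  next
    case False
    then have pos: "ip z z > 0" using ip_self_nonneg[of z] by linarith
    have "ip z (app z) / ip z z \<le> \<nu>"
      using bspec[OF mx nrm(1)[OF pos that]] nrm(2)[OF pos that] by (simp add: \<nu>_def)
    then show ?thesis using pos by (simp add: field_simps)
  qed
  have orth: "ip y r = 0" if y: "\<forall>k<m. ip y (v k) = 0" for y
  proof (rule quadratic_nonpos)
    fix t
    let ?z = "\<lambda>i. x i + t * y i"
    have zk: "\<forall>k<m. ip ?z (v k) = 0" using x y by (simp add: ip_add ip_mult)
    have az: "app ?z = (\<lambda>i. app x i + t * app y i)" by (auto simp: app_add app_mult)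
    have ryx: "ip y r = ip y (app x) - \<nu> * ip y x"
      unfolding r_def ip_commute[of y] ip_add ip_mult by simp
    have sy: "ip x (app y) = ip y (app x)" using app_adjoint[of y x] ip_commute by metis
    have add2: "ip u (\<lambda>i. f i + c * g i) = ip u f + c * ip u g" for u f g c
      unfolding ip_commute[of u] ip_add ip_mult ..
    have "ip ?z (app ?z) - \<nu> * ip ?z ?z \<le> 0" using bd[OF zk] by simp
    moreover have "ip ?z (app ?z) = ip x (app x) + 2 * t * ip y (app x) + t\<^sup>2 * ip y (app y)"
      unfolding az add2 unfolding ip_add ip_mult sy by (simp add: algebra_simps power2_eq_square)
    moreover have "ip ?z ?z = ip x x + 2 * t * ip y x + t\<^sup>2 * ip y y"
      unfolding add2 unfolding ip_add ip_mult ip_commute[of x y] by (simp add: algebra_simps power2_eq_square)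
    moreover have "ip x x = 1" using x by simp
    ultimately show "2 * t * ip y r + t\<^sup>2 * (ip y (app y) - \<nu> * ip y y) \<le> 0"
      unfolding ryx \<nu>_def by (simp add: algebra_simps)
  qed
  have xv: "ip x (v k) = 0" "ip (v k) x = 0" if "k < m" for k
    using x that ip_commute[of x "v k"] by auto
  have rv: "ip r (v k) = 0" if k: "k < m" for k
  proof -
    have "ip (app x) (v k) = ip x (app (v k))" by (rule app_adjoint)
    also have "\<dots> = ip x (\<lambda>i. \<mu> k * v k i)"
      using F k by (intro ip_cong) (auto simp: eigen_family_def)
    also have "\<dots> = \<mu> k * ip (v k) x" by (simp only: ip_commute[of x "\<lambda>i. \<mu> k * v k i"] ip_mult)
    also have "\<dots> = 0" using xv k by simp
    finally show ?thesis using xv k unfolding r_def ip_add ip_mult by simp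
  qed
  have r0: "r i = 0" if "i \<in> I" for i
    by (rule ip_self_eq_0[OF orth that]) (simp add: rv)
  have "eigen_family (Suc m) (v(m := x)) (\<mu>(m := \<nu>))"
    unfolding eigen_family_def
  proof (intro conjI allI impI ballI)
    fix k l assume "k < Suc m" "l < Suc m"
    moreover have "ip x x = 1" using x by simp
    moreover have "ip (v k) (v l) = (if k = l then 1 else 0)" if "k < m" "l < m"
      using F that unfolding eigen_family_def by blast
    ultimately show "ip ((v(m := x)) k) ((v(m := x)) l) = (if k = l then 1 else 0)"
      using xv[of k] xv[of l] by (cases "k = m"; cases "l = m") simp_all
  next
    fix k i assume k: "k < Suc m" and i: "i \<in> I"
    show "app ((v(m := x)) k) i = (\<mu>(m := \<nu>)) k * (v(m := x)) k i"
    proof (cases "k = m")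
      case True
      then show ?thesis using r0[OF i] by (simp add: r_def)
    next
      case False
      then show ?thesis using F k i by (simp add: eigen_family_def)
    qed
  qed
  then show ?thesis by blast
qed

lemma spectral:
  obtains v \<mu> where "eigen_family (card I) v \<mu>"
proof -
  have "m \<le> card I \<Longrightarrow> \<exists>v \<mu>. eigen_family m v \<mu>" for m
  proof (induction m)
    case 0
    then show ?case by (auto simp: eigen_family_def)
  next
    case (Suc m)
    then show ?case using eigen_family_extend by (metis Suc_le_lessD less_imp_le)
  qed
  then show ?thesis using that by blast
qed

text \<open>By Bessel the sum of \<open>p j * (v k j)\<^sup>2\<close> over \<open>k\<close> is at
  most \<open>1\<close>, and over all \<open>j\<close> these sums add up to \<open>card I\<close>,
  so each equals \<open>1\<close>. Hence the residual \<open>e j\<close> of the unit vector at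
  \<open>j\<close> has norm zero, and pairing it with the residual \<open>y\<close> of
  \<open>x\<close> gives \<open>p j * y j = 0\<close>.\<close>

lemma eigen_family_complete:
  assumes F: "eigen_family (card I) v \<mu>" and "i \<in> I"
  shows "x i = (\<Sum>k<card I. ip x (v k) * v k i)"
proof -
  have bessel: "(\<Sum>k<card I. p j * (v k j)\<^sup>2) \<le> 1" if j: "j \<in> I" for j
  proof -
    define S where "S = (\<Sum>k<card I. (v k j)\<^sup>2)"
    \<comment> \<open>Up to the factor \<open>p j\<close> this is the projection of the unit vector
      at \<open>j\<close>; its squared norm and its entry at \<open>j\<close> are both
      \<open>S\<close>.\<close>
    define y where "y = (\<lambda>i. \<Sum>k<card I. v k j * v k i)"
    have "ip (v k) y = v k j" if k: "k < card I" for k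
    proof -
      have "ip y (v k) = (\<Sum>l<card I. v l j * ip (v l) (v k))"
        unfolding y_def by (rule ip_lincomb) simp
      also have "\<dots> = (\<Sum>l<card I. if l = k then v k j else 0)"
        using F k by (intro sum.cong refl) (auto simp: eigen_family_def)
      finally show ?thesis using k by (subst ip_commute) simp
    qed
    moreover have "ip y y = (\<Sum>k<card I. v k j * ip (v k) y)"
      by (subst (1) y_def) (rule ip_lincomb, simp)
    ultimately have "ip y y = S" by (simp add: S_def power2_eq_square)
    moreover have "y j = S" by (simp add: y_def S_def power2_eq_square)
    moreover have "p j * y j * y j \<le> ip y y" unfolding ip_def
      by (intro member_le_sum[OF j]) (use term_nonneg in auto)
    ultimately have "p j * S * S \<le> S" by simp
    then have "p j * (p j * S * S) \<le> p j * S" using p_pos[OF j] by (intro mult_left_mono) auto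
    then have "(p j * S) * (p j * S) \<le> p j * S" by (simp only: mult_ac)
    moreover have "c * c \<le> c \<Longrightarrow> c \<le> 1" for c :: real
      using mult_strict_right_mono[of 1 c c] by (cases "c > 1") auto
    ultimately have "p j * S \<le> 1" by blast
    then show ?thesis by (simp add: S_def sum_distrib_left)
  qed
  have tot: "(\<Sum>j\<in>I. \<Sum>k<card I. p j * (v k j)\<^sup>2) = (\<Sum>j\<in>I. 1)"
  proof -
    have "(\<Sum>j\<in>I. \<Sum>k<card I. p j * (v k j)\<^sup>2) = (\<Sum>k<card I. ip (v k) (v k))"
      by (subst sum.swap) (simp add: ip_def power2_eq_square mult_ac)
    also have "\<dots> = real (card I)" using F by (simp add: eigen_family_def)
    finally show ?thesis by simp
  qed
  define e where "e j = (\<lambda>i. (if i = j then 1 else 0) + (\<Sum>k<card I. (- p j * v k j) * v k i))" for j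
  define y where "y i = x i + (\<Sum>k<card I. (- ip x (v k)) * v k i)" for i
  have yv: "ip y (v l) = 0" if l: "l < card I" for l
  proof -
    have "ip y (v l) = ip x (v l) + (\<Sum>k<card I. (- ip x (v k)) * ip (v k) (v l))"
      unfolding y_def ip_add by (subst ip_sum) (simp_all only: ip_mult finite_lessThan)
    also have "(\<Sum>k<card I. (- ip x (v k)) * ip (v k) (v l)) = (\<Sum>k<card I. if k = l then - ip x (v l) else 0)"
      using F l by (intro sum.cong) (auto simp: eigen_family_def)
    finally show ?thesis using l by simp
  qed
  have one: "(\<Sum>k<card I. p j * (v k j)\<^sup>2) = 1" if j: "j \<in> I" for j
  proof (rule ccontr)
    assume "\<not> ?thesis"
    then have "(\<Sum>k<card I. p j * (v k j)\<^sup>2) < 1" using bessel[OF j] by linarith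
    then have "(\<Sum>j\<in>I. \<Sum>k<card I. p j * (v k j)\<^sup>2) < (\<Sum>j\<in>I. 1)"
      by (intro sum_strict_mono_ex1) (use bessel j in auto)
    then show False using tot by simp
  qed
  have dl: "ip (\<lambda>i. if i = j then 1 else 0) z = p j * z j" if "j \<in> I" for z j
    using that by (simp add: ip_def if_distrib if_distribR sum.delta cong: if_cong)
  have "y j = 0" if j: "j \<in> I" for j
  proof -
    have ev: "ip (e j) (v l) = 0" if l: "l < card I" for l
    proof -
      have "ip (e j) (v l) = p j * v l j + (\<Sum>k<card I. (- p j * v k j) * ip (v k) (v l))"
        unfolding e_def ip_add dl[OF j] by (subst ip_sum) (simp_all only: ip_mult finite_lessThan)
      also have "(\<Sum>k<card I. (- p j * v k j) * ip (v k) (v l)) = (\<Sum>k<card I. if k = l then - p j * v l j else 0)"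
        using F l by (intro sum.cong) (auto simp: eigen_family_def)
      finally show ?thesis using l by simp
    qed
    have "ip (e j) (e j) = p j * e j j + (\<Sum>k<card I. (- p j * v k j) * ip (v k) (e j))"
      by (subst (1) e_def, unfold ip_add dl[OF j]) (subst ip_sum, simp_all only: ip_mult finite_lessThan)
    also have "(\<Sum>k<card I. (- p j * v k j) * ip (v k) (e j)) = 0"
      using ev by (intro sum.neutral) (auto simp: ip_commute[of _ "e j"])
    also have "e j j = 0"
      using one[OF j] by (simp add: e_def sum_negf power2_eq_square mult_ac)
    finally have e0: "e j i = 0" if "i \<in> I" for i
      using ip_self_eq_0[of "e j"] that by simp
    have "ip (e j) y = p j * y j + (\<Sum>k<card I. (- p j * v k j) * ip (v k) y)"
      unfolding e_def ip_add dl[OF j] by (subst ip_sum) (simp_all only: ip_mult finite_lessThan)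
    also have "(\<Sum>k<card I. (- p j * v k j) * ip (v k) y) = 0"
      using yv by (intro sum.neutral) (auto simp: ip_commute[of _ y])
    also have "ip (e j) y = 0" using e0 by (simp add: ip_def)
    finally show ?thesis using p_pos[OF j] by simp
  qed
  from this[OF assms(2)] show ?thesis by (simp add: y_def sum_negf)
qed

lemma eigen_family_parseval:
  assumes F: "eigen_family (card I) v \<mu>"
  shows "ip x y = (\<Sum>k<card I. ip x (v k) * ip y (v k))"
proof -
  have "ip x y = ip (\<lambda>i. \<Sum>k<card I. ip x (v k) * v k i) y"
    using eigen_family_complete[OF F] by (intro ip_cong) auto
  also have "\<dots> = (\<Sum>k<card I. ip x (v k) * ip (v k) y)" by (rule ip_lincomb) simp
  finally show ?thesis by (simp only: ip_commute[of y])
qed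

lemma eigen_family_app:
  assumes F: "eigen_family (card I) v \<mu>" and "k < card I"
  shows "ip (app x) (v k) = \<mu> k * ip x (v k)"
proof -
  have "ip (app x) (v k) = ip x (app (v k))" by (rule app_adjoint)
  also have "\<dots> = ip x (\<lambda>i. \<mu> k * v k i)"
    using assms by (intro ip_cong) (auto simp: eigen_family_def)
  finally show ?thesis by (simp add: ip_commute[of x] ip_mult)
qed

end

text \<open>Irreducibility is phrased through closed sets of the graph of positive entries, the form
  in which support arguments use it. Diagonal entries may have any sign.\<close>

locale irreducible_symmetric = weighted_symmetric +
  assumes nonneg: "i \<in> I \<Longrightarrow> j \<in> I \<Longrightarrow> i \<noteq> j \<Longrightarrow> M i j \<ge> 0"
    and irred: "Z \<subseteq> I \<Longrightarrow> Z \<noteq> {} \<Longrightarrow> (\<And>i j. i \<in> Z \<Longrightarrow> j \<in> I \<Longrightarrow> j \<noteq> i \<Longrightarrow> M j i > 0 \<Longrightarrow> j \<in> Z) \<Longrightarrow> Z = I"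
    and nonempty: "I \<noteq> {}"
begin

text \<open>The modulus of an eigenvector for the largest eigenvalue attains the Rayleigh maximum,
  so it is an eigenvector too, and irreducibility leaves it no zero entry. The same for
  \<open>\<bar>x\<bar> + x\<close> gives \<open>x\<close> one sign. Two vectors of constant sign are
  never orthogonal, so the eigenvalue is simple.\<close>

lemma perron:
  obtains v \<mu> where "eigen_family (card I) v \<mu>" "\<And>i. i \<in> I \<Longrightarrow> v 0 i > 0"
    "\<And>k. 0 < k \<Longrightarrow> k < card I \<Longrightarrow> \<mu> k < \<mu> 0"
proof -
  obtain v \<mu> where F: "eigen_family (card I) v \<mu>" using spectral by blast
  have c0: "card I > 0" using nonempty by (simp add: card_gt_0_iff)
  obtain k0 where k0: "k0 < card I" "\<And>k. k < card I \<Longrightarrow> \<mu> k \<le> \<mu> k0"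
  proof -
    have "Max (\<mu> ` {..<card I}) \<in> \<mu> ` {..<card I}" using c0 by (intro Max_in) auto
    then obtain k0 where "k0 < card I" "\<mu> k0 = Max (\<mu> ` {..<card I})" by auto
    then show ?thesis using Max_ge[of "\<mu> ` {..<card I}"] by (intro that[of k0]) auto
  qed
  let ?m = "\<mu> k0"
  \<comment> \<open>The support of a nonnegative eigenvector is closed: if \<open>x j = 0\<close>,
    the eigenvalue equation at \<open>j\<close> forces \<open>M j i * x i = 0\<close> for all
    \<open>i\<close>.\<close>
  have eig0: "\<forall>i\<in>I. x i \<noteq> 0"
    if nz: "\<exists>i\<in>I. x i \<noteq> 0" and eig: "\<And>i. i \<in> I \<Longrightarrow> app x i = ?m * x i" and ge: "\<And>i. i \<in> I \<Longrightarrow> x i \<ge> 0" for x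
  proof -
    have "{i\<in>I. x i > 0} = I"
    proof (rule irred)
      show "{i\<in>I. x i > 0} \<noteq> {}" using nz ge by force
    next
      fix i j assume i: "i \<in> {i\<in>I. x i > 0}" and j: "j \<in> I" "j \<noteq> i" "M j i > 0"
      have "x j \<noteq> 0"
      proof
        assume xj: "x j = 0"
        have "0 < M j i * x i" using i j by simp
        also have "\<dots> \<le> (\<Sum>l\<in>I. M j l * x l)"
        proof (rule member_le_sum)
          show "i \<in> I" using i by auto
          fix l assume "l \<in> I - {i}"
          then show "0 \<le> M j l * x l" using nonneg[OF j(1), of l] ge[of l] xj by (cases "l = j") auto
        qed auto
        also have "\<dots> = 0" using eig[OF j(1)] xj by (simp add: app_def)
        finally show False by simp
      qed
      then show "j \<in> {i\<in>I. x i > 0}" using ge[OF j(1)] j by auto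
    qed auto
    then show ?thesis by (metis (mono_tags, lifting) mem_Collect_eq less_irrefl)
  qed
  have expand: "ip x (app x) = (\<Sum>k<card I. \<mu> k * (ip x (v k))\<^sup>2)" for x
    by (subst eigen_family_parseval[OF F], intro sum.cong refl) (simp add: eigen_family_app[OF F] power2_eq_square)
  have absolute: "app (\<lambda>i. \<bar>x i\<bar>) i = ?m * \<bar>x i\<bar>"
    if eig: "\<And>i. i \<in> I \<Longrightarrow> app x i = ?m * x i" and i: "i \<in> I" for x i
  proof -
    let ?a = "\<lambda>i. \<bar>x i\<bar>"
    have "?m * ip ?a ?a = ?m * ip x x" by (simp add: ip_def mult.assoc)
    also have "\<dots> = ip (\<lambda>i. ?m * x i) x" by (simp add: ip_mult)
    also have "\<dots> = ip x (app x)" using eig by (subst ip_commute) (intro ip_cong, auto)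
    also have "\<dots> \<le> ip ?a (app ?a)"
    proof -
      have "p i * x i * app x i \<le> p i * ?a i * app ?a i" if i: "i \<in> I" for i
      proof -
        have "x i * (M i j * x j) \<le> ?a i * (M i j * ?a j)" if j: "j \<in> I" for j
        proof (cases "i = j")
          case False
          have "x i * x j \<le> ?a i * ?a j" by (metis abs_ge_self abs_mult)
          then have "M i j * (x i * x j) \<le> M i j * (?a i * ?a j)"
            using nonneg[OF i j False] by (rule mult_left_mono)
          then show ?thesis by (simp add: mult_ac)
        next
          case True
          then show ?thesis using abs_mult_self_eq[of "x j"] by (simp only: mult.left_commute[of _ "M _ _"])
        qed
        then have "x i * app x i \<le> ?a i * app ?a i"
          unfolding app_def sum_distrib_left by (intro sum_mono)
        then show ?thesis using p_pos[OF i] by (simp add: mult.assoc)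
      qed
      then show ?thesis unfolding ip_def by (intro sum_mono)
    qed
    \<comment> \<open>Equality in the Rayleigh bound leaves only components whose eigenvalue is
      \<open>?m\<close>.\<close>
    finally have "(\<Sum>k<card I. ?m * (ip ?a (v k))\<^sup>2) \<le> (\<Sum>k<card I. \<mu> k * (ip ?a (v k))\<^sup>2)"
      unfolding expand eigen_family_parseval[OF F, of ?a ?a] by (simp add: sum_distrib_left power2_eq_square)
    then have "(\<Sum>k<card I. (?m - \<mu> k) * (ip ?a (v k))\<^sup>2) \<le> 0"
      by (simp add: algebra_simps sum_subtractf)
    moreover have nn: "(?m - \<mu> k) * (ip ?a (v k))\<^sup>2 \<ge> 0" if "k < card I" for k
      using k0(2)[OF that] by simp
    ultimately have "(\<Sum>k<card I. (?m - \<mu> k) * (ip ?a (v k))\<^sup>2) = 0"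
      by (intro antisym sum_nonneg) auto
    then have z: "(?m - \<mu> k) * (ip ?a (v k))\<^sup>2 = 0" if "k < card I" for k
      using that nn by (subst (asm) sum_nonneg_eq_0_iff) auto
    have "app ?a i = (\<Sum>k<card I. ip (app ?a) (v k) * v k i)"
      by (rule eigen_family_complete[OF F i])
    also have "\<dots> = (\<Sum>k<card I. ?m * (ip ?a (v k) * v k i))"
    proof (intro sum.cong refl)
      fix k assume "k \<in> {..<card I}"
      then have k: "k < card I" by simp
      have "\<mu> k * ip ?a (v k) = ?m * ip ?a (v k)"
        using z[OF k] by (simp only: mult_eq_0_iff zero_eq_power2 right_minus_eq) (elim disjE, simp_all)
      then show "ip (app ?a) (v k) * v k i = ?m * (ip ?a (v k) * v k i)"
        by (simp only: eigen_family_app[OF F k] mult.assoc[symmetric])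
    qed
    also have "\<dots> = ?m * ?a i"
      using eigen_family_complete[OF F i, of ?a] by (simp add: sum_distrib_left)
    finally show ?thesis .
  qed
  have sgn: "(\<forall>i\<in>I. x i > 0) \<or> (\<forall>i\<in>I. x i < 0)"
    if nz: "\<exists>i\<in>I. x i \<noteq> 0" and eig: "\<And>i. i \<in> I \<Longrightarrow> app x i = ?m * x i" for x
  proof -
    let ?a = "\<lambda>i. \<bar>x i\<bar>"
    have na: "\<forall>i\<in>I. \<bar>x i\<bar> \<noteq> 0"
    proof (rule eig0)
      show "\<exists>i\<in>I. \<bar>x i\<bar> \<noteq> 0" using nz by auto
      show "app (\<lambda>i. \<bar>x i\<bar>) i = ?m * \<bar>x i\<bar>" if "i \<in> I" for i
        by (rule absolute[OF eig that])
    qed auto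
    show ?thesis
    proof (cases "\<exists>i\<in>I. x i > 0")
      case True
      have "\<forall>i\<in>I. \<bar>x i\<bar> + x i \<noteq> 0"
      proof (rule eig0)
        obtain i0 where "i0 \<in> I" "x i0 > 0" using True by blast
        then show "\<exists>i\<in>I. \<bar>x i\<bar> + x i \<noteq> 0" by (intro bexI[of _ i0]) auto
      next
        fix i assume i: "i \<in> I"
        show "app (\<lambda>i. \<bar>x i\<bar> + x i) i = ?m * (\<bar>x i\<bar> + x i)"
          by (simp only: app_add distrib_left absolute[OF eig i] eig[OF i])
        show "0 \<le> \<bar>x i\<bar> + x i" by simp
      qed
      then have "x i > 0" if "i \<in> I" for i
        using that by (cases "x i > 0") (auto simp: not_less)
      then show ?thesis by blast
    next
      case False
      then have "x i < 0" if "i \<in> I" for i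
        using bspec[OF na that] that by (cases "x i < 0") (auto simp: not_less order.strict_iff_order)
      then show ?thesis by blast
    qed
  qed
  \<comment> \<open>\<open>s\<close> makes the top eigenvector positive, and \<open>\<sigma>\<close>
    swaps \<open>0\<close> and \<open>k0\<close> to give it the index \<open>0\<close>.\<close>
  define s where "s = (if \<forall>i\<in>I. v k0 i > 0 then 1 else - 1 :: real)"
  define \<sigma> where "\<sigma> = (\<lambda>k. if k = 0 then k0 else if k = k0 then 0 else k)"
  have \<sigma>: "\<sigma> k < card I \<longleftrightarrow> k < card I" "\<sigma> k = \<sigma> l \<longleftrightarrow> k = l" "\<sigma> 0 = k0" "\<sigma> k = k0 \<longleftrightarrow> k = 0" for k l
    unfolding \<sigma>_def using k0(1) c0 by presburger+
  define v' where "v' k = (\<lambda>i. (if k = 0 then s else 1) * v (\<sigma> k) i)" for k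
  have nzv: "\<exists>i\<in>I. v k i \<noteq> 0" if "k < card I" for k
  proof (rule ccontr)
    assume "\<not> ?thesis"
    then have "ip (v k) (v k) = 0" by (simp add: ip_def)
    then show False using F that by (simp add: eigen_family_def)
  qed
  have ev: "app (v k) i = \<mu> k * v k i" if "k < card I" "i \<in> I" for k i
    using F that by (simp add: eigen_family_def)
  have "eigen_family (card I) v' (\<lambda>k. \<mu> (\<sigma> k))"
    unfolding eigen_family_def
  proof (intro conjI allI impI ballI)
    fix k l assume "k < card I" "l < card I"
    then have "ip (v (\<sigma> k)) (v (\<sigma> l)) = (if k = l then 1 else 0)"
      using F \<sigma>(1)[of k] \<sigma>(1)[of l] \<sigma>(2)[of k l] unfolding eigen_family_def by presburger
    then show "ip (v' k) (v' l) = (if k = l then 1 else 0)"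
      unfolding v'_def ip_mult2 by (simp add: s_def split: if_splits)
  next
    fix k i assume "k < card I" "i \<in> I"
    then show "app (v' k) i = \<mu> (\<sigma> k) * v' k i"
      using ev[of "\<sigma> k" i] \<sigma> by (simp add: v'_def app_mult)
  qed
  moreover have "v' 0 i > 0" if i: "i \<in> I" for i
  proof -
    have "(\<forall>i\<in>I. v k0 i > 0) \<or> (\<forall>i\<in>I. v k0 i < 0)"
      by (rule sgn[of "v k0", OF nzv[OF k0(1)] ev[OF k0(1)]])
    then show ?thesis
    proof
      assume "\<forall>i\<in>I. v k0 i > 0"
      then show ?thesis using i by (simp add: v'_def \<sigma>(3) s_def)
    next
      assume neg: "\<forall>i\<in>I. v k0 i < 0"
      then have "\<not> (\<forall>i\<in>I. v k0 i > 0)" using i by fastforce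
      then have "s = - 1" by (simp only: s_def if_False)
      then show ?thesis using i neg by (simp add: v'_def \<sigma>(3))
    qed
  qed
  moreover have "\<mu> (\<sigma> k) < \<mu> (\<sigma> 0)" if k: "0 < k" "k < card I" for k
  proof (rule ccontr)
    let ?k = "\<sigma> k"
    assume "\<not> ?thesis"
    then have e: "\<mu> ?k = ?m" using k0(2)[of ?k] k(2) \<sigma>(1)[of k] \<sigma>(3) by simp
    have kk: "?k < card I" "?k \<noteq> k0" using k \<sigma>(1)[of k] \<sigma>(4)[of k] by auto
    have 1: "(\<forall>i\<in>I. v ?k i > 0) \<or> (\<forall>i\<in>I. v ?k i < 0)"
      by (rule sgn[of "v ?k", OF nzv[OF kk(1)] ev[OF kk(1), unfolded e]])
    have 2: "(\<forall>i\<in>I. v k0 i > 0) \<or> (\<forall>i\<in>I. v k0 i < 0)"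
      by (rule sgn[of "v k0", OF nzv[OF k0(1)] ev[OF k0(1)]])
    have "(\<forall>i\<in>I. v ?k i * v k0 i > 0) \<or> (\<forall>i\<in>I. v ?k i * v k0 i < 0)"
      using 1 2 by (metis mult_pos_pos mult_neg_neg mult_pos_neg mult_neg_pos)
    then have "ip (v ?k) (v k0) \<noteq> 0"
    proof
      assume "\<forall>i\<in>I. v ?k i * v k0 i > 0"
      then have "ip (v ?k) (v k0) > 0" unfolding ip_def mult.assoc using p_pos nonempty by (intro sum_pos) auto
      then show ?thesis by simp
    next
      assume "\<forall>i\<in>I. v ?k i * v k0 i < 0"
      then have "(\<Sum>i\<in>I. - (p i * (v ?k i * v k0 i))) > 0" using p_pos nonempty by (intro sum_pos) (auto simp: mult_pos_neg)
      then show ?thesis by (simp add: ip_def sum_negf mult.assoc)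
    qed
    moreover have "ip (v ?k) (v k0) = 0"
      using F kk k0(1) unfolding eigen_family_def by presburger
    ultimately show False by contradiction
  qed
  ultimately show ?thesis using that[of v' "\<lambda>k. \<mu> (\<sigma> k)"] by blast
qed

end

section \<open>The semigroup of a symmetric matrix\<close>

context weighted_symmetric
begin

definition nrm :: "('i \<Rightarrow> real) \<Rightarrow> real" where
  "nrm x = L2_set (\<lambda>i. sqrt (p i) * x i) I"

lemma nrm_power2: "(nrm x)\<^sup>2 = ip x x"
proof -
  have "(sqrt (p i) * x i)\<^sup>2 = p i * x i * x i" if "i \<in> I" for i
    using p_pos[OF that] by (simp add: power_mult_distrib power2_eq_square)
  then show ?thesis
    unfolding nrm_def L2_set_def ip_def by (subst real_sqrt_pow2) (auto intro!: sum_nonneg simp: term_nonneg)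
qed

lemma nrm_nonneg [simp]: "nrm x \<ge> 0"
  by (simp add: nrm_def)

lemma nrm_add: "nrm (\<lambda>i. x i + y i) \<le> nrm x + nrm y"
  unfolding nrm_def distrib_left by (rule L2_set_triangle_ineq)

lemma nrm_mult: "nrm (\<lambda>i. c * x i) = \<bar>c\<bar> * nrm x"
proof -
  have "(nrm (\<lambda>i. c * x i))\<^sup>2 = (\<bar>c\<bar> * nrm x)\<^sup>2"
    unfolding nrm_power2 power_mult_distrib by (simp add: ip_mult2 power2_eq_square)
  then show ?thesis by (rule power2_eq_imp_eq) auto
qed

lemma nrm_cong: "(\<And>i. i \<in> I \<Longrightarrow> x i = y i) \<Longrightarrow> nrm x = nrm y"
  unfolding nrm_def by (intro L2_set_cong) auto

lemma abs_le_nrm: "i \<in> I \<Longrightarrow> sqrt (p i) * \<bar>x i\<bar> \<le> nrm x"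
proof -
  assume i: "i \<in> I"
  have "(sqrt (p i) * \<bar>x i\<bar>)\<^sup>2 = p i * x i * x i"
    using p_pos[OF i] by (simp add: power_mult_distrib) (simp add: power2_eq_square)
  also have "\<dots> \<le> ip x x" unfolding ip_def by (intro member_le_sum[OF i]) (use term_nonneg in auto)
  finally show ?thesis unfolding nrm_power2[symmetric] by (rule power2_le_imp_le) simp
qed

lemma nrm_le_sum: "nrm x \<le> (\<Sum>i\<in>I. sqrt (p i) * \<bar>x i\<bar>)"
  unfolding nrm_def by (rule order_trans[OF L2_set_le_sum_abs]) (auto simp: abs_mult p_pos less_imp_le intro!: sum_mono)

lemma matrix_bounded: "\<exists>C\<ge>0. \<forall>x. nrm (\<lambda>i. \<Sum>j\<in>I. A i j * x j) \<le> C * nrm x"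
proof (intro exI conjI allI)
  let ?C = "\<Sum>i\<in>I. sqrt (p i) * (\<Sum>j\<in>I. \<bar>A i j\<bar> / sqrt (p j))"
  show "0 \<le> ?C" using p_pos by (intro sum_nonneg mult_nonneg_nonneg) (auto simp: less_imp_le)
  fix x
  have xj: "\<bar>x j\<bar> \<le> nrm x / sqrt (p j)" if "j \<in> I" for j
    using abs_le_nrm[OF that, of x] p_pos[OF that] by (simp add: field_simps)
  have "nrm (\<lambda>i. \<Sum>j\<in>I. A i j * x j) \<le> (\<Sum>i\<in>I. sqrt (p i) * \<bar>\<Sum>j\<in>I. A i j * x j\<bar>)"
    by (rule nrm_le_sum)
  also have "\<dots> \<le> (\<Sum>i\<in>I. sqrt (p i) * (\<Sum>j\<in>I. \<bar>A i j\<bar> * (nrm x / sqrt (p j))))"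
    using p_pos xj
    by (intro sum_mono mult_left_mono order_trans[OF sum_abs]) (auto simp: abs_mult less_imp_le simp del: times_divide_eq_right intro!: sum_mono mult_left_mono)
  also have "\<dots> = ?C * nrm x"
    by (simp add: sum_distrib_right sum_distrib_left mult_ac)
  finally show "nrm (\<lambda>i. \<Sum>j\<in>I. A i j * x j) \<le> ?C * nrm x" .
qed

text \<open>Some \<open>P s\<close> preserving \<open>K\<close> agrees with \<open>1 + s T\<close>
  up to order \<open>s\<^sup>2\<close>. The exact operator \<open>1 + s T\<close> need not inherit
  invariance under sums of generators; this form does, by composition.\<close>

definition infinitesimal :: "('i \<Rightarrow> real) set \<Rightarrow> (('i \<Rightarrow> real) \<Rightarrow> 'i \<Rightarrow> real) \<Rightarrow> bool" where
  "infinitesimal K T \<longleftrightarrow>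
     (\<exists>C\<ge>0. \<forall>x. nrm (T x) \<le> C * nrm x) \<and>
     (\<forall>x y c. \<forall>i\<in>I. T (\<lambda>i. x i + c * y i) i = T x i + c * T y i) \<and>
     (\<exists>P s0. s0 > 0 \<and> (\<forall>s x. 0 < s \<and> s \<le> s0 \<and> x \<in> K \<longrightarrow> P s x \<in> K) \<and>
       (\<exists>C\<ge>0. \<forall>s\<in>{0..1}. \<forall>x. nrm (\<lambda>i. P s x i + - x i + (- s) * T x i) \<le> C * s\<^sup>2 * nrm x))"

lemma infinitesimalI:
  assumes "\<And>i x. i \<in> I \<Longrightarrow> T x i = (\<Sum>j\<in>I. A i j * x j)" "sm > 0"
    and "\<And>s x. 0 < s \<Longrightarrow> s \<le> sm \<Longrightarrow> x \<in> K \<Longrightarrow> (\<lambda>i. x i + s * T x i) \<in> K"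
  shows "infinitesimal K T"
  unfolding infinitesimal_def
proof (intro conjI)
  have "nrm (T x) = nrm (\<lambda>i. \<Sum>j\<in>I. A i j * x j)" for x
    using assms(1) by (intro nrm_cong)
  then show "\<exists>C\<ge>0. \<forall>x. nrm (T x) \<le> C * nrm x" using matrix_bounded[of A] by simp
  show "\<forall>x y c. \<forall>i\<in>I. T (\<lambda>i. x i + c * y i) i = T x i + c * T y i"
    using assms(1) by (simp add: sum.distrib sum_distrib_left algebra_simps)
  have z: "nrm (\<lambda>i. 0) = 0" using nrm_mult[of 0] by simp
  show "\<exists>P s0. s0 > 0 \<and> (\<forall>s x. 0 < s \<and> s \<le> s0 \<and> x \<in> K \<longrightarrow> P s x \<in> K) \<and>
       (\<exists>C\<ge>0. \<forall>s\<in>{0..1}. \<forall>x. nrm (\<lambda>i. P s x i + - x i + (- s) * T x i) \<le> C * s\<^sup>2 * nrm x)"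
    by (intro exI[of _ "\<lambda>s x i. x i + s * T x i"] exI[of _ sm] conjI exI[of _ 0])
      (use assms(2,3) z in auto)
qed

lemma infinitesimalE:
  assumes "infinitesimal K T"
  obtains CT P sP CP where "CT \<ge> 0" "\<And>x. nrm (T x) \<le> CT * nrm x"
    "\<And>x y c i. i \<in> I \<Longrightarrow> T (\<lambda>i. x i + c * y i) i = T x i + c * T y i"
    "sP > 0" "\<And>s x. 0 < s \<Longrightarrow> s \<le> sP \<Longrightarrow> x \<in> K \<Longrightarrow> P s x \<in> K"
    "CP \<ge> 0" "\<And>s x. 0 \<le> s \<Longrightarrow> s \<le> 1 \<Longrightarrow> nrm (\<lambda>i. P s x i + - x i + (- s) * T x i) \<le> CP * s\<^sup>2 * nrm x"
proof -
  obtain CT where CT: "CT \<ge> 0" "\<forall>x. nrm (T x) \<le> CT * nrm x"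
    using assms unfolding infinitesimal_def by blast
  have lin: "\<forall>x y c. \<forall>i\<in>I. T (\<lambda>i. x i + c * y i) i = T x i + c * T y i"
    using assms unfolding infinitesimal_def by blast
  obtain P sP CP where P: "sP > 0" "\<forall>s x. 0 < s \<and> s \<le> sP \<and> x \<in> K \<longrightarrow> P s x \<in> K"
    "CP \<ge> 0" "\<forall>s\<in>{0..1}. \<forall>x. nrm (\<lambda>i. P s x i + - x i + (- s) * T x i) \<le> CP * s\<^sup>2 * nrm x"
    using assms unfolding infinitesimal_def by (elim conjE exE) (rule that)
  show ?thesis
  proof (rule that[of CT sP P CP])
    fix s x assume "0 \<le> s" "s \<le> (1::real)"
    then have "s \<in> {0..1}" by simp
    then show "nrm (\<lambda>i. P s x i + - x i + (- s) * T x i) \<le> CP * s\<^sup>2 * nrm x" using P(4) by blast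
  next
    fix x y :: "'i \<Rightarrow> real" and c i assume "i \<in> I"
    then show "T (\<lambda>i. x i + c * y i) i = T x i + c * T y i" using lin by blast
  qed (use CT P(1-3) in auto)
qed

text \<open>For \<open>y = Q s x = x + \<delta>\<close> with \<open>\<delta> = s U x + e\<close>,
  the error of \<open>P s (Q s x)\<close> splits into that of \<open>P s\<close> at
  \<open>y\<close>, the error \<open>e\<close> of \<open>Q s\<close> at \<open>x\<close>, and the
  cross term \<open>s T \<delta>\<close>, each of order \<open>s\<^sup>2\<close>.\<close>

lemma infinitesimal_add:
  assumes "infinitesimal K T" "infinitesimal K U"
  shows "infinitesimal K (\<lambda>x i. T x i + U x i)"
proof -
  obtain CT P sP CP where
    T: "CT \<ge> 0" "\<And>x. nrm (T x) \<le> CT * nrm x" "\<And>x y c i. i \<in> I \<Longrightarrow> T (\<lambda>i. x i + c * y i) i = T x i + c * T y i"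
      "sP > 0" "\<And>s x. 0 < s \<Longrightarrow> s \<le> sP \<Longrightarrow> x \<in> K \<Longrightarrow> P s x \<in> K"
      "CP \<ge> 0" "\<And>s x. 0 \<le> s \<Longrightarrow> s \<le> 1 \<Longrightarrow> nrm (\<lambda>i. P s x i + - x i + (- s) * T x i) \<le> CP * s\<^sup>2 * nrm x"
    by (rule infinitesimalE[OF assms(1)]) blast
  obtain CU Q sQ CQ where
    U: "CU \<ge> 0" "\<And>x. nrm (U x) \<le> CU * nrm x" "\<And>x y c i. i \<in> I \<Longrightarrow> U (\<lambda>i. x i + c * y i) i = U x i + c * U y i"
      "sQ > 0" "\<And>s x. 0 < s \<Longrightarrow> s \<le> sQ \<Longrightarrow> x \<in> K \<Longrightarrow> Q s x \<in> K"
      "CQ \<ge> 0" "\<And>s x. 0 \<le> s \<Longrightarrow> s \<le> 1 \<Longrightarrow> nrm (\<lambda>i. Q s x i + - x i + (- s) * U x i) \<le> CQ * s\<^sup>2 * nrm x"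
    by (rule infinitesimalE[OF assms(2)]) blast
  show ?thesis
    unfolding infinitesimal_def
  proof (intro conjI)
    show "\<exists>C\<ge>0. \<forall>x. nrm (\<lambda>i. T x i + U x i) \<le> C * nrm x"
    proof (intro exI[of _ "CT + CU"] conjI allI)
      fix x
      show "nrm (\<lambda>i. T x i + U x i) \<le> (CT + CU) * nrm x"
        using nrm_add[of "T x" "U x"] T(2)[of x] U(2)[of x] by (simp add: algebra_simps)
    qed (use T U in auto)
    show "\<forall>x y c. \<forall>i\<in>I. T (\<lambda>i. x i + c * y i) i + U (\<lambda>i. x i + c * y i) i = T x i + U x i + c * (T y i + U y i)"
      using T(3) U(3) by (simp add: algebra_simps)
    \<comment> \<open>The summands bound the error of \<open>P s\<close>, the error of
      \<open>Q s\<close> and the cross term; \<open>1 + CU + CQ\<close> is the growth from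
      \<open>x\<close> to \<open>Q s x\<close> for \<open>s \<le> 1\<close>.\<close>
    define C where "C = CP * (1 + CU + CQ) + CQ + CT * (CU + CQ)"
    show "\<exists>P s0. s0 > 0 \<and> (\<forall>s x. 0 < s \<and> s \<le> s0 \<and> x \<in> K \<longrightarrow> P s x \<in> K) \<and>
       (\<exists>C\<ge>0. \<forall>s\<in>{0..1}. \<forall>x. nrm (\<lambda>i. P s x i + - x i + (- s) * (T x i + U x i)) \<le> C * s\<^sup>2 * nrm x)"
    proof (rule exI[of _ "\<lambda>s x. P s (Q s x)"], rule exI[of _ "min sP sQ"], intro conjI)
      show "\<forall>s x. 0 < s \<and> s \<le> min sP sQ \<and> x \<in> K \<longrightarrow> P s (Q s x) \<in> K" using T(5) U(5) by simp
      show "\<exists>C\<ge>0. \<forall>s\<in>{0..1}. \<forall>x. nrm (\<lambda>i. P s (Q s x) i + - x i + (- s) * (T x i + U x i)) \<le> C * s\<^sup>2 * nrm x"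
      proof (rule exI[of _ C], intro conjI ballI allI)
        show "0 \<le> C" using T U by (simp add: C_def)
        fix s x assume "s \<in> {0..1::real}"
        then have s: "0 \<le> s" "s \<le> 1" by auto
        let ?y = "Q s x"
        define e where "e = (\<lambda>i. ?y i + - x i + (- s) * U x i)"
        define \<delta> where "\<delta> = (\<lambda>i. s * U x i + e i)"
        have e: "nrm e \<le> CQ * s\<^sup>2 * nrm x" unfolding e_def by (rule U(7)[OF s])
        have ss: "s\<^sup>2 \<le> s" using s by (simp add: power2_eq_square mult_left_le_one_le)
        have "CQ * s\<^sup>2 * nrm x \<le> CQ * s * nrm x"
          using ss U(6) by (intro mult_right_mono mult_left_mono) auto
        moreover have "nrm \<delta> \<le> s * nrm (U x) + nrm e"
          unfolding \<delta>_def using nrm_add[of "\<lambda>i. s * U x i" e] s by (simp add: nrm_mult)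
        moreover have "s * nrm (U x) \<le> s * (CU * nrm x)"
          using U(2) s by (intro mult_left_mono) auto
        ultimately have \<delta>: "nrm \<delta> \<le> s * (CU + CQ) * nrm x"
          using e by (simp add: algebra_simps)
        have y: "?y = (\<lambda>i. x i + 1 * \<delta> i)" by (auto simp: \<delta>_def e_def)
        have "s * (CU + CQ) * nrm x \<le> 1 * (CU + CQ) * nrm x"
          using s U by (intro mult_right_mono) auto
        then have ny: "nrm ?y \<le> (1 + CU + CQ) * nrm x"
          using nrm_add[of x \<delta>] \<delta> unfolding y by (simp add: algebra_simps)
        have "nrm (\<lambda>i. P s ?y i + - x i + (- s) * (T x i + U x i)) =
            nrm (\<lambda>i. (P s ?y i + - ?y i + (- s) * T ?y i) + (e i + s * T \<delta> i))"
        proof (intro nrm_cong)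
          fix i assume i: "i \<in> I"
          have "T ?y i = T x i + T \<delta> i" using T(3)[OF i, of x 1 \<delta>] unfolding y by simp
          then show "P s ?y i + - x i + (- s) * (T x i + U x i) =
              (P s ?y i + - ?y i + (- s) * T ?y i) + (e i + s * T \<delta> i)"
            by (simp add: e_def algebra_simps)
      qed
      also have "\<dots> \<le> nrm (\<lambda>i. P s ?y i + - ?y i + (- s) * T ?y i) + (nrm e + s * nrm (T \<delta>))"
        using nrm_add[of "\<lambda>i. P s ?y i + - ?y i + (- s) * T ?y i" "\<lambda>i. e i + s * T \<delta> i"]
          nrm_add[of e "\<lambda>i. s * T \<delta> i"] s by (simp add: nrm_mult)
      also have "\<dots> \<le> CP * s\<^sup>2 * ((1 + CU + CQ) * nrm x) + (CQ * s\<^sup>2 * nrm x + s * (CT * (s * (CU + CQ) * nrm x)))"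
      proof (intro add_mono mult_left_mono e)
        show "nrm (\<lambda>i. P s ?y i + - ?y i + (- s) * T ?y i) \<le> CP * s\<^sup>2 * ((1 + CU + CQ) * nrm x)"
          using ny T(6) by (intro order_trans[OF T(7)[OF s]] mult_left_mono) auto
        show "nrm (T \<delta>) \<le> CT * (s * (CU + CQ) * nrm x)"
          using \<delta> T(1) by (intro order_trans[OF T(2)] mult_left_mono) auto
      qed (use s in auto)
      also have "\<dots> = C * s\<^sup>2 * nrm x" by (simp add: C_def algebra_simps power2_eq_square)
      finally show "nrm (\<lambda>i. P s ?y i + - x i + (- s) * (T x i + U x i)) \<le> C * s\<^sup>2 * nrm x" .
      qed
    qed (use T(4) U(4) in auto)
  qed
qed

lemma infinitesimal_cong:
  assumes "infinitesimal K T" "\<And>x i. i \<in> I \<Longrightarrow> T x i = U x i"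
  shows "infinitesimal K U"
proof -
  have "nrm (U x) = nrm (T x)" for x using assms(2) by (intro nrm_cong) auto
  moreover have "nrm (\<lambda>i. P s x i + - x i + (- s) * U x i) = nrm (\<lambda>i. P s x i + - x i + (- s) * T x i)" for P s x
    using assms(2) by (intro nrm_cong) auto
  ultimately show ?thesis using assms unfolding infinitesimal_def by simp
qed

lemma infinitesimal_sum:
  assumes "finite J" "J \<noteq> {}" "\<And>j. j \<in> J \<Longrightarrow> infinitesimal K (T j)"
  shows "infinitesimal K (\<lambda>x i. \<Sum>j\<in>J. T j x i)"
  using assms
proof (induction J rule: finite_ne_induct)
  case (insert j J)
  have "infinitesimal K (\<lambda>x i. T j x i + (\<Sum>j\<in>J. T j x i))"
    using insert by (intro infinitesimal_add) auto
  then show ?case using insert by (simp add: infinitesimal_cong)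
qed auto

end

section \<open>The semigroup normalised by its top eigenvalue\<close>

locale perron_frame = irreducible_symmetric +
  fixes v :: "nat \<Rightarrow> 'a \<Rightarrow> real" and \<mu> :: "nat \<Rightarrow> real"
  assumes eig: "eigen_family (card I) v \<mu>"
    and v0_pos: "i \<in> I \<Longrightarrow> v 0 i > 0"
    and mu_less: "0 < k \<Longrightarrow> k < card I \<Longrightarrow> \<mu> k < \<mu> 0"
begin

text \<open>This is \<open>exp (t (M - \<mu> 0))\<close> in the eigenbasis: the shift by
  \<open>\<mu> 0\<close> fixes the positive eigenvector \<open>v 0\<close> and lets all other
  components decay.\<close>

definition flow :: "real \<Rightarrow> ('a \<Rightarrow> real) \<Rightarrow> 'a \<Rightarrow> real" where
  "flow t x i = (\<Sum>k<card I. exp ((\<mu> k - \<mu> 0) * t) * ip x (v k) * v k i)"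

lemma mu_le: "k < card I \<Longrightarrow> \<mu> k \<le> \<mu> 0"
  using mu_less[of k] by (cases "k = 0") auto

lemma ip_lincomb_v:
  assumes "k < card I"
  shows "ip (\<lambda>i. \<Sum>l<card I. c l * v l i) (v k) = c k"
proof -
  have "ip (\<lambda>i. \<Sum>l<card I. c l * v l i) (v k) = (\<Sum>l<card I. c l * ip (v l) (v k))"
    by (rule ip_lincomb) simp
  also have "\<dots> = (\<Sum>l<card I. if l = k then c k else 0)"
    using eig assms by (intro sum.cong refl) (auto simp: eigen_family_def)
  finally show ?thesis using assms by simp
qed

lemma ip_flow: "k < card I \<Longrightarrow> ip (flow t x) (v k) = exp ((\<mu> k - \<mu> 0) * t) * ip x (v k)"
  unfolding flow_def by (rule ip_lincomb_v)

lemma flow_0: "i \<in> I \<Longrightarrow> flow 0 x i = x i"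
  using eigen_family_complete[OF eig, of i x] by (simp add: flow_def)

lemma flow_add: "flow (s + t) x = flow s (flow t x)"
proof -
  have e: "exp (c * (s + t)) = exp (c * s) * exp (c * t)" for c :: real
    by (simp add: distrib_left exp_add)
  show ?thesis
    unfolding flow_def[of "s + t"] flow_def[of s] e
    by (rule ext, rule sum.cong) (simp_all add: ip_flow mult_ac)
qed

lemma flow_deriv:
  assumes "i \<in> I"
  shows "((\<lambda>t. flow t x i) has_real_derivative app (flow t x) i - \<mu> 0 * flow t x i) (at t)"
proof -
  have "((\<lambda>t. flow t x i) has_real_derivative
      (\<Sum>k<card I. (\<mu> k - \<mu> 0) * (exp ((\<mu> k - \<mu> 0) * t) * ip x (v k) * v k i))) (at t)"
    unfolding flow_def by (auto intro!: derivative_eq_intros sum.cong simp: mult_ac)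
  moreover have "app (flow t x) i = (\<Sum>k<card I. \<mu> k * (exp ((\<mu> k - \<mu> 0) * t) * ip x (v k) * v k i))"
    using eigen_family_complete[OF eig assms, of "app (flow t x)"]
    by (simp add: eigen_family_app[OF eig] ip_flow mult_ac)
  ultimately show ?thesis
    by (simp add: flow_def[of t x i] sum_distrib_left sum_subtractf left_diff_distrib)
qed

lemma nrm_eq: "(nrm x)\<^sup>2 = (\<Sum>k<card I. (ip x (v k))\<^sup>2)"
  unfolding nrm_power2 by (subst eigen_family_parseval[OF eig]) (simp add: power2_eq_square)

lemma nrm_flow_le:
  assumes "t \<ge> 0"
  shows "nrm (flow t x) \<le> nrm x"
proof (rule power2_le_imp_le)
  have "(exp ((\<mu> k - \<mu> 0) * t))\<^sup>2 \<le> 1" if "k < card I" for k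
    using mu_le[OF that] assms by (intro power_le_one) (auto simp: mult_nonpos_nonneg)
  then have "(exp ((\<mu> k - \<mu> 0) * t))\<^sup>2 * (ip x (v k))\<^sup>2 \<le> (ip x (v k))\<^sup>2" if "k < card I" for k
    using that by (simp add: mult_left_le_one_le)
  then show "(nrm (flow t x))\<^sup>2 \<le> (nrm x)\<^sup>2"
    unfolding nrm_eq by (intro sum_mono) (simp add: ip_flow power_mult_distrib)
qed auto

text \<open>With \<open>w = - z\<close>,
  \<open>exp z = 1 / exp w \<le> 1 / (1 + w) \<le> 1 - w + w\<^sup>2\<close>. The sign of
  \<open>z\<close> replaces a smallness condition, so the estimate serves all times.\<close>

lemma abs_exp_minus_linear_le:
  fixes z :: real assumes "z \<le> 0" shows "\<bar>exp z - 1 - z\<bar> \<le> z\<^sup>2"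
proof -
  define w where "w = - z"
  have w: "w \<ge> 0" using assms by (simp add: w_def)
  have "exp z = 1 / exp w" by (simp add: w_def exp_minus field_simps)
  also have "\<dots> \<le> 1 / (1 + w)" using w exp_ge_add_one_self[of w] by (intro divide_left_mono) auto
  also have "\<dots> \<le> 1 - w + w\<^sup>2"
  proof -
    have "(1 - w + w\<^sup>2) * (1 + w) = 1 + w ^ 3" by (simp add: algebra_simps power2_eq_square power3_eq_cube)
    then show ?thesis using w by (simp add: pos_divide_le_eq)
  qed
  finally have "exp z - 1 - z \<le> z\<^sup>2" by (simp add: w_def)
  moreover have "exp z - 1 - z \<ge> 0" using exp_ge_add_one_self[of z] by linarith
  ultimately show ?thesis by simp
qed

lemma flow_infinitesimal:
  "\<exists>C\<ge>0. \<forall>s\<ge>0. \<forall>x. nrm (\<lambda>i. flow s x i + - x i + (- s) * (app x i + (- \<mu> 0) * x i)) \<le> C * s\<^sup>2 * nrm x"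
proof -
  define \<Lambda> where "\<Lambda> = (\<Sum>k<card I. \<bar>\<mu> k - \<mu> 0\<bar>)"
  have \<Lambda>: "\<bar>\<mu> k - \<mu> 0\<bar> \<le> \<Lambda>" if "k < card I" for k
    unfolding \<Lambda>_def using that by (intro member_le_sum) auto
  show ?thesis
  proof (intro exI[of _ "\<Lambda>\<^sup>2"] conjI allI impI)
    fix s :: real and x assume s: "s \<ge> 0"
    let ?e = "\<lambda>i. flow s x i + - x i + (- s) * (app x i + (- \<mu> 0) * x i)"
    have ipe: "ip ?e (v k) = (exp ((\<mu> k - \<mu> 0) * s) - 1 - (\<mu> k - \<mu> 0) * s) * ip x (v k)" if "k < card I" for k
    proof -
      have "ip ?e (v k) = ip (\<lambda>i. flow s x i + ((-1) * x i + (- s) * (app x i + (- \<mu> 0) * x i))) (v k)"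
        by (rule ip_cong) auto
      also have "\<dots> = ip (flow s x) (v k) + (- 1 * ip x (v k) + (- s) * (ip (app x) (v k) + (- \<mu> 0) * ip x (v k)))"
        by (simp only: ip_add ip_mult)
      finally show ?thesis unfolding ip_flow[OF that] eigen_family_app[OF eig that] by (simp add: algebra_simps)
    qed
    have le: "\<bar>exp ((\<mu> k - \<mu> 0) * s) - 1 - (\<mu> k - \<mu> 0) * s\<bar> \<le> \<Lambda>\<^sup>2 * s\<^sup>2" if "k < card I" for k
    proof -
      have "\<bar>exp ((\<mu> k - \<mu> 0) * s) - 1 - (\<mu> k - \<mu> 0) * s\<bar> \<le> ((\<mu> k - \<mu> 0) * s)\<^sup>2"
        using mu_le[OF that] s by (intro abs_exp_minus_linear_le) (simp add: mult_nonpos_nonneg)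
      also have "\<dots> = \<bar>\<mu> k - \<mu> 0\<bar>\<^sup>2 * s\<^sup>2" by (simp add: power_mult_distrib)
      also have "\<dots> \<le> \<Lambda>\<^sup>2 * s\<^sup>2" using \<Lambda>[OF that] by (intro mult_right_mono power_mono) auto
      finally show ?thesis .
    qed
    show "nrm ?e \<le> \<Lambda>\<^sup>2 * s\<^sup>2 * nrm x"
    proof (rule power2_le_imp_le)
      have "(ip ?e (v k))\<^sup>2 \<le> (\<Lambda>\<^sup>2 * s\<^sup>2)\<^sup>2 * (ip x (v k))\<^sup>2" if "k < card I" for k
      proof -
        have "\<bar>exp ((\<mu> k - \<mu> 0) * s) - 1 - (\<mu> k - \<mu> 0) * s\<bar>\<^sup>2 \<le> (\<Lambda>\<^sup>2 * s\<^sup>2)\<^sup>2"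
          using le[OF that] by (intro power_mono) auto
        then show ?thesis unfolding ipe[OF that] power_mult_distrib[of _ "ip x (v k)"]
          by (intro mult_right_mono) auto
      qed
      then show "(nrm ?e)\<^sup>2 \<le> (\<Lambda>\<^sup>2 * s\<^sup>2 * nrm x)\<^sup>2"
        unfolding nrm_eq[of ?e] power_mult_distrib[of _ "nrm x"] nrm_eq[of x] sum_distrib_left
        by (intro sum_mono) simp
    qed simp
  qed simp
qed

text \<open>Euler steps of a first order approximation converge to the semigroup.\<close>

lemma flow_invariant:
  assumes inf: "infinitesimal K (\<lambda>x i. app x i + (- \<mu> 0) * x i)"
    and closed: "\<And>X x. (\<And>m. X m \<in> K) \<Longrightarrow> (\<And>i. i \<in> I \<Longrightarrow> (\<lambda>m. X m i) \<longlonglongrightarrow> x i) \<Longrightarrow> x \<in> K"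
    and x: "x \<in> K" and t: "t > 0"
  shows "flow t x \<in> K"
proof -
  let ?T = "\<lambda>x i. app x i + (- \<mu> 0) * x i"
  obtain P s0 CP where P: "s0 > 0" "\<And>s x. 0 < s \<Longrightarrow> s \<le> s0 \<Longrightarrow> x \<in> K \<Longrightarrow> P s x \<in> K"
      "CP \<ge> 0" "\<And>s x. 0 \<le> s \<Longrightarrow> s \<le> 1 \<Longrightarrow> nrm (\<lambda>i. P s x i + - x i + (- s) * ?T x i) \<le> CP * s\<^sup>2 * nrm x"
    by (rule infinitesimalE[OF inf]) blast
  obtain CE where CE: "CE \<ge> 0" "\<And>s x. s \<ge> 0 \<Longrightarrow> nrm (\<lambda>i. flow s x i + - x i + (- s) * ?T x i) \<le> CE * s\<^sup>2 * nrm x"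
    using flow_infinitesimal by blast
  define C where "C = CP + CE"
  have C: "C \<ge> 0" using P CE by (simp add: C_def)
  have diff: "nrm (\<lambda>i. P s y i - flow s y i) \<le> C * s\<^sup>2 * nrm y" if s: "0 \<le> s" "s \<le> 1" for s y
  proof -
    let ?a = "\<lambda>i. P s y i + - y i + (- s) * ?T y i" and ?b = "\<lambda>i. flow s y i + - y i + (- s) * ?T y i"
    have "(\<lambda>i. P s y i - flow s y i) = (\<lambda>i. ?a i + (-1) * ?b i)" by (auto simp: algebra_simps)
    then have "nrm (\<lambda>i. P s y i - flow s y i) \<le> nrm ?a + nrm ?b"
      using nrm_add[of ?a "\<lambda>i. (-1) * ?b i"] nrm_mult[of "-1" ?b] by simp
    then show ?thesis using P(4)[OF s, of y] CE(2)[OF s(1), of y] by (simp add: C_def algebra_simps)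
  qed
  have Pn: "nrm (P s y) \<le> (1 + C * s\<^sup>2) * nrm y" if s: "0 \<le> s" "s \<le> 1" for s y
  proof -
    have "nrm (P s y) \<le> nrm (\<lambda>i. P s y i - flow s y i) + nrm (flow s y)"
      using nrm_add[of "\<lambda>i. P s y i - flow s y i" "flow s y"] by simp
    then show ?thesis using diff[OF s, of y] nrm_flow_le[OF s(1), of y] by (simp add: algebra_simps)
  qed
  have flow_diff: "flow s (\<lambda>i. y i - z i) = (\<lambda>i. flow s y i - flow s z i)" for s y z
  proof -
    have ipd: "ip (\<lambda>i. y i - z i) w = ip y w - ip z w" for w
      by (simp add: ip_def algebra_simps sum_subtractf)
    show ?thesis
      unfolding fun_eq_iff flow_def sum_subtractf[symmetric] ipd by (intro allI sum.cong) (simp_all add: algebra_simps)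
  qed
  \<comment> \<open>Each Euler step adds an error \<open>C * s\<^sup>2\<close> times the current
    norm, which has grown by at most \<open>(1 + C * s\<^sup>2) ^ k\<close>; older errors are not
    enlarged, since the semigroup does not increase \<open>nrm\<close>.\<close>
  have iter: "nrm ((P s ^^ k) x) \<le> (1 + C * s\<^sup>2) ^ k * nrm x \<and>
      nrm (\<lambda>i. (P s ^^ k) x i - flow (real k * s) x i) \<le> real k * (C * s\<^sup>2) * (1 + C * s\<^sup>2) ^ k * nrm x"
    if s: "0 \<le> s" "s \<le> 1" for s k
  proof (induction k)
    case 0
    have "nrm (\<lambda>i. x i - flow 0 x i) = nrm (\<lambda>i. 0 * x i)"
      by (intro nrm_cong) (simp add: flow_0)
    then show ?case by (simp only: nrm_mult) simp
  next
    case (Suc k)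
    let ?q = "1 + C * s\<^sup>2" and ?y = "(P s ^^ k) x" and ?z = "flow (real k * s) x"
    have q: "?q \<ge> 1" using C by simp
    have 1: "nrm ((P s ^^ Suc k) x) \<le> ?q ^ Suc k * nrm x"
    proof -
      have "nrm ((P s ^^ Suc k) x) \<le> ?q * nrm ?y" using Pn[OF s] by simp
      also have "\<dots> \<le> ?q * (?q ^ k * nrm x)" using Suc q by (intro mult_left_mono) auto
      finally show ?thesis by (simp add: mult.assoc)
    qed
    have f: "flow (real (Suc k) * s) x = flow s ?z"
      unfolding flow_add[symmetric] by (simp add: algebra_simps)
    have "nrm (\<lambda>i. (P s ^^ Suc k) x i - flow (real (Suc k) * s) x i) =
        nrm (\<lambda>i. (P s ?y i - flow s ?y i) + flow s (\<lambda>i. ?y i - ?z i) i)"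
      unfolding f flow_diff by (intro nrm_cong) simp
    also have "\<dots> \<le> nrm (\<lambda>i. P s ?y i - flow s ?y i) + nrm (flow s (\<lambda>i. ?y i - ?z i))"
      by (rule nrm_add)
    also have "\<dots> \<le> C * s\<^sup>2 * nrm ?y + nrm (\<lambda>i. ?y i - ?z i)"
      by (intro add_mono diff[OF s] nrm_flow_le[OF s(1)])
    also have "\<dots> \<le> C * s\<^sup>2 * (?q ^ k * nrm x) + real k * (C * s\<^sup>2) * ?q ^ k * nrm x"
      using Suc C by (intro add_mono mult_left_mono) auto
    also have "\<dots> = real (Suc k) * (C * s\<^sup>2) * (?q ^ k * nrm x)" by (simp add: algebra_simps)
    also have "\<dots> \<le> real (Suc k) * (C * s\<^sup>2) * (?q ^ Suc k * nrm x)"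
      using q C by (intro mult_left_mono mult_right_mono power_increasing) auto
    finally show ?case using 1 by (simp add: mult.assoc)
  qed
  \<comment> \<open>From \<open>N0\<close> on the step length is below both \<open>s0\<close>, where
    \<open>P\<close> preserves \<open>K\<close>, and \<open>1\<close>, where its error bound
    holds.\<close>
  obtain N0 :: nat where N0: "t / min s0 1 < real N0" using reals_Archimedean2 by blast
  define X where "X m = (P (t / real (N0 + m + 1)) ^^ (N0 + m + 1)) x" for m
  have sm: "0 < t / real (N0 + m + 1)" "t / real (N0 + m + 1) \<le> min s0 1" for m
  proof -
    have m1: "min s0 1 > 0" using P(1) by simp
    have "t < real N0 * min s0 1" using N0 m1 by (simp add: field_simps)
    also have "\<dots> \<le> real (N0 + m + 1) * min s0 1" using m1 by (intro mult_right_mono) auto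
    finally have "t \<le> min s0 1 * real (N0 + m + 1)" by (simp only: mult.commute less_imp_le)
    then show "t / real (N0 + m + 1) \<le> min s0 1" by (subst pos_divide_le_eq) auto
  qed (use t in auto)
  have XK: "X m \<in> K" for m
  proof -
    have "(P (t / real (N0 + m + 1)) ^^ k) x \<in> K" for k
      by (induction k) (use x P(2) sm[of m] in auto)
    then show ?thesis unfolding X_def .
  qed
  \<comment> \<open>\<open>N\<close> steps of length \<open>t / N\<close> accumulate at most
    \<open>N * C * (t / N)\<^sup>2 * exp (C * t\<^sup>2) * nrm x = B / N\<close>.\<close>
  define B where "B = C * t\<^sup>2 * exp (C * t\<^sup>2) * nrm x"
  have err: "nrm (\<lambda>i. X m i - flow t x i) \<le> B / real (N0 + m + 1)" for m
  proof -
    let ?N = "N0 + m + 1"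
    let ?s = "t / real ?N"
    have s: "0 \<le> ?s" "?s \<le> 1" using sm[of m] by auto
    have N: "real ?N \<ge> 1" "real ?N * ?s = t" by auto
    have "r * (C * (t / r)\<^sup>2) = C * t\<^sup>2 / r" if "r > 0" for r :: real
      using that by (simp add: power2_eq_square field_simps)
    then have hN: "real ?N * (C * ?s\<^sup>2) = C * t\<^sup>2 / real ?N" using N(1) by simp
    have "nrm (\<lambda>i. X m i - flow t x i) \<le> real ?N * (C * ?s\<^sup>2) * (1 + C * ?s\<^sup>2) ^ ?N * nrm x"
      using iter[OF s, of ?N] unfolding X_def N(2) by blast
    also have "\<dots> \<le> real ?N * (C * ?s\<^sup>2) * exp (C * t\<^sup>2) * nrm x"
    proof (intro mult_right_mono mult_left_mono)
      have "(1 + C * ?s\<^sup>2) ^ ?N \<le> exp (C * ?s\<^sup>2) ^ ?N"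
        using C by (intro power_mono exp_ge_add_one_self) auto
      also have "\<dots> = exp (real ?N * (C * ?s\<^sup>2))" by (rule exp_of_nat_mult[symmetric])
      also have "\<dots> \<le> exp (C * t\<^sup>2)"
      proof -
        have "real ?N * (C * ?s\<^sup>2) = C * t\<^sup>2 / real ?N" by (rule hN)
        also have "\<dots> \<le> C * t\<^sup>2 / 1" using N C by (intro divide_left_mono) auto
        finally show ?thesis by simp
      qed
      finally show "(1 + C * ?s\<^sup>2) ^ ?N \<le> exp (C * t\<^sup>2)" .
    qed (use C in auto)
    also have "\<dots> = B / real ?N" unfolding hN by (simp add: B_def)
    finally show ?thesis .
  qed
  show ?thesis
  proof (rule closed[of X, OF XK])
    fix i assume i: "i \<in> I"
    have lim0: "(\<lambda>m. B / sqrt (p i) / real (N0 + m + 1)) \<longlonglongrightarrow> 0"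
      using LIMSEQ_ignore_initial_segment[OF lim_const_over_n[of "B / sqrt (p i)"], of "N0 + 1"]
      by (simp add: add_ac)
    have bound: "norm (X m i - flow t x i) \<le> B / sqrt (p i) / real (N0 + m + 1)" for m
    proof -
      have le: "sqrt (p i) * \<bar>X m i - flow t x i\<bar> \<le> B / real (N0 + m + 1)"
        using abs_le_nrm[OF i, of "\<lambda>i. X m i - flow t x i"] err[of m] by linarith
      have div: "a \<le> B / q / r" if "q * a \<le> B / r" "q > 0" for a q r :: real
      proof -
        have "a * q \<le> B / r" using that(1) by (simp only: mult.commute)
        then have "a \<le> (B / r) / q" using that(2) by (simp only: pos_le_divide_eq)
        also have "\<dots> = B / q / r" by (simp only: divide_divide_eq_left mult.commute)
        finally show ?thesis .
      qed
      show ?thesis unfolding real_norm_def by (rule div[OF le]) (use p_pos[OF i] in simp)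
    qed
    have "(\<lambda>m. X m i - flow t x i) \<longlonglongrightarrow> 0"
      by (rule Lim_null_comparison[OF always_eventually[OF allI[OF bound]] lim0])
    then show "(\<lambda>m. X m i) \<longlonglongrightarrow> flow t x i" by (simp add: LIM_zero_iff)
  qed
qed

text \<open>The coordinates that are positive at all positive times form a nonempty set closed in
  the graph of positive entries, hence all of \<open>I\<close>.\<close>

lemma flow_pos:
  assumes nn: "\<And>t i. t \<ge> 0 \<Longrightarrow> i \<in> I \<Longrightarrow> flow t x i \<ge> 0" and nz: "\<exists>i\<in>I. x i \<noteq> 0"
    and "t > 0" "i \<in> I"
  shows "flow t x i > 0"
proof -
  \<comment> \<open>Integrating factor: it removes the diagonal term, so the derivative of
    \<open>h j\<close> is the nonnegative inflow from the other coordinates.\<close>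
  define h where "h j s = exp ((\<mu> 0 - M j j) * s) * flow s x j" for j s
  have h': "(h j has_real_derivative exp ((\<mu> 0 - M j j) * s) * (\<Sum>i\<in>I - {j}. M j i * flow s x i)) (at s)"
    if j: "j \<in> I" for j s
  proof -
    have "app (flow s x) j = M j j * flow s x j + (\<Sum>i\<in>I - {j}. M j i * flow s x i)"
      unfolding app_def by (rule sum.remove[OF fin j])
    then show ?thesis unfolding h_def
      by (auto intro!: derivative_eq_intros flow_deriv[OF j] simp: algebra_simps)
  qed
  have term_nn: "M j i * flow s x i \<ge> 0" if "j \<in> I" "i \<in> I - {j}" "s \<ge> 0" for i j s
    using nonneg[of j i] nn[of s i] that by auto
  have "{j\<in>I. \<forall>t>0. flow t x j > 0} = I"
  proof (rule irred)
    obtain j where j: "j \<in> I" "x j \<noteq> 0" using nz by blast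
    have xj: "x j > 0" using nn[of 0 j] j by (simp add: flow_0)
    have "flow t x j > 0" if t: "t > 0" for t
    proof -
      have "h j 0 \<le> h j t"
      proof (rule DERIV_nonneg_imp_nondecreasing[where f = "h j"])
        fix s assume "0 \<le> s" "s \<le> t"
        then show "\<exists>y. (h j has_real_derivative y) (at s) \<and> y \<ge> 0"
          using h'[OF j(1), of s] term_nn[OF j(1)]
          by (intro exI[of _ "exp ((\<mu> 0 - M j j) * s) * (\<Sum>i\<in>I - {j}. M j i * flow s x i)"] conjI
              mult_nonneg_nonneg[OF exp_ge_zero] sum_nonneg) auto
      qed (use t in simp)
      then have "exp ((\<mu> 0 - M j j) * t) * flow t x j > 0"
        using xj by (simp add: h_def flow_0[OF j(1)])
      then show ?thesis by (simp add: zero_less_mult_iff)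
    qed
    then show "{j\<in>I. \<forall>t>0. flow t x j > 0} \<noteq> {}" using j by blast
  next
    fix i j assume i: "i \<in> {j\<in>I. \<forall>t>0. flow t x j > 0}" and j: "j \<in> I" "j \<noteq> i" "M j i > 0"
    have "flow t x j > 0" if t: "t > 0" for t
    proof -
      \<comment> \<open>The inflow from \<open>i\<close> is known to be positive only at positive
        times, hence the start at \<open>t / 2\<close>.\<close>
      have "h j (t / 2) < h j t"
      proof (rule DERIV_pos_imp_increasing[where f = "h j"])
        fix s assume s: "t / 2 \<le> s" "s \<le> t"
        have "0 < M j i * flow s x i" using i j s t by simp
        also have "\<dots> \<le> (\<Sum>i\<in>I - {j}. M j i * flow s x i)"
          using i j s t term_nn[OF j(1), of _ s] by (intro member_le_sum) auto
        finally show "\<exists>y. (h j has_real_derivative y) (at s) \<and> y > 0"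
          using h'[OF j(1), of s]
          by (intro exI[of _ "exp ((\<mu> 0 - M j j) * s) * (\<Sum>i\<in>I - {j}. M j i * flow s x i)"] conjI) auto
      qed (use t in simp)
      moreover have "h j (t / 2) \<ge> 0" using nn[of "t / 2" j] t j by (simp add: h_def)
      ultimately have "exp ((\<mu> 0 - M j j) * t) * flow t x j > 0" by (simp add: h_def)
      then show ?thesis by (simp add: zero_less_mult_iff)
    qed
    then show "j \<in> {j\<in>I. \<forall>t>0. flow t x j > 0}" using j by blast
  qed auto
  then show ?thesis using assms by blast
qed

end

section \<open>A stability preserving semigroup\<close>

definition factorial_weight :: "nat \<Rightarrow> (nat \<Rightarrow> nat) \<Rightarrow> real" where
  "factorial_weight n a = (\<Prod>i<n. fact (a i))"

text \<open>The matrix of \<open>L\<close>, row \<open>a\<close> receiving from column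
  \<open>b\<close>. The terms \<open>k = l\<close> of the double sum also lie on the
  diagonal.\<close>

definition exchange_matrix :: "nat \<Rightarrow> (nat \<Rightarrow> nat) \<Rightarrow> (nat \<Rightarrow> nat) \<Rightarrow> real" where
  "exchange_matrix n a b = (\<Sum>k<n. \<Sum>l<n. if inc l a = inc k b then real (b l) else 0)
     - (if a = b then \<Sum>k<n. (real (a k))\<^sup>2 else 0)"

lemma factorial_weight_pos: "factorial_weight n a > 0"
  unfolding factorial_weight_def by (intro prod_pos) auto

lemma factorial_weight_inc: "l < n \<Longrightarrow> factorial_weight n (inc l a) = factorial_weight n a * real (Suc (a l))"
  unfolding factorial_weight_def by (subst (1 2) prod.remove[of _ l]) (auto simp: algebra_simps)

text \<open>Adjointness of \<open>w\<^sub>k \<partial>\<^sub>l\<close> and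
  \<open>w\<^sub>l \<partial>\<^sub>k\<close>: for \<open>k \<noteq> l\<close> both sides are the
  factorial weight of the common vector \<open>inc l a = inc k b\<close>.\<close>

lemma factorial_weight_hop:
  assumes "k < n" "l < n" "inc l a = inc k b"
  shows "factorial_weight n a * real (b l) = factorial_weight n b * real (a k)"
proof (cases "k = l")
  case True
  then show ?thesis using assms by simp
next
  case False
  have "Suc (a l) = b l" "Suc (b k) = a k"
    using fun_cong[OF assms(3), of l] fun_cong[OF assms(3), of k] False by auto
  moreover have "factorial_weight n a * real (Suc (a l)) = factorial_weight n b * real (Suc (b k))"
    using factorial_weight_inc assms by metis
  ultimately show ?thesis by simp
qed

lemma exchange_matrix_symm: "factorial_weight n a * exchange_matrix n a b = factorial_weight n b * exchange_matrix n b a"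
proof -
  have "factorial_weight n a * (\<Sum>k<n. \<Sum>l<n. if inc l a = inc k b then real (b l) else 0)
      = (\<Sum>k<n. \<Sum>l<n. if inc l a = inc k b then factorial_weight n a * real (b l) else 0)"
    by (simp add: sum_distrib_left if_distrib cong: if_cong)
  also have "\<dots> = (\<Sum>k<n. \<Sum>l<n. if inc k b = inc l a then factorial_weight n b * real (a k) else 0)"
  proof (intro sum.cong refl)
    fix k l assume "k \<in> {..<n}" "l \<in> {..<n}"
    then have "inc l a = inc k b \<Longrightarrow> factorial_weight n a * real (b l) = factorial_weight n b * real (a k)"
      by (intro factorial_weight_hop) auto
    then show "(if inc l a = inc k b then factorial_weight n a * real (b l) else 0) =
        (if inc k b = inc l a then factorial_weight n b * real (a k) else 0)"
      by metis
  qed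
  also have "\<dots> = factorial_weight n b * (\<Sum>k<n. \<Sum>l<n. if inc l b = inc k a then real (a l) else 0)"
    by (subst sum.swap) (simp add: sum_distrib_left if_distrib cong: if_cong)
  finally show ?thesis unfolding exchange_matrix_def right_diff_distrib by (cases "a = b") simp_all
qed

lemma exchange_matrix_nonneg: "a \<noteq> b \<Longrightarrow> exchange_matrix n a b \<ge> 0"
  unfolding exchange_matrix_def by (auto intro!: sum_nonneg)

lemma exchange_matrix_hop_pos:
  assumes "k < n" "l < n" "inc l a = inc k b" "b l > 0" "a \<noteq> b"
  shows "exchange_matrix n a b > 0"
proof -
  let ?f = "\<lambda>k l. if inc l a = inc k b then real (b l) else 0"
  have "0 < ?f k l" using assms by simp
  also have "\<dots> \<le> (\<Sum>l<n. ?f k l)" using assms(2) by (intro member_le_sum) auto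
  also have "\<dots> \<le> (\<Sum>k<n. \<Sum>l<n. ?f k l)" using assms(1)
    by (intro member_le_sum[where f="\<lambda>k. \<Sum>l<n. ?f k l"]) (auto intro!: sum_nonneg)
  finally show ?thesis using assms(5) by (simp add: exchange_matrix_def)
qed

definition axis_expo :: "nat \<Rightarrow> nat \<Rightarrow> nat \<Rightarrow> nat" where
  "axis_expo d j = (\<lambda>i. if i = j then d else 0)"

lemma axis_expo: "j < n \<Longrightarrow> axis_expo d j \<in> expos n d"
  by (auto simp: axis_expo_def expos_def)

text \<open>All exponents are connected to \<open>(d, 0, \<dots>, 0)\<close> by moving one unit at a time to the
  first variable.\<close>

lemma closed_contains_axis:
  assumes "a \<in> Z" "Z \<subseteq> expos n d" "n \<ge> 1"
    and closed: "\<And>i j. i \<in> Z \<Longrightarrow> j \<in> expos n d \<Longrightarrow> j \<noteq> i \<Longrightarrow> exchange_matrix n j i > 0 \<Longrightarrow> j \<in> Z"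
  shows "axis_expo d 0 \<in> Z"
  using assms(1)
proof (induction "d - a 0" arbitrary: a rule: less_induct)
  case less
  have aE: "a \<in> expos n d" using less.prems assms(2) by blast
  have tot: "a 0 + (\<Sum>i\<in>{..<n} - {0}. a i) = d"
    using aE assms(3) sum.remove[of "{..<n}" 0 a] by (simp add: expos_def)
  show ?case
  proof (cases "\<exists>l<n. l \<noteq> 0 \<and> a l > 0")
    case True
    then obtain l where l: "l < n" "l \<noteq> 0" "a l > 0" by blast
    define c where "c = a(l := a l - 1)"
    have ac: "a = inc l c" using l by (auto simp: c_def)
    obtain e where e: "d = Suc e" using aE ac expos_Suc_D l(1) by metis
    have cE: "c \<in> expos n e" using aE inc_expos[OF l(1)] unfolding ac e by blast
    define b where "b = inc 0 c"
    have bE: "b \<in> expos n d" using cE inc_expos[of 0 n c e] assms(3) unfolding b_def e by simp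
    have b0: "b 0 = Suc (a 0)" using l by (simp add: b_def c_def)
    have "exchange_matrix n b a > 0"
    proof (rule exchange_matrix_hop_pos[of 0 n l])
      show "inc l b = inc 0 a" unfolding b_def ac by (rule inc_commute)
      show "b \<noteq> a" using b0 by auto
    qed (use l assms(3) in auto)
    moreover have "b \<noteq> a" using b0 by auto
    ultimately have "b \<in> Z" using closed[OF less.prems bE] by blast
    moreover have "d - b 0 < d - a 0" using expos_le[OF bE, of 0] b0 by simp
    ultimately show ?thesis using less.hyps by blast
  next
    case False
    then have "\<forall>l\<in>{..<n} - {0}. a l = 0" by auto
    then have "a 0 = d" using tot by simp
    then have "a = axis_expo d 0"
    proof (intro ext)
      fix i
      show "a i = axis_expo d 0 i"
        using False aE \<open>a 0 = d\<close> by (cases "i = 0"; cases "i < n") (auto simp: axis_expo_def expos_def)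
    qed
    then show ?thesis using less.prems by simp
  qed
qed

text \<open>Positivity of entries is symmetric, so the complement of a closed set is closed too. If
  both were nonempty, both would contain \<open>axis_expo d 0\<close>.\<close>

lemma irreducible_exchange_matrix:
  assumes "n \<ge> 1"
  shows "irreducible_symmetric (expos n d) (factorial_weight n) (exchange_matrix n)"
proof
  show "expos n d \<noteq> {}" using axis_expo[of 0 n d] assms by auto
next
  fix Z assume Z: "Z \<subseteq> expos n d" "Z \<noteq> {}"
    and closed: "\<And>i j. i \<in> Z \<Longrightarrow> j \<in> expos n d \<Longrightarrow> j \<noteq> i \<Longrightarrow> exchange_matrix n j i > 0 \<Longrightarrow> j \<in> Z"
  have sym: "exchange_matrix n i j > 0" if "exchange_matrix n j i > 0" for i j
    using exchange_matrix_symm[of n i j] that factorial_weight_pos[of n i] factorial_weight_pos[of n j] by (metis mult_pos_pos zero_less_mult_pos)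
  show "Z = expos n d"
  proof (rule ccontr)
    assume "Z \<noteq> expos n d"
    then obtain b where b: "b \<in> expos n d - Z" using Z by blast
    obtain a where a: "a \<in> Z" using Z by blast
    have "axis_expo d 0 \<in> expos n d - Z"
    proof (rule closed_contains_axis[OF b _ assms])
      fix i j assume "i \<in> expos n d - Z" "j \<in> expos n d" "j \<noteq> i" "exchange_matrix n j i > 0"
      then show "j \<in> expos n d - Z" using closed[of j i] sym[of j i] by auto
    qed auto
    moreover have "axis_expo d 0 \<in> Z" by (rule closed_contains_axis[OF a Z(1) assms closed])
    ultimately show False by blast
  qed
qed (auto simp: factorial_weight_pos exchange_matrix_symm exchange_matrix_nonneg)

section \<open>Invariance of the cone under the semigroup\<close>

lemma stable_cone_zero: "(\<And>a. a \<in> expos n d \<Longrightarrow> x a = 0) \<Longrightarrow> stable_cone n d x"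
  by (simp add: stable_cone_def nonneg_coeffs_def msum_def)

text \<open>The zero polynomial belongs to the cone without being stable, so it has to be treated
  separately.\<close>

lemma stable_cone_step:
  assumes "stable_cone n d x" "stable_coeffs n d x \<Longrightarrow> stable_coeffs n d y" "nonneg_coeffs n d y"
    "(\<And>a. a \<in> expos n d \<Longrightarrow> x a = 0) \<Longrightarrow> (\<And>a. a \<in> expos n d \<Longrightarrow> y a = 0)"
  shows "stable_cone n d y"
proof (cases "\<exists>a\<in>expos n d. x a \<noteq> 0")
  case True
  then show ?thesis using stable_cone_imp_stable[OF assms(1)] assms(2,3) stable_imp_stable_cone by blast
next
  case False
  then show ?thesis using assms(4) stable_cone_zero by blast
qed

lemma stable_cone_coeff_cong:
  assumes "\<And>a. a \<in> expos n d \<Longrightarrow> x a = y a"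
  shows "stable_cone n d x = stable_cone n d y"
proof -
  have "ev n d x w = ev n d y w" for w :: "nat \<Rightarrow> real"
    using assms by (rule msum_coeff_cong)
  moreover have "ev n d x w = ev n d y w" for w :: "nat \<Rightarrow> complex"
    using assms by (rule msum_coeff_cong)
  ultimately show ?thesis using assms by (simp add: stable_cone_def nonneg_coeffs_def)
qed

lemma stable_cone_scale: "stable_cone n d x \<Longrightarrow> r \<ge> 0 \<Longrightarrow> stable_cone n d (\<lambda>a. r * x a)"
  by (auto simp: stable_cone_def nonneg_coeffs_def msum_mult norm_mult mult_left_mono)

lemma stable_cone_limit:
  assumes "\<And>m. stable_cone n d (X m)" "\<And>a. a \<in> expos n d \<Longrightarrow> (\<lambda>m. X m a) \<longlonglongrightarrow> x a"
  shows "stable_cone n d x"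
  unfolding stable_cone_def nonneg_coeffs_def
proof (intro conjI ballI allI impI)
  fix a assume "a \<in> expos n d"
  then show "0 \<le> x a"
    using assms(1) by (intro LIMSEQ_le_const[OF assms(2)]) (auto simp: stable_cone_def nonneg_coeffs_def)
next
  fix u v :: "nat \<Rightarrow> real" assume v: "\<forall>k<n. 0 < v k"
  show "ev n d x v \<le> cmod (ev n d x (\<lambda>i. Complex (u i) (v i)))"
  proof (rule LIMSEQ_le)
    show "(\<lambda>m. ev n d (X m) v) \<longlonglongrightarrow> ev n d x v"
      by (intro tendsto_msum_coeffs tendsto_const assms(2))
    show "(\<lambda>m. cmod (ev n d (X m) (\<lambda>i. Complex (u i) (v i)))) \<longlonglongrightarrow> cmod (ev n d x (\<lambda>i. Complex (u i) (v i)))"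
      by (intro tendsto_norm tendsto_msum_coeffs tendsto_const assms(2))
    show "\<exists>N. \<forall>m\<ge>N. ev n d (X m) v \<le> cmod (ev n d (X m) (\<lambda>i. Complex (u i) (v i)))"
      using stable_coneD[OF assms(1) v] by blast
  qed
qed

locale stable_flow = perron_frame "expos n d" "factorial_weight n" "exchange_matrix n" v \<mu>
  for n d :: nat and v \<mu> +
  assumes n1: "n \<ge> 1"
begin

lemma app_eq:
  assumes "a \<in> expos n d"
  shows "app x a = (\<Sum>k<n. \<Sum>l<n. hop n d k l x a) - (\<Sum>k<n. (real (a k))\<^sup>2) * x a"
proof -
  have "app x a = (\<Sum>b\<in>expos n d. (\<Sum>k<n. \<Sum>l<n. (if inc l a = inc k b then real (b l) * x b else 0)))
      - (\<Sum>b\<in>expos n d. if b = a then (\<Sum>k<n. (real (a k))\<^sup>2) * x a else 0)"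
    unfolding app_def exchange_matrix_def left_diff_distrib sum_subtractf sum_distrib_right
    by (intro arg_cong2[where f="(-)"] sum.cong refl) (auto simp: sum_distrib_right)
  also have "(\<Sum>b\<in>expos n d. if b = a then (\<Sum>k<n. (real (a k))\<^sup>2) * x a else 0) = (\<Sum>k<n. (real (a k))\<^sup>2) * x a"
    using assms by simp
  also have "(\<Sum>b\<in>expos n d. (\<Sum>k<n. \<Sum>l<n. (if inc l a = inc k b then real (b l) * x b else 0)))
      = (\<Sum>k<n. \<Sum>l<n. hop n d k l x a)"
    unfolding hop_def by (subst sum.swap, intro sum.cong refl, rule sum.swap)
  finally show ?thesis .
qed

lemma infinitesimal_hop:
  assumes "k < n" "l < n"
  shows "infinitesimal (Collect (stable_cone n d)) (hop n d k l)"
proof (rule infinitesimalI[where sm = 1 and A = "\<lambda>a b. if inc l a = inc k b then real (b l) else 0"])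
  fix x a show "hop n d k l x a = (\<Sum>b\<in>expos n d. (if inc l a = inc k b then real (b l) else 0) * x b)"
    unfolding hop_def by (intro sum.cong) auto
next
  fix s :: real and x assume s: "0 < s" "s \<le> 1" and x: "x \<in> Collect (stable_cone n d)"
  have nnx: "b \<in> expos n d \<Longrightarrow> x b \<ge> 0" for b using x by (auto simp: stable_cone_def nonneg_coeffs_def)
  have "stable_cone n d (\<lambda>i. x i + s * hop n d k l x i)"
  proof (rule stable_cone_step[of n d x])
    show "nonneg_coeffs n d (\<lambda>i. x i + s * hop n d k l x i)"
      using hop_nonneg[OF nnx] s nnx by (auto simp: nonneg_coeffs_def intro!: add_nonneg_nonneg mult_nonneg_nonneg)
    show "stable_coeffs n d x \<Longrightarrow> stable_coeffs n d (\<lambda>i. x i + s * hop n d k l x i)"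
      using stable_hop assms s by (simp add: less_imp_le)
  qed (use x in \<open>auto simp: hop_def intro!: sum.neutral\<close>)
  then show "(\<lambda>i. x i + s * hop n d k l x i) \<in> Collect (stable_cone n d)" by simp
qed auto

lemma infinitesimal_diag:
  assumes "k < n"
  shows "infinitesimal (Collect (stable_cone n d)) (\<lambda>x a. - (real (a k))\<^sup>2 * x a)"
\<comment> \<open>This step size gives \<open>s * d\<^sup>2 < 1\<close>, which serves both stability
  and nonnegativity; the summand \<open>1\<close> covers \<open>d = 0\<close>.\<close>
proof (rule infinitesimalI[where sm = "1 / (1 + (real d)\<^sup>2)" and A = "\<lambda>a b. if b = a then - (real (a k))\<^sup>2 else 0"])
  fix x a assume "a \<in> expos n d"
  then show "- (real (a k))\<^sup>2 * x a = (\<Sum>b\<in>expos n d. (if b = a then - (real (a k))\<^sup>2 else 0) * x b)"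
    by (simp add: if_distrib if_distribR sum.delta cong: if_cong)
next
  fix s :: real and x assume s: "0 < s" "s \<le> 1 / (1 + (real d)\<^sup>2)" and x: "x \<in> Collect (stable_cone n d)"
  have p: "1 + (real d)\<^sup>2 > 0" by (smt (verit) zero_le_power2)
  have "s * (1 + (real d)\<^sup>2) \<le> 1" using s(2) p by (simp add: pos_le_divide_eq)
  then have sd: "s * (real d)\<^sup>2 < 1" using s(1) by (simp add: distrib_left)
  have eq: "(\<lambda>i. x i + s * (- (real (i k))\<^sup>2 * x i)) = (\<lambda>i. x i - s * (real (i k))\<^sup>2 * x i)" by auto
  have "stable_cone n d (\<lambda>i. x i - s * (real (i k))\<^sup>2 * x i)"
  proof (rule stable_cone_step[of n d x])
    show "nonneg_coeffs n d (\<lambda>i. x i - s * (real (i k))\<^sup>2 * x i)"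
      unfolding nonneg_coeffs_def
    proof
      fix a assume a: "a \<in> expos n d"
      have "s * (real (a k))\<^sup>2 \<le> s * (real d)\<^sup>2"
        using expos_le[OF a, of k] s by (intro mult_left_mono power_mono) auto
      then have "s * (real (a k))\<^sup>2 * x a \<le> 1 * x a"
        using sd x a by (intro mult_right_mono) (auto simp: stable_cone_def nonneg_coeffs_def)
      then show "0 \<le> x a - s * (real (a k))\<^sup>2 * x a" by simp
    qed
    show "stable_coeffs n d x \<Longrightarrow> stable_coeffs n d (\<lambda>i. x i - s * (real (i k))\<^sup>2 * x i)"
      using stable_diag assms s(1) sd by (simp add: less_imp_le)
  qed (use x in auto)
  then show "(\<lambda>i. x i + s * (- (real (i k))\<^sup>2 * x i)) \<in> Collect (stable_cone n d)" unfolding eq by simp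
next
  show "1 / (1 + (real d)\<^sup>2) > 0" by (simp add: add_pos_nonneg)
qed

text \<open>Accounts for the shift by \<open>- \<mu> 0\<close>: for
  \<open>s * \<bar>c\<bar> \<le> 1\<close> the map is a nonnegative scaling.\<close>

lemma infinitesimal_const: "infinitesimal (Collect (stable_cone n d)) (\<lambda>x a. c * x a)"
proof (rule infinitesimalI[where sm = "1 / (1 + \<bar>c\<bar>)" and A = "\<lambda>a b. if b = a then c else 0"])
  fix x a assume "a \<in> expos n d"
  then show "c * x a = (\<Sum>b\<in>expos n d. (if b = a then c else 0) * x b)"
    by (simp add: if_distrib if_distribR sum.delta cong: if_cong)
next
  fix s :: real and x assume s: "0 < s" "s \<le> 1 / (1 + \<bar>c\<bar>)" and x: "x \<in> Collect (stable_cone n d)"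
  have p: "1 + \<bar>c\<bar> > 0" by simp
  have "s * (1 + \<bar>c\<bar>) \<le> 1" using s(2) p by (simp add: pos_le_divide_eq)
  then have "s * \<bar>c\<bar> \<le> 1" using s(1) by (simp add: distrib_left)
  then have "\<bar>s * c\<bar> \<le> 1" using s(1) by (simp add: abs_mult)
  then have "1 + s * c \<ge> 0" by linarith
  then have "stable_cone n d (\<lambda>a. (1 + s * c) * x a)" using x by (intro stable_cone_scale) auto
  then show "(\<lambda>i. x i + s * (c * x i)) \<in> Collect (stable_cone n d)" by (simp add: distrib_right mult.assoc)
qed (simp add: add_pos_nonneg)

lemma infinitesimal_app: "infinitesimal (Collect (stable_cone n d)) (\<lambda>x a. app x a + (- \<mu> 0) * x a)"
proof -
  have ne: "{..<n} \<noteq> {}" using n1 by (auto simp: lessThan_empty_iff)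
  have "infinitesimal (Collect (stable_cone n d)) (\<lambda>x a. ((\<Sum>k<n. \<Sum>l<n. hop n d k l x a) +
      (\<Sum>k<n. - (real (a k))\<^sup>2 * x a)) + (- \<mu> 0) * x a)"
    by (intro infinitesimal_add infinitesimal_const infinitesimal_sum infinitesimal_diag infinitesimal_hop
        finite_lessThan ne) auto
  then show ?thesis
    by (rule infinitesimal_cong) (simp add: app_eq sum_negf sum_distrib_right)
qed

lemma flow_cone:
  assumes "stable_cone n d x" "t \<ge> 0"
  shows "stable_cone n d (flow t x)"
proof (cases "t = 0")
  case True
  then show ?thesis using stable_cone_coeff_cong[of n d "flow 0 x" x] flow_0 assms(1) by auto
next
  case False
  have "flow t x \<in> Collect (stable_cone n d)"
  proof (rule flow_invariant[OF infinitesimal_app])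
    fix X :: "nat \<Rightarrow> (nat \<Rightarrow> nat) \<Rightarrow> real" and y
    assume "\<And>m. X m \<in> Collect (stable_cone n d)" "\<And>a. a \<in> expos n d \<Longrightarrow> (\<lambda>m. X m a) \<longlonglongrightarrow> y a"
    then show "y \<in> Collect (stable_cone n d)" using stable_cone_limit[of n d X y] by simp
  qed (use assms False in auto)
  then show ?thesis by simp
qed

lemma flow_coeff_pos:
  assumes "stable_cone n d x" "\<exists>a\<in>expos n d. x a \<noteq> 0" "t > 0" "a \<in> expos n d"
  shows "flow t x a > 0"
proof (rule flow_pos[OF _ assms(2-4)])
  fix t :: real and a assume "t \<ge> 0" "a \<in> expos n d"
  then show "flow t x a \<ge> 0" using flow_cone[OF assms(1)] by (auto simp: stable_cone_def nonneg_coeffs_def)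
qed

end

section \<open>Real zeros along the semigroup\<close>

lemma coeff_mult_eq_first:
  fixes p q :: "'a::comm_ring_1 poly"
  assumes "\<And>i. i < N \<Longrightarrow> coeff q i = 0"
  shows "coeff (p * q) N = coeff p 0 * coeff q N"
proof -
  have "coeff (p * q) N = (\<Sum>i\<le>N. coeff p i * coeff q (N - i))" by (rule coeff_mult)
  also have "\<dots> = (\<Sum>i\<le>N. if i = 0 then coeff p 0 * coeff q N else 0)"
    using assms by (intro sum.cong) auto
  finally show ?thesis by simp
qed

lemma poly_decompose_order_0:
  fixes p :: "real poly"
  assumes "p \<noteq> 0"
  obtains m q where "p = monom 1 m * q" "coeff q 0 \<noteq> 0" "coeff p m \<noteq> 0" "\<And>i. i < m \<Longrightarrow> coeff p i = 0"
proof -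
  obtain q where q: "p = [:- 0, 1:] ^ order 0 p * q" "\<not> [:- 0, 1:] dvd q"
    using order_decomp[OF assms, of 0] by blast
  have p: "p = monom 1 (order 0 p) * q" using q(1) by (simp add: monom_altdef)
  have q0: "coeff q 0 \<noteq> 0" using q(2) by (simp add: dvd_iff_poly_eq_0 poly_0_coeff_0)
  have "coeff p i = (if i < order 0 p then 0 else coeff q (i - order 0 p))" for i
    by (subst p) (simp add: coeff_monom_mult)
  then show ?thesis using that[OF p q0] q0 by simp
qed

lemma ev_ge_axis:
  assumes "nonneg_coeffs n d x" "j < n" "\<And>i. i < n \<Longrightarrow> v i \<ge> (0::real)"
  shows "x (axis_expo d j) * v j ^ d \<le> ev n d x v"
proof -
  have "mon n (axis_expo d j) v = v j ^ d"
    using assms(2) by (simp add: mon_split[of j] axis_expo_def)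
  then have "x (axis_expo d j) * v j ^ d = of_real (x (axis_expo d j)) * mon n (axis_expo d j) v" by simp
  also have "\<dots> \<le> ev n d x v" unfolding msum_def
    using assms axis_expo[OF assms(2)]
    by (intro member_le_sum) (auto simp: nonneg_coeffs_def intro!: mult_nonneg_nonneg mon_nonneg)
  finally show ?thesis .
qed

text \<open>The operator identity \<open>(w \<partial>)\<^sup>2 = w\<^sup>2 \<partial>\<^sup>2 + w
  \<partial>\<close>, which isolates the second-order term.\<close>

lemma ev_sq:
  assumes "k < n"
  shows "ev n d (\<lambda>a. (real (a k))\<^sup>2 * x a) w = (w k)\<^sup>2 * ddev n d k x w + w k * dev n d k x w"
proof -
  have t: "of_real ((real (a k))\<^sup>2 * x a) * mon n a w =
      (w k)\<^sup>2 * (of_real (x a * real (a k * (a k - 1))) * mon n (a(k := a k - 1 - 1)) w) +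
      w k * (of_real (x a * real (a k)) * mon n (a(k := a k - 1)) w)" for a
  proof (cases "a k")
    case (Suc b)
    have 1: "mon n a w = w k * mon n (a(k := a k - 1)) w"
      using mon_inc[OF assms, of "a(k := a k - 1)" w] fun_upd_triv[of a k] Suc by simp
    show ?thesis
    proof (cases b)
      case 0
      then show ?thesis using Suc 1 by simp
    next
      case (Suc c)
      have "mon n (a(k := a k - 1)) w = w k * mon n (a(k := a k - 1 - 1)) w"
        using mon_inc[OF assms, of "a(k := a k - 1 - 1)" w] Suc \<open>a k = Suc b\<close> by simp
      moreover have "(real (a k))\<^sup>2 = real (a k * (a k - 1)) + real (a k)"
        using \<open>a k = Suc b\<close> by (simp add: power2_eq_square algebra_simps)
      ultimately show ?thesis unfolding 1 by (simp add: algebra_simps power2_eq_square)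
    qed
  qed simp
  show ?thesis
    unfolding msum_def t sum.distrib sum_distrib_left ..
qed

text \<open>Homogeneity of degree \<open>d - 1\<close>; the extra factor \<open>c\<close> avoids the
  truncated exponent at \<open>d = 0\<close>.\<close>

lemma dev_scale: "c * dev n d l x (\<lambda>i. c * w i) = c ^ d * dev n d l x w" if "l < n"
proof -
  have "c * (of_real (x a * real (a l)) * mon n (a(l := a l - 1)) (\<lambda>i. c * w i)) =
      c ^ d * (of_real (x a * real (a l)) * mon n (a(l := a l - 1)) w)" if a: "a \<in> expos n d" for a
  proof (cases "a l")
    case (Suc b)
    have "inc l (a(l := b)) = a" using Suc by auto
    then obtain e where e: "d = Suc e" "a(l := b) \<in> expos n e"
      using expos_Suc_D[where l = l and c = "a(l := b)"] inc_expos[OF \<open>l < n\<close>, where a = "a(l := b)"]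
        a \<open>l < n\<close> by metis
    then have "(\<Sum>i<n. (a(l := b)) i) = e" by (simp add: expos_def)
    then show ?thesis using Suc e(1) by (simp add: mon_scale mult_ac)
  qed simp
  then show ?thesis unfolding msum_def sum_distrib_left by (intro sum.cong) auto
qed

text \<open>Linearity in \<open>c\<close> with weights independent of \<open>c\<close>, so that
  these coefficients can be differentiated along the semigroup.\<close>

lemma shifted_line_poly_coeff: "coeff (shifted_line_poly n I c e y j) k = (\<Sum>i\<in>I. c i * coeff (shifted_line_poly n {i} (\<lambda>_. 1) e y j) k)"
proof (cases "finite I")
  case True
  then show ?thesis
    unfolding shifted_line_poly_def line_poly_def
  proof (induction I rule: finite_induct)
    case (insert i I)
    have "monom (c i * P) m = smult (c i) (monom P m)" for P :: real and m by (simp add: smult_monom)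
    then show ?case using insert by (simp add: pcompose_add pcompose_smult)
  qed simp
qed (simp add: shifted_line_poly_def line_poly_def)

text \<open>Mean value theorem on a vertical segment: moving upwards multiplies the derivative by
  \<open>\<i>\<close>, and \<open>Im (\<i> * a) = Re a\<close>.\<close>

lemma Im_poly_mean_value:
  fixes p :: "complex poly"
  assumes "v > 0"
  shows "\<exists>\<tau>>0. \<tau> < v \<and> Im (poly p (Complex u v)) - Im (poly p (Complex u 0)) = v * Re (poly (pderiv p) (Complex u \<tau>))"
proof -
  have "((\<lambda>\<tau>. Im (poly p (Complex u \<tau>))) has_real_derivative Re (poly (pderiv p) (Complex u \<tau>))) (at \<tau>)" for \<tau>
  proof -
    have c: "((\<lambda>\<tau>. Complex u \<tau>) has_vector_derivative \<i>) (at \<tau>)"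
    proof -
      have "(\<lambda>\<tau>. Complex u \<tau>) = (\<lambda>\<tau>. of_real u + \<i> * of_real \<tau>)" by (simp add: fun_eq_iff complex_eq_iff)
      then show ?thesis unfolding has_vector_derivative_def
        by (auto intro!: derivative_eq_intros simp: scaleR_conv_of_real)
    qed
    have "((poly p \<circ> (\<lambda>\<tau>. Complex u \<tau>)) has_vector_derivative (\<i> * poly (pderiv p) (Complex u \<tau>))) (at \<tau>)"
      by (rule field_vector_diff_chain_at[OF c poly_DERIV])
    then have "((\<lambda>\<tau>. Im (poly p (Complex u \<tau>))) has_vector_derivative Im (\<i> * poly (pderiv p) (Complex u \<tau>))) (at \<tau>)"
      unfolding o_def by (rule bounded_linear.has_vector_derivative[OF bounded_linear_Im])
    then show ?thesis by (simp add: has_real_derivative_iff_has_vector_derivative)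
  qed
  from MVT2[OF assms this] show ?thesis by auto
qed

context stable_flow
begin

text \<open>The conclusion is more than simplicity: all partial derivatives are nonzero and of one
  sign, the form that survives perturbation. If one of them vanished, the whole gradient would, so
  the contradiction can be sought along a direction with \<open>y i \<noteq> 0\<close>, where the
  second-order term of \<open>L\<close> is visible.\<close>

lemma simple_zeros:
  assumes x: "stable_cone n d x" "\<exists>a\<in>expos n d. x a \<noteq> 0" and t: "t > 0"
    and y: "\<exists>i<n. y i \<noteq> 0" "ev n d (flow t x) y = (0::real)"
    and kl: "k < n" "l < n"
  shows "dev n d k (flow t x) y * dev n d l (flow t x) y > (0::real)"
proof -
  let ?E = "expos n d"
  define F where "F s = flow s x" for s
  have Fpos: "F s a > 0" if "s > 0" "a \<in> ?E" for s a
    unfolding F_def by (rule flow_coeff_pos[OF x that])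
  have Fcone: "stable_cone n d (F s)" if "s > 0" for s using flow_cone[OF x(1)] that by (simp add: F_def)
  have nnF: "nonneg_coeffs n d (F s)" if "s > 0" for s using Fpos that by (auto simp: nonneg_coeffs_def less_imp_le)
  have Fstab: "stable_coeffs n d (F s)" if "s > 0" for s
    using stable_cone_imp_stable[OF Fcone[OF that]] Fpos[OF that] axis_expo[OF kl(1)] by (metis less_irrefl)
  \<comment> \<open>On the line through \<open>y\<close> in direction \<open>j\<close>,
    \<open>P\<close> is \<open>f\<^sub>s\<close>, and \<open>Q\<close> and \<open>R\<close> are the
    first and second \<open>l\<close>-th partial derivatives of \<open>f\<^sub>t\<close>.\<close>
  define P where "P s j = shifted_line_poly n ?E (F s) (\<lambda>a. a) y j" for s j
  define Q where "Q l j = shifted_line_poly n ?E (\<lambda>a. F t a * real (a l)) (\<lambda>a. a(l := a l - 1)) y j" for l j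
  define R where "R l j = shifted_line_poly n ?E (\<lambda>a. F t a * real (a l * (a l - 1))) (\<lambda>a. a(l := a l - 1 - 1)) y j" for l j
  let ?w = "\<lambda>j z. (\<lambda>i. complex_of_real (y i))(j := of_real (y j) + z)"
  \<comment> \<open>Only coordinate \<open>j\<close> becomes nonreal here, so stability does not
    apply directly; the cone inequality on the closed orthant does, with the positive coefficient of
    \<open>w\<^sub>j ^ d\<close> as lower bound.\<close>
  have A: "cpoly (P s j) z \<noteq> 0" if s: "s > 0" and j: "j < n" and z: "Im z > 0" for s j z
  proof -
    define v where "v = (\<lambda>i. if i = j then Im z else 0)"
    have w: "?w j z = (\<lambda>i. Complex ((y(j := y j + Re z)) i) (v i))"
      by (auto simp: fun_eq_iff complex_eq_iff v_def)
    have "0 < F s (axis_expo d j) * v j ^ d" using Fpos[OF s axis_expo[OF j]] z by (simp add: v_def)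
    also have "\<dots> \<le> ev n d (F s) v" using nnF[OF s] j z by (intro ev_ge_axis) (auto simp: v_def)
    also have "\<dots> \<le> cmod (ev n d (F s) (?w j z))"
      unfolding w by (rule stable_cone_closed_orthant[OF Fcone[OF s]]) (use z in \<open>auto simp: v_def\<close>)
    finally show ?thesis unfolding P_def cpoly_shifted_line_poly[OF j] by auto
  qed
  have B: "Im (cpoly (Q l j) z * cnj (cpoly (P t j) z)) \<le> 0"
    and C: "Im (cpoly (R l j) z * cnj (cpoly (Q l j) z)) \<le> 0"
    if j: "j < n" and l: "l < n" and z: "Im z > 0" for l j z
    unfolding P_def Q_def R_def cpoly_shifted_line_poly[OF j]
    by (rule stable_Im_dev_le[OF Fstab[OF t] _ l], use z in simp)+
  \<comment> \<open>Far out on the line, and rescaled by homogeneity, the derivative tends to its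
    value at the \<open>j\<close>-th unit vector, to which \<open>inc l (axis_expo e j)\<close>
    contributes positively.\<close>
  have Q0: "Q l j \<noteq> 0" if d: "d \<ge> 1" and j: "j < n" and l: "l < n" for l j
  proof
    assume "Q l j = 0"
    then have z: "dev n d l (F t) (y(j := y j + z)) = 0" for z
      using poly_shifted_line_poly[OF j, of ?E "\<lambda>a. F t a * real (a l)" "\<lambda>a. a(l := a l - 1)" y z] by (simp add: Q_def)
    let ?h = "\<lambda>\<epsilon>. dev n d l (F t) (\<lambda>i. \<epsilon> * y i + (if i = j then 1 else 0))"
    have h: "?h \<epsilon> = 0" if e: "\<epsilon> > 0" for \<epsilon>
    proof -
      have "(\<lambda>i. \<epsilon> * y i + (if i = j then 1 else 0)) = (\<lambda>i. \<epsilon> * (y(j := y j + 1 / \<epsilon>)) i)"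
        using e by (auto simp: fun_eq_iff field_simps)
      then have "\<epsilon> * ?h \<epsilon> = \<epsilon> ^ d * dev n d l (F t) (y(j := y j + 1 / \<epsilon>))"
        using dev_scale[OF l, of \<epsilon> d "F t" "y(j := y j + 1 / \<epsilon>)"] by simp
      then show ?thesis using z e by simp
    qed
    have "(?h \<longlongrightarrow> ?h 0) (at_right 0)" by (intro tendsto_msum tendsto_intros)
    moreover have "(?h \<longlongrightarrow> 0) (at_right 0)"
      by (intro tendsto_eventually eventually_mono[OF eventually_at_right_less[of 0]]) (rule h)
    ultimately have h0: "?h 0 = 0" by (rule tendsto_unique[OF trivial_limit_at_right_real])
    obtain e where e: "d = Suc e" using d by (cases d) auto
    let ?b = "inc l (axis_expo e j)"
    let ?u = "\<lambda>i. 0 * y i + (if i = j then 1 else 0 :: real)"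
    have b: "?b \<in> ?E" using inc_expos[OF l] axis_expo[OF j] e by simp
    have "mon n (axis_expo e j) ?u = 1" using j by (simp add: mon_split[of j] axis_expo_def)
    then have "0 < F t ?b * real (?b l) * mon n (?b(l := ?b l - 1)) ?u" using Fpos[OF t b] by simp
    also have "\<dots> \<le> (\<Sum>a\<in>?E. F t a * real (a l) * mon n (a(l := a l - 1)) ?u)"
      using b Fpos[OF t]
      by (intro member_le_sum[where f="\<lambda>a. F t a * real (a l) * mon n (a(l := a l - 1)) ?u"])
        (auto intro!: mult_nonneg_nonneg mon_nonneg simp: less_imp_le)
    also have "\<dots> = ?h 0" by (simp add: msum_def)
    finally show False using h0 by simp
  qed
  have P0: "P s j \<noteq> 0" if "s > 0" "j < n" for s j using A[OF that, of \<i>] by auto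
  have Pc0: "coeff (P t j) 0 = 0" if j: "j < n" for j
    using y(2) poly_shifted_line_poly[OF j, of ?E "F t" "\<lambda>a. a" y 0] by (simp add: P_def F_def poly_0_coeff_0)
  have Qc0: "coeff (Q l j) 0 = dev n d l (F t) y" if j: "j < n" for l j
    using poly_shifted_line_poly[OF j, of ?E "\<lambda>a. F t a * real (a l)" "\<lambda>a. a(l := a l - 1)" y 0] by (simp add: Q_def poly_0_coeff_0)
  have QP: "Q j j = pderiv (P t j)" for j by (simp add: P_def Q_def pderiv_shifted_line_poly)
  have RP: "R j j = pderiv (pderiv (P t j))" for j
    unfolding QP[symmetric] by (simp add: Q_def R_def pderiv_shifted_line_poly mult.assoc)
  \<comment> \<open>The zero has order \<open>m \<ge> 2\<close> along direction \<open>j\<close>, so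
    \<open>order_lemma\<close> forces \<open>Q l j\<close> to vanish at \<open>0\<close>.\<close>
  have dbl: "dev n d l (F t) y = 0" if d0: "dev n d j (F t) y = 0" and j: "j < n" and l: "l < n" for j l
  proof -
    obtain m q where m: "P t j = monom 1 m * q" "coeff q 0 \<noteq> 0" "coeff (P t j) m \<noteq> 0"
      using poly_decompose_order_0[OF P0[OF t j]] by metis
    have "coeff (P t j) 1 = 0" using d0 Qc0[OF j, of j] by (simp add: QP coeff_pderiv)
    then have "Suc 0 < m" using Pc0[OF j] m(3) by (metis One_nat_def Suc_lessI not_gr_zero)
    then have "coeff (Q l j) 0 = 0" using order_lemma(1)[OF B[OF j l] m(1,2)] by blast
    then show ?thesis using Qc0[OF j] by simp
  qed
  have nz: "dev n d j (F t) y \<noteq> 0" if j: "j < n" for j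
  proof
    assume "dev n d j (F t) y = 0"
    then have all0: "dev n d l (F t) y = 0" if "l < n" for l using dbl j that by blast
    obtain i where i: "i < n" "y i \<noteq> 0" using y(1) by blast
    obtain m q where m: "P t i = monom 1 m * q" "coeff q 0 \<noteq> 0" "coeff (P t i) m \<noteq> 0"
        "\<And>j. j < m \<Longrightarrow> coeff (P t i) j = 0"
      using poly_decompose_order_0[OF P0[OF t i(1)]] by metis
    have "coeff (P t i) 1 = 0" using all0[OF i(1)] Qc0[OF i(1), of i] by (simp add: QP coeff_pderiv)
    then have m2: "m \<ge> 2" using Pc0[OF i(1)] m(3) by (metis One_nat_def less_2_cases not_le)
    have d1: "d \<ge> 1"
    proof (rule ccontr)
      assume "\<not> d \<ge> 1"
      then have "degree (P t i) = 0"
        using degree_line_poly[of ?E "\<lambda>a. a" i d n "F t" y] expos_le[of _ n d i]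
        by (simp add: P_def shifted_line_poly_def degree_pcompose)
      then show False using m2 m(3) by (simp add: coeff_eq_0)
    qed
    let ?N = "m - 2"
    have Qv: "coeff (Q l i) r = 0" if "l < n" "r < m - 1" for l r
      using order_lemma(1)[OF B[OF i(1) that(1)] m(1,2)] that(2) by simp
    \<comment> \<open>\<open>order_lemma\<close> is applied from \<open>P\<close> to
      \<open>Q\<close> and from \<open>Q\<close> to \<open>R\<close>. If \<open>Q\<close> has order
      exactly \<open>m - 1\<close>, the signs multiply through its lowest coefficient; if its order
      is larger, the coefficient of \<open>R\<close> in question is zero.\<close>
    have RvP: "(\<forall>r<?N. coeff (R l i) r = 0) \<and> coeff (R l i) ?N * coeff (P t i) m \<ge> 0" if l: "l < n" for l
    proof -
      obtain m' q' where m': "Q l i = monom 1 m' * q'" "coeff q' 0 \<noteq> 0" "coeff (Q l i) m' \<noteq> 0"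
        using poly_decompose_order_0[OF Q0[OF d1 i(1) l]] by metis
      have mm: "m - 1 \<le> m'" using Qv[OF l, of m'] m'(3) by force
      have R1: "coeff (R l i) r = 0" if "Suc r < m'" for r
        using order_lemma(1)[OF C[OF i(1) l] m'(1,2)] that by blast
      have "coeff (R l i) ?N * coeff (P t i) m \<ge> 0"
      proof (cases "m' = m - 1")
        case True
        have N: "m' - 1 = ?N" using True by simp
        have 1: "0 \<le> coeff (R l i) ?N * coeff (Q l i) m'"
          using order_lemma(2)[OF C[OF i(1) l] m'(1,2)] True m2 unfolding N by linarith
        have 2: "0 \<le> coeff (Q l i) m' * coeff (P t i) m"
          using order_lemma(2)[OF B[OF i(1) l] m(1,2)] m2 unfolding True by linarith
        have "0 \<le> (coeff (R l i) ?N * coeff (Q l i) m') * (coeff (Q l i) m' * coeff (P t i) m)"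
          by (rule mult_nonneg_nonneg[OF 1 2])
        then have "0 \<le> (coeff (R l i) ?N * coeff (P t i) m) * (coeff (Q l i) m')\<^sup>2"
          by (simp add: power2_eq_square mult_ac)
        then show ?thesis using m'(3) by (simp add: zero_le_mult_iff)
      next
        case False
        then have "Suc ?N < m'" using mm m2 by linarith
        then show ?thesis using R1 by simp
      qed
      then show ?thesis using R1 mm by auto
    qed
    \<comment> \<open>\<open>F'\<close> is the time derivative at \<open>t\<close>, \<open>D\<close>
      its coefficient of index \<open>m - 2\<close> on the line, and \<open>W k\<close> the variable
      \<open>w\<^sub>k\<close> restricted to the line.\<close>
    define F' where "F' = (\<lambda>a. app (F t) a - \<mu> 0 * F t a)"
    define D where "D = coeff (shifted_line_poly n ?E F' (\<lambda>a. a) y i) ?N"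
    define W where "W k = (if k = i then [:y i, 1:] else [:y k:])" for k
    have W0: "coeff (W k) 0 = y k" for k by (simp add: W_def)
    have "shifted_line_poly n ?E F' (\<lambda>a. a) y i = (\<Sum>k<n. \<Sum>l<n. W k * Q l i)
        - (\<Sum>k<n. W k * (W k * R k i) + W k * Q k i) - smult (\<mu> 0) (P t i)"
      (is "?L = ?R")
    proof -
      have "poly ?L z = poly ?R z" for z
      proof -
        let ?u = "y(i := y i + z)"
        have Wz: "poly (W k) z = ?u k" for k by (auto simp: W_def)
        have "ev n d F' ?u = ev n d (\<lambda>a. (\<Sum>k<n. \<Sum>l<n. hop n d k l (F t) a) +
            ((-1) * (\<Sum>k<n. (real (a k))\<^sup>2 * F t a) + (- \<mu> 0) * F t a)) ?u"
          by (intro msum_coeff_cong) (simp add: F'_def app_eq sum_distrib_right)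
        also have "\<dots> = (\<Sum>k<n. \<Sum>l<n. ev n d (hop n d k l (F t)) ?u) +
            ((-1) * (\<Sum>k<n. ev n d (\<lambda>a. (real (a k))\<^sup>2 * F t a) ?u) + (- \<mu> 0) * ev n d (F t) ?u)"
          by (simp only: msum_add msum_mult msum_sum finite_lessThan of_real_eq_id id_apply)
        also have "\<dots> = (\<Sum>k<n. \<Sum>l<n. ?u k * dev n d l (F t) ?u) +
            ((-1) * (\<Sum>k<n. (?u k)\<^sup>2 * ddev n d k (F t) ?u + ?u k * dev n d k (F t) ?u) + (- \<mu> 0) * ev n d (F t) ?u)"
          by (intro arg_cong2[where f="(+)"] arg_cong2[where f="(*)"] sum.cong refl ev_hop ev_sq) auto
        also have "\<dots> = poly ?R z"
          by (simp only: poly_diff poly_sum poly_mult poly_add poly_smult Wz Q_def R_def P_def poly_shifted_line_poly[OF i(1)])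
            (simp add: power2_eq_square mult.assoc)
        finally show ?thesis unfolding poly_shifted_line_poly[OF i(1)] .
      qed
      then show ?thesis by (simp add: poly_eq_poly_eq_iff[symmetric] fun_eq_iff)
    qed
    then have "D = (\<Sum>k<n. \<Sum>l<n. coeff (W k * Q l i) ?N)
        - (\<Sum>k<n. coeff (W k * (W k * R k i)) ?N + coeff (W k * Q k i) ?N) - \<mu> 0 * coeff (P t i) ?N"
      by (simp add: D_def coeff_sum)
    \<comment> \<open>First-order terms have order at least \<open>m - 1\<close> and do not reach
      the index \<open>m - 2\<close>.\<close>
    moreover have WQ: "coeff (W k * Q l i) ?N = 0" if "l < n" for k l
      using coeff_mult_eq_first[of ?N "Q l i" "W k"] Qv[OF that] m2 by simp
    moreover have WR: "coeff (W k * (W k * R k i)) ?N = (y k)\<^sup>2 * coeff (R k i) ?N" if "k < n" for k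
    proof -
      have "coeff (W k * W k * R k i) ?N = coeff (W k * W k) 0 * coeff (R k i) ?N"
        by (rule coeff_mult_eq_first) (use RvP[OF that] in auto)
      then show ?thesis by (simp only: mult.assoc coeff_mult_0 W0 power2_eq_square)
    qed
    ultimately have D: "D = - (\<Sum>k<n. (y k)\<^sup>2 * coeff (R k i) ?N)"
      using m(4)[of ?N] m2 by simp
    have "coeff (R i i) ?N = real m * real (m - 1) * coeff (P t i) m"
      using m2 by (simp add: RP coeff_pderiv Suc_diff_Suc numeral_2_eq_2)
    then have "coeff (R i i) ?N * coeff (P t i) m > 0"
      using m2 m(3) by (simp add: mult.assoc zero_less_mult_iff) (metis linorder_neqE_linordered_idom)
    then have "0 < (y i)\<^sup>2 * (coeff (R i i) ?N * coeff (P t i) m)" using i by simp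
    also have "\<dots> \<le> (\<Sum>k<n. (y k)\<^sup>2 * (coeff (R k i) ?N * coeff (P t i) m))"
      using RvP i(1) by (intro member_le_sum[where f="\<lambda>k. (y k)\<^sup>2 * (coeff (R k i) ?N * coeff (P t i) m)"]) auto
    also have "\<dots> = - D * coeff (P t i) m" by (simp add: D sum_distrib_right mult.assoc)
    finally have D0: "D \<noteq> 0" by auto
    define cf where "cf r s = coeff (P s i) r" for r s
    \<comment> \<open>The defect in Newton's inequality, nonnegative for \<open>s > 0\<close> and
      zero at \<open>t\<close>, so its derivative vanishes there. As the coefficients of index
      \<open>m - 2\<close> and \<open>m - 1\<close> are zero at \<open>t\<close>, that derivative is
      a nonzero multiple of \<open>D\<close> times the coefficient of index
      \<open>m\<close>.\<close>
    define g where "g s = (fact (Suc ?N) * cf (Suc ?N) s)\<^sup>2 - fact ?N * fact (?N + 2) * (cf ?N s * cf (?N + 2) s)" for s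
    have cf': "(cf r has_real_derivative coeff (shifted_line_poly n ?E F' (\<lambda>a. a) y i) r) (at t)" for r
    proof -
      have fl: "((\<lambda>s. F s a) has_real_derivative F' a) (at t)" if "a \<in> ?E" for a
        unfolding F_def F'_def using flow_deriv[OF that] by simp
      have "((\<lambda>s. \<Sum>a\<in>?E. F s a * coeff (shifted_line_poly n {a} (\<lambda>_. 1) (\<lambda>a. a) y i) r) has_real_derivative
          (\<Sum>a\<in>?E. F' a * coeff (shifted_line_poly n {a} (\<lambda>_. 1) (\<lambda>a. a) y i) r)) (at t)"
        by (intro DERIV_sum DERIV_cmult_right fl)
      then show ?thesis unfolding cf_def P_def shifted_line_poly_coeff[symmetric] .
    qed
    have m22: "?N + 2 = m" "Suc ?N = m - 1" using m2 by auto
    have cft: "cf ?N t = 0" "cf (Suc ?N) t = 0" using m(4) m2 by (auto simp: cf_def)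
    have gd: "(g has_real_derivative - (fact ?N * fact (?N + 2) * (D * cf (?N + 2) t))) (at t)"
      unfolding g_def by (rule derivative_eq_intros cf' refl)+ (simp add: cft D_def)
    have gnn: "g s \<ge> 0" if s: "s > 0" for s
      using newton_inequality[OF A[OF s i(1)], of ?N] by (simp add: g_def cf_def)
    have "- (fact ?N * fact (?N + 2) * (D * cf (?N + 2) t)) = 0"
      by (rule DERIV_local_min[OF gd t]) (use gnn cft in \<open>auto simp: g_def[of t]\<close>)
    then show False using D0 m(3) unfolding m22 by (simp add: cf_def)
  qed
  \<comment> \<open>All zeros now being simple, the sign part of \<open>order_lemma\<close> with
    \<open>m = 1\<close> compares directions \<open>k\<close> and \<open>l\<close>.\<close>
  have "0 \<le> coeff (Q l k) 0 * coeff (P t k) 1"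
  proof -
    obtain m q where m: "P t k = monom 1 m * q" "coeff q 0 \<noteq> 0" "coeff (P t k) m \<noteq> 0"
        "\<And>j. j < m \<Longrightarrow> coeff (P t k) j = 0"
      using poly_decompose_order_0[OF P0[OF t kl(1)]] by metis
    have "coeff (P t k) 1 \<noteq> 0" using nz[OF kl(1)] Qc0[OF kl(1), of k] by (simp add: QP coeff_pderiv)
    then have "m = 1" using m(3,4) Pc0[OF kl(1)] by (metis less_one linorder_neqE_nat)
    then show ?thesis using order_lemma(2)[OF B[OF kl] m(1,2)] by simp
  qed
  moreover have "coeff (P t k) 1 = dev n d k (F t) y" using Qc0[OF kl(1), of k] by (simp add: QP coeff_pderiv)
  ultimately have "0 \<le> dev n d l (F t) y * dev n d k (F t) y" using Qc0[OF kl(1)] by simp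
  then have "0 \<le> dev n d k (F t) y * dev n d l (F t) y" by (simp only: mult.commute)
  moreover have "dev n d k (F t) y * dev n d l (F t) y \<noteq> 0" using nz kl by simp
  ultimately show ?thesis unfolding F_def by linarith
qed

end

section \<open>Interior points\<close>

lemma ev_pos_orthant:
  assumes "\<And>a. a \<in> expos n d \<Longrightarrow> x a > 0" "\<And>i. i < n \<Longrightarrow> v i \<ge> (0::real)" "j < n" "v j > 0"
  shows "ev n d x v > 0"
proof -
  have "0 < x (axis_expo d j) * v j ^ d" using assms axis_expo by simp
  also have "\<dots> \<le> ev n d x v" using assms by (intro ev_ge_axis) (auto simp: nonneg_coeffs_def less_imp_le)
  finally show ?thesis .
qed

text \<open>Raising the imaginary parts of the coordinates one after the other.\<close>

lemma Im_ev_telescope: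
  fixes w :: "nat \<Rightarrow> complex"
  assumes w: "\<And>i. i < n \<Longrightarrow> Im (w i) > 0"
  shows "\<exists>\<xi>. Im (ev n d x w) = (\<Sum>k<n. Im (w k) * Re (dev n d k x (\<xi> k))) \<and>
    (\<forall>k<n. \<forall>i<n. Re (\<xi> k i) = Re (w i) \<and> 0 \<le> Im (\<xi> k i) \<and> Im (\<xi> k i) \<le> Im (w i))"
proof -
  define p where "p k = (\<lambda>i. if i < k then w i else of_real (Re (w i)))" for k :: nat
  have step: "\<exists>z. Im (ev n d x (p (Suc k))) - Im (ev n d x (p k)) = Im (w k) * Re (dev n d k x z) \<and>
      (\<forall>i<n. Re (z i) = Re (w i) \<and> 0 \<le> Im (z i) \<and> Im (z i) \<le> Im (w i))" if k: "k < n" for k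
  proof -
    let ?q = "line_poly n (expos n d) x (\<lambda>a. a) (p k) k"
    obtain \<tau> where \<tau>: "\<tau> > 0" "\<tau> < Im (w k)"
      "Im (poly ?q (Complex (Re (w k)) (Im (w k)))) - Im (poly ?q (Complex (Re (w k)) 0)) =
        Im (w k) * Re (poly (pderiv ?q) (Complex (Re (w k)) \<tau>))"
      using Im_poly_mean_value[OF w[OF k], of ?q "Re (w k)"] by blast
    have 1: "(p k)(k := Complex (Re (w k)) (Im (w k))) = p (Suc k)"
      by (auto simp: p_def fun_eq_iff less_Suc_eq)
    have 2: "(p k)(k := Complex (Re (w k)) 0) = p k"
      by (auto simp: p_def fun_eq_iff complex_eq_iff)
    show ?thesis
    proof (intro exI conjI)
      show "Im (ev n d x (p (Suc k))) - Im (ev n d x (p k)) =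
          Im (w k) * Re (dev n d k x ((p k)(k := Complex (Re (w k)) \<tau>)))"
        using \<tau>(3) unfolding pderiv_line_poly poly_line_poly[OF k] 1 2 .
      show "\<forall>i<n. Re (((p k)(k := Complex (Re (w k)) \<tau>)) i) = Re (w i) \<and>
          0 \<le> Im (((p k)(k := Complex (Re (w k)) \<tau>)) i) \<and> Im (((p k)(k := Complex (Re (w k)) \<tau>)) i) \<le> Im (w i)"
        using \<tau>(1,2) w by (auto simp: p_def less_imp_le)
    qed
  qed
  have "\<forall>k. \<exists>z. k < n \<longrightarrow> Im (ev n d x (p (Suc k))) - Im (ev n d x (p k)) = Im (w k) * Re (dev n d k x z) \<and>
      (\<forall>i<n. Re (z i) = Re (w i) \<and> 0 \<le> Im (z i) \<and> Im (z i) \<le> Im (w i))"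
  proof
    fix k
    show "\<exists>z. k < n \<longrightarrow> Im (ev n d x (p (Suc k))) - Im (ev n d x (p k)) = Im (w k) * Re (dev n d k x z) \<and>
      (\<forall>i<n. Re (z i) = Re (w i) \<and> 0 \<le> Im (z i) \<and> Im (z i) \<le> Im (w i))"
      using step[of k] by (cases "k < n") (simp_all only: simp_thms)
  qed
  then have "\<exists>\<xi>. \<forall>k. k < n \<longrightarrow> Im (ev n d x (p (Suc k))) - Im (ev n d x (p k)) = Im (w k) * Re (dev n d k x (\<xi> k)) \<and>
      (\<forall>i<n. Re (\<xi> k i) = Re (w i) \<and> 0 \<le> Im (\<xi> k i) \<and> Im (\<xi> k i) \<le> Im (w i))"
    by (rule choice)
  then obtain \<xi> where \<xi>0: "\<forall>k. k < n \<longrightarrow> Im (ev n d x (p (Suc k))) - Im (ev n d x (p k)) = Im (w k) * Re (dev n d k x (\<xi> k)) \<and>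
      (\<forall>i<n. Re (\<xi> k i) = Re (w i) \<and> 0 \<le> Im (\<xi> k i) \<and> Im (\<xi> k i) \<le> Im (w i))" ..
  have \<xi>: "Im (ev n d x (p (Suc k))) - Im (ev n d x (p k)) = Im (w k) * Re (dev n d k x (\<xi> k))"
      "\<forall>i<n. Re (\<xi> k i) = Re (w i) \<and> 0 \<le> Im (\<xi> k i) \<and> Im (\<xi> k i) \<le> Im (w i)" if "k < n" for k
    using spec[OF \<xi>0, of k] that by blast+
  have "(\<Sum>k<n. Im (w k) * Re (dev n d k x (\<xi> k))) = (\<Sum>k<n. Im (ev n d x (p (Suc k))) - Im (ev n d x (p k)))"
    by (rule sum.cong) (use \<xi>(1) in \<open>simp_all only: lessThan_iff\<close>)
  also have "\<dots> = Im (ev n d x (p n)) - Im (ev n d x (p 0))" by (rule sum_lessThan_telescope)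
  also have "ev n d x (p n) = ev n d x w" by (rule msum_cong) (simp add: p_def)
  also have "Im (ev n d x (p 0)) = 0" by (simp add: p_def msum_of_real)
  finally have fin: "(\<Sum>k<n. Im (w k) * Re (dev n d k x (\<xi> k))) = Im (ev n d x w)" by (simp only: diff_0_right)
  show ?thesis
  proof (intro exI conjI)
    show "Im (ev n d x w) = (\<Sum>k<n. Im (w k) * Re (dev n d k x (\<xi> k)))" by (rule fin[symmetric])
    show "\<forall>k<n. \<forall>i<n. Re (\<xi> k i) = Re (w i) \<and> 0 \<le> Im (\<xi> k i) \<and> Im (\<xi> k i) \<le> Im (w i)"
      using \<xi>(2) by blast
  qed
qed

lemma tendsto_fun_coordinate:
  fixes X :: "nat \<Rightarrow> 'a \<Rightarrow> 'b::topological_space"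
  assumes "X \<longlonglongrightarrow> L" shows "(\<lambda>m. X m i) \<longlonglongrightarrow> L i"
  using continuous_on_tendsto_compose[OF continuous_on_product_coordinates[of i] assms] by simp

text \<open>Zeros of failing nearby polynomials, normalised by homogeneity, accumulate at a nonzero
  zero of \<open>x\<close> in the closed half planes. The cone inequality makes it real; there the
  partial derivatives share a sign, so the imaginary part of the nearby value, a positive
  combination of them, cannot vanish.\<close>

lemma stable_cone_interior:
  assumes n1: "n \<ge> 1" and cone: "stable_cone n d x" and pos: "\<And>a. a \<in> expos n d \<Longrightarrow> x a > 0"
    and simple: "\<And>y k l. \<exists>i<n. y i \<noteq> 0 \<Longrightarrow> ev n d x y = (0::real) \<Longrightarrow> k < n \<Longrightarrow> l < n \<Longrightarrow>
      dev n d k x y * dev n d l x y > 0"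
  shows "\<exists>\<delta>>0. \<forall>x'. (\<forall>a\<in>expos n d. \<bar>x' a - x a\<bar> < \<delta>) \<longrightarrow> stable_cone n d x'"
proof (rule ccontr)
  assume neg: "\<not> ?thesis"
  have "\<exists>x'. (\<forall>a\<in>expos n d. \<bar>x' a - x a\<bar> < 1 / real (Suc m)) \<and> \<not> stable_cone n d x'" for m
  proof -
    have "0 < 1 / real (Suc m)" by simp
    then show ?thesis using neg by blast
  qed
  then have "\<exists>X. \<forall>m. (\<forall>a\<in>expos n d. \<bar>X m a - x a\<bar> < 1 / real (Suc m)) \<and> \<not> stable_cone n d (X m)"
    by (intro choice allI)
  then obtain X where X0: "\<forall>m. (\<forall>a\<in>expos n d. \<bar>X m a - x a\<bar> < 1 / real (Suc m)) \<and> \<not> stable_cone n d (X m)" ..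
  have X: "\<bar>X m a - x a\<bar> < 1 / real (Suc m)" "\<not> stable_cone n d (X m)" if "a \<in> expos n d" for m a
    using X0 that by auto
  have X2: "\<not> stable_cone n d (X m)" for m using X0 by auto
  have Xlim: "(\<lambda>m. X m a) \<longlonglongrightarrow> x a" if a: "a \<in> expos n d" for a
  proof -
    have "(\<lambda>m. X m a - x a) \<longlonglongrightarrow> 0"
    proof (rule Lim_null_comparison)
      show "\<forall>\<^sub>F m in sequentially. norm (X m a - x a) \<le> 1 / real (Suc m)"
        using X(1)[OF a] by (intro always_eventually allI) (simp add: less_imp_le)
      show "(\<lambda>m. 1 / real (Suc m)) \<longlonglongrightarrow> 0" by (rule LIMSEQ_inverse_real_of_nat[unfolded inverse_eq_divide])
    qed
    then show ?thesis by (simp add: LIM_zero_iff)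
  qed
  \<comment> \<open>Positive coefficients persist, so what fails for \<open>Y m\<close> is stability
    itself, which supplies the zeros \<open>W m\<close>.\<close>
  have "\<forall>\<^sub>F m in sequentially. \<forall>a\<in>expos n d. X m a > 0"
    by (intro eventually_ball_finite finite_expos ballI order_tendstoD(1)[OF Xlim] pos)
  then obtain M where M: "\<And>m a. m \<ge> M \<Longrightarrow> a \<in> expos n d \<Longrightarrow> X m a > 0"
    unfolding eventually_sequentially by blast
  define Y where "Y m = X (m + M)" for m
  have Ylim: "(\<lambda>m. Y m a) \<longlonglongrightarrow> x a" if a: "a \<in> expos n d" for a
    unfolding Y_def by (rule LIMSEQ_ignore_initial_segment[OF Xlim[OF a]])
  have "\<exists>w. (\<forall>j<n. Im (w j) > 0) \<and> ev n d (Y m) w = 0" for m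
  proof (rule ccontr)
    assume "\<not> ?thesis"
    then have "stable_coeffs n d (Y m)" by (auto simp: stable_coeffs_def)
    moreover have "nonneg_coeffs n d (Y m)" using M[of "m + M"] by (auto simp: nonneg_coeffs_def Y_def less_imp_le)
    ultimately have "stable_cone n d (Y m)" by (rule stable_imp_stable_cone)
    then show False using X2 by (simp add: Y_def)
  qed
  then have "\<exists>W. \<forall>m. (\<forall>j<n. Im (W m j) > 0) \<and> ev n d (Y m) (W m) = 0"
    by (intro choice allI)
  then obtain W where W0: "\<forall>m. (\<forall>j<n. Im (W m j) > 0) \<and> ev n d (Y m) (W m) = 0" ..
  have W: "j < n \<Longrightarrow> Im (W m j) > 0" "ev n d (Y m) (W m) = 0" for m j
    using W0 by auto
  define S where "S m = (\<Sum>i<n. cmod (W m i))" for m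
  have S: "S m > 0" for m
  proof -
    have "cmod (W m 0) > 0" using W(1)[of 0 m] n1 by auto
    also have "cmod (W m 0) \<le> S m" unfolding S_def using n1 by (intro member_le_sum) auto
    finally show ?thesis .
  qed
  \<comment> \<open>By homogeneity, division by \<open>S m\<close> keeps zeros and half planes; the
    coordinates from \<open>n\<close> on are set to \<open>0\<close> for compactness.\<close>
  define V where "V m = (\<lambda>i. if i < n then of_real (1 / S m) * W m i else 0)" for m
  have V1: "Im (V m i) > 0" if "i < n" for m i using W(1)[OF that, of m] S[of m] that by (simp add: V_def)
  have V2: "ev n d (Y m) (V m) = 0" for m
  proof -
    have "ev n d (Y m) (V m) = ev n d (Y m) (\<lambda>i. of_real (1 / S m) * W m i)"
      by (rule msum_cong) (simp add: V_def)
    then show ?thesis unfolding ev_scale W(2) by simp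
  qed
  have V3: "(\<Sum>i<n. cmod (V m i)) = 1" for m
  proof -
    have "(\<Sum>i<n. cmod (V m i)) = (\<Sum>i<n. cmod (W m i) / S m)"
      using S[of m] by (intro sum.cong) (auto simp: V_def norm_mult norm_divide)
    also have "\<dots> = 1" using S[of m] by (simp add: S_def sum_divide_distrib[symmetric])
    finally show ?thesis .
  qed
  have V4: "V m \<in> PiE UNIV (\<lambda>i. if i < n then cball 0 1 else {0})" for m
  proof -
    have "cmod (V m i) \<le> 1" if "i < n" for i
      using member_le_sum[of i "{..<n}" "\<lambda>i. cmod (V m i)"] V3[of m] that by simp
    then show ?thesis by (auto simp: PiE_iff V_def)
  qed
  have "compactin (product_topology (\<lambda>i. euclidean) UNIV) (PiE UNIV (\<lambda>i. if i < n then cball (0::complex) 1 else {0}))"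
    by (subst compactin_PiE) auto
  then have "compact (PiE UNIV (\<lambda>i::nat. if i < n then cball (0::complex) 1 else {0}))"
    by (simp add: euclidean_product_topology)
  then have "seq_compact (PiE UNIV (\<lambda>i::nat. if i < n then cball (0::complex) 1 else {0}))"
    by (rule compact_imp_seq_compact)
  then obtain L r where r: "strict_mono (r :: nat \<Rightarrow> nat)" and "(V \<circ> r) \<longlonglongrightarrow> L"
    using V4 unfolding seq_compact_def by metis
  then have Vlim: "(\<lambda>m. V (r m) i) \<longlonglongrightarrow> L i" for i
    using tendsto_fun_coordinate[of "V \<circ> r" L i] by (simp add: o_def)
  have YR: "(\<lambda>m. Y (r m) a) \<longlonglongrightarrow> x a" if a: "a \<in> expos n d" for a
    using LIMSEQ_subseq_LIMSEQ[OF Ylim[OF a] r] by (simp add: o_def)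
  have L0: "ev n d x L = 0"
  proof -
    have "(\<lambda>m. ev n d (Y (r m)) (V (r m))) \<longlonglongrightarrow> ev n d x L"
      by (intro tendsto_msum_coeffs Vlim YR)
    then show ?thesis unfolding V2 by (simp add: LIMSEQ_const_iff)
  qed
  have L1: "Im (L i) \<ge> 0" if "i < n" for i
    by (rule LIMSEQ_le_const[OF tendsto_Im[OF Vlim]]) (use V1[OF that] in \<open>auto simp: less_imp_le\<close>)
  have L2: "(\<Sum>i<n. cmod (L i)) = 1"
  proof -
    have "(\<lambda>m. \<Sum>i<n. cmod (V (r m) i)) \<longlonglongrightarrow> (\<Sum>i<n. cmod (L i))"
      by (intro tendsto_sum tendsto_norm Vlim)
    then show ?thesis unfolding V3 by (simp add: LIMSEQ_const_iff)
  qed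
  \<comment> \<open>A single positive imaginary part would make the lower bound in the cone
    inequality positive, as all coefficients of \<open>x\<close> are.\<close>
  have L3: "Im (L j) = 0" if j: "j < n" for j
  proof (rule ccontr)
    assume "Im (L j) \<noteq> 0"
    then have "Im (L j) > 0" using L1[OF j] by simp
    then have "0 < ev n d x (\<lambda>i. Im (L i))" using L1 j pos by (intro ev_pos_orthant[of n d x _ j]) auto
    also have "\<dots> \<le> cmod (ev n d x (\<lambda>i. Complex (Re (L i)) (Im (L i))))"
      by (rule stable_cone_closed_orthant[OF cone L1])
    finally show False using L0 by simp
  qed
  define u where "u i = Re (L i)" for i
  have Lu: "L i = of_real (u i)" if "i < n" for i using L3[OF that] by (simp add: u_def complex_eq_iff)
  have u0: "\<exists>i<n. u i \<noteq> 0"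
  proof (rule ccontr)
    assume "\<not> ?thesis"
    then have "(\<Sum>i<n. cmod (L i)) = 0" using Lu by simp
    then show False using L2 by simp
  qed
  have "of_real (ev n d x u) = (ev n d x (\<lambda>i. of_real (u i)) :: complex)" by (rule msum_of_real[symmetric])
  also have "\<dots> = ev n d x L" by (rule msum_cong) (simp add: Lu)
  finally have evu: "ev n d x u = 0" using L0 by simp
  define g where "g k = dev n d k x u" for k
  have g: "g k * g l > 0" if "k < n" "l < n" for k l
    unfolding g_def by (rule simple[OF u0 evu that])
  define \<sigma> where "\<sigma> = sgn (g 0)"
  have \<sigma>g: "\<sigma> * g k > 0" if "k < n" for k
    using g[of 0 k] that n1 by (auto simp: \<sigma>_def sgn_if zero_less_mult_iff)
  have "\<exists>\<xi>. Im (ev n d (Y m) (V m)) = (\<Sum>k<n. Im (V m k) * Re (dev n d k (Y m) (\<xi> k))) \<and>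
    (\<forall>k<n. \<forall>i<n. Re (\<xi> k i) = Re (V m i) \<and> 0 \<le> Im (\<xi> k i) \<and> Im (\<xi> k i) \<le> Im (V m i))" for m
    by (rule Im_ev_telescope) (rule V1)
  then have "\<exists>\<xi>. \<forall>m. Im (ev n d (Y m) (V m)) = (\<Sum>k<n. Im (V m k) * Re (dev n d k (Y m) (\<xi> m k))) \<and>
    (\<forall>k<n. \<forall>i<n. Re (\<xi> m k i) = Re (V m i) \<and> 0 \<le> Im (\<xi> m k i) \<and> Im (\<xi> m k i) \<le> Im (V m i))"
    by (intro choice allI)
  then obtain \<xi> where \<xi>0: "\<forall>m. Im (ev n d (Y m) (V m)) = (\<Sum>k<n. Im (V m k) * Re (dev n d k (Y m) (\<xi> m k))) \<and>
    (\<forall>k<n. \<forall>i<n. Re (\<xi> m k i) = Re (V m i) \<and> 0 \<le> Im (\<xi> m k i) \<and> Im (\<xi> m k i) \<le> Im (V m i))" ..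
  have \<xi>: "Im (ev n d (Y m) (V m)) = (\<Sum>k<n. Im (V m k) * Re (dev n d k (Y m) (\<xi> m k)))"
    "k < n \<Longrightarrow> i < n \<Longrightarrow> Re (\<xi> m k i) = Re (V m i) \<and> 0 \<le> Im (\<xi> m k i) \<and> Im (\<xi> m k i) \<le> Im (V m i)" for m k i
    using spec[OF \<xi>0, of m] by blast+
  have \<xi>lim: "(\<lambda>m. \<xi> (r m) k i) \<longlonglongrightarrow> L i" if ki: "k < n" "i < n" for k i
  proof -
    have "(\<lambda>m. Im (V (r m) i)) \<longlonglongrightarrow> 0" using tendsto_Im[OF Vlim[of i]] L3[OF ki(2)] by simp
    then have im: "(\<lambda>m. Im (\<xi> (r m) k i)) \<longlonglongrightarrow> Im (L i)"
      unfolding L3[OF ki(2)]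
      by (rule tendsto_sandwich[rotated 3, OF _ _ _ tendsto_const]) (use \<xi>(2)[OF ki] in auto)
    have re: "(\<lambda>m. Re (\<xi> (r m) k i)) \<longlonglongrightarrow> Re (L i)" using tendsto_Re[OF Vlim[of i]] \<xi>(2)[OF ki] by simp
    show ?thesis using re im by (simp add: tendsto_complex_iff)
  qed
  have "(\<lambda>m. dev n d k (Y (r m)) (\<xi> (r m) k)) \<longlonglongrightarrow> dev n d k x L" if k: "k < n" for k
    by (intro tendsto_msum_coeffs \<xi>lim[OF k] tendsto_mult_right YR) auto
  moreover have "dev n d k x L = of_real (g k)" for k
  proof -
    have "dev n d k x L = dev n d k x (\<lambda>i. of_real (u i))" by (rule msum_cong) (simp add: Lu)
    then show ?thesis unfolding g_def msum_of_real .
  qed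
  ultimately have "(\<lambda>m. Re (dev n d k (Y (r m)) (\<xi> (r m) k))) \<longlonglongrightarrow> g k" if "k < n" for k
    using tendsto_Re[where a = "of_real (g k)"] that by fastforce
  then have "(\<lambda>m. \<sigma> * Re (dev n d k (Y (r m)) (\<xi> (r m) k))) \<longlonglongrightarrow> \<sigma> * g k" if "k < n" for k
    using that by (intro tendsto_mult_left)
  then have "\<forall>\<^sub>F m in sequentially. \<forall>k\<in>{..<n}. \<sigma> * Re (dev n d k (Y (r m)) (\<xi> (r m) k)) > 0"
    using \<sigma>g by (intro eventually_ball_finite finite_lessThan ballI order_tendstoD(1)) auto
  then obtain m where m: "\<And>k. k < n \<Longrightarrow> \<sigma> * Re (dev n d k (Y (r m)) (\<xi> (r m) k)) > 0"
    unfolding eventually_sequentially by auto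
  have "0 < (\<Sum>k<n. Im (V (r m) k) * (\<sigma> * Re (dev n d k (Y (r m)) (\<xi> (r m) k))))"
    using m V1 n1 by (intro sum_pos) (auto simp: lessThan_empty_iff)
  also have "\<dots> = \<sigma> * Im (ev n d (Y (r m)) (V (r m)))"
    unfolding \<xi>(1) sum_distrib_left by (simp add: mult_ac)
  finally show False unfolding V2 by simp
qed

section \<open>Contracting flows and balls\<close>

definition unit_ball :: "nat \<Rightarrow> (nat \<Rightarrow> real) set" where
  "unit_ball N = {x. (\<forall>i\<ge>N. x i = 0) \<and> (\<Sum>i<N. (x i)\<^sup>2) \<le> 1}"

text \<open>\<open>Q\<close> is compact but not assumed convex. The space of dimension
  \<open>N\<close> is realised as functions vanishing from \<open>N\<close> on, and
  \<open>Q_interior\<close> describes interior points by boxes.\<close>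

locale contracting_flow =
  fixes N :: nat and lam :: "nat \<Rightarrow> real" and Q :: "(nat \<Rightarrow> real) set"
  assumes lam: "i < N \<Longrightarrow> lam i > 0"
    and supp: "x \<in> Q \<Longrightarrow> i \<ge> N \<Longrightarrow> x i = 0"
    and Q_closed: "(\<And>m. X m \<in> Q) \<Longrightarrow> (\<And>i. i < N \<Longrightarrow> (\<lambda>m. X m i) \<longlonglongrightarrow> x i) \<Longrightarrow> (\<And>i. i \<ge> N \<Longrightarrow> x i = 0) \<Longrightarrow> x \<in> Q"
    and Q_bounded: "\<exists>B. \<forall>x\<in>Q. \<forall>i<N. \<bar>x i\<bar> \<le> B"
    and Q_interior: "x \<in> Q \<Longrightarrow> t > 0 \<Longrightarrow> \<exists>\<delta>>0. \<forall>y. (\<forall>i\<ge>N. y i = 0) \<longrightarrow>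
      (\<forall>i<N. \<bar>y i - exp (- (lam i * t)) * x i\<bar> < \<delta>) \<longrightarrow> y \<in> Q"
    and Q_nonempty: "Q \<noteq> {}"
begin

definition contract :: "real \<Rightarrow> (nat \<Rightarrow> real) \<Rightarrow> nat \<Rightarrow> real" where
  "contract t x = (\<lambda>i. exp (- (lam i * t)) * x i)"

definition sqn :: "(nat \<Rightarrow> real) \<Rightarrow> real" where
  "sqn x = (\<Sum>i<N. (x i)\<^sup>2)"

definition unit_sphere :: "(nat \<Rightarrow> real) set" where
  "unit_sphere = {x. (\<forall>i\<ge>N. x i = 0) \<and> sqn x = 1}"

lemma contract_add: "contract (s + t) x = contract s (contract t x)"
  by (auto simp: contract_def fun_eq_iff algebra_simps exp_add exp_diff exp_minus divide_simps)

lemma contract_0 [simp]: "contract 0 x = x"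
  by (simp add: contract_def)

lemma sqn_nonneg: "sqn x \<ge> 0"
  by (simp add: sqn_def sum_nonneg)

lemma sqn_scale: "sqn (\<lambda>i. c * x i) = c\<^sup>2 * sqn x"
  by (simp add: sqn_def power_mult_distrib sum_distrib_left)

lemma sqn_eq_0: "sqn x = 0 \<Longrightarrow> i < N \<Longrightarrow> x i = 0"
  unfolding sqn_def by (subst (asm) sum_nonneg_eq_0_iff) auto

lemma sqn_nonzero: "sqn x \<noteq> 0 \<Longrightarrow> \<exists>j<N. x j \<noteq> 0"
  by (rule ccontr) (simp add: sqn_def)

lemma coord_le_sqn: "i < N \<Longrightarrow> (x i)\<^sup>2 \<le> sqn x"
  unfolding sqn_def by (intro member_le_sum) auto

lemma Q_contract: assumes "x \<in> Q" "t \<ge> 0" shows "contract t x \<in> Q"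
proof (cases "t = 0")
  case False
  then obtain \<delta> where "\<delta> > 0" "\<forall>y. (\<forall>i\<ge>N. y i = 0) \<longrightarrow> (\<forall>i<N. \<bar>y i - exp (- (lam i * t)) * x i\<bar> < \<delta>) \<longrightarrow> y \<in> Q"
    using Q_interior[OF assms(1), of t] assms(2) by auto
  then show ?thesis using supp[OF assms(1)] by (auto simp: contract_def)
qed (use assms in simp)

lemma rate_lower_bound: obtains l where "l > 0" "\<And>i. i < N \<Longrightarrow> l \<le> lam i"
proof (cases "N = 0")
  case True
  then show ?thesis using that[of 1] by simp
next
  case False
  have "Min (lam ` {..<N}) \<in> lam ` {..<N}" using False by (intro Min_in) auto
  then have "Min (lam ` {..<N}) > 0" using lam by auto
  then show ?thesis using that[of "Min (lam ` {..<N})"] by auto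
qed

lemma contract_tendsto_0: "i < N \<Longrightarrow> ((\<lambda>t. contract t x i) \<longlongrightarrow> 0) at_top"
proof -
  assume i: "i < N"
  have "filterlim (\<lambda>t. lam i * t) at_top at_top"
    by (rule filterlim_tendsto_pos_mult_at_top[OF tendsto_const lam[OF i] filterlim_ident])
  then have "((\<lambda>t. exp (- (lam i * t))) \<longlongrightarrow> 0) at_top"
    by (intro filterlim_compose[OF exp_at_bot] filterlim_compose[OF filterlim_uminus_at_bot_at_top])
  then show ?thesis unfolding contract_def by (rule tendsto_mult_left_zero)
qed

lemma zero_in_Q: "(\<lambda>_. 0) \<in> Q"
proof -
  obtain q where q: "q \<in> Q" using Q_nonempty by blast
  show ?thesis
  proof (rule Q_closed[of "\<lambda>m. contract (real m) q"])
    show "contract (real m) q \<in> Q" for m using q by (intro Q_contract) auto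
    show "(\<lambda>m. contract (real m) q i) \<longlonglongrightarrow> 0" if "i < N" for i
      by (rule filterlim_compose[OF contract_tendsto_0[OF that] filterlim_real_sequentially])
  qed auto
qed

text \<open>The origin is its own image under the contraction, hence interior to \<open>Q\<close>,
  and every trajectory tends to it.\<close>

lemma eventually_in_Q:
  assumes "\<forall>i\<ge>N. y i = 0"
  shows "\<exists>t. contract t y \<in> Q"
proof -
  obtain \<delta> where \<delta>: "\<delta> > 0" "\<forall>y. (\<forall>i\<ge>N. y i = 0) \<longrightarrow> (\<forall>i<N. \<bar>y i - exp (- (lam i * 1)) * 0\<bar> < \<delta>) \<longrightarrow> y \<in> Q"
    using Q_interior[OF zero_in_Q, of 1] by auto
  have "eventually (\<lambda>t. \<forall>i\<in>{..<N}. \<bar>contract t y i\<bar> < \<delta>) at_top"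
    using \<delta>(1) by (intro eventually_ball_finite ballI order_tendstoD(2)[OF tendsto_rabs_zero[OF contract_tendsto_0]]) auto
  then obtain t where "\<forall>i\<in>{..<N}. \<bar>contract t y i\<bar> < \<delta>" using eventually_happens'[of "at_top :: real filter"] by auto
  then have "contract t y \<in> Q" using \<delta>(2) assms by (auto simp: contract_def)
  then show ?thesis ..
qed

text \<open>Backwards in time, trajectories from the sphere expand and must leave the bounded set
  \<open>Q\<close>.\<close>

lemma entry_bounded_below:
  obtains C where "C \<ge> 0" "\<And>y t. y \<in> unit_sphere \<Longrightarrow> contract t y \<in> Q \<Longrightarrow> t \<ge> - C"
proof -
  obtain l where l: "l > 0" "\<And>i. i < N \<Longrightarrow> l \<le> lam i" using rate_lower_bound by blast
  obtain B where B: "\<And>x i. x \<in> Q \<Longrightarrow> i < N \<Longrightarrow> \<bar>x i\<bar> \<le> B" using Q_bounded by blast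
  \<comment> \<open>\<open>K\<close> exceeds all squared norms on \<open>Q\<close>. Going back by
    time \<open>C\<close> multiplies squared norms by at least \<open>exp (2 * l * C) = K\<close>,
    as no rate is below \<open>l\<close>.\<close>
  define K where "K = real N * B\<^sup>2 + 1"
  have K: "K \<ge> 1" by (simp add: K_def)
  define C where "C = ln K / (2 * l)"
  have "t \<ge> - C" if y: "y \<in> unit_sphere" "contract t y \<in> Q" for y t
  proof (rule ccontr)
    assume "\<not> t \<ge> - C"
    then have tC: "t < - C" by simp
    have C0: "C \<ge> 0" using K l by (simp add: C_def)
    have "exp (2 * (l * - t)) * (y i)\<^sup>2 \<le> (contract t y i)\<^sup>2" if i: "i < N" for i
    proof -
      have "l * - t \<le> lam i * - t" using l(2)[OF i] tC C0 by (intro mult_right_mono) auto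
      then have "exp (2 * (l * - t)) \<le> exp (2 * (lam i * - t))" by simp
      also have "\<dots> = (exp (- (lam i * t)))\<^sup>2" by (simp add: exp_double[symmetric] power2_eq_square exp_add[symmetric])
      finally show ?thesis unfolding contract_def power_mult_distrib by (rule mult_right_mono) simp
    qed
    then have "exp (2 * (l * - t)) * sqn y \<le> sqn (contract t y)"
      unfolding sqn_def sum_distrib_left by (intro sum_mono) auto
    also have "\<dots> \<le> (\<Sum>i<N. B\<^sup>2)"
      unfolding sqn_def by (intro sum_mono) (use B[OF y(2)] in \<open>metis abs_le_square_iff abs_of_nonneg abs_ge_zero lessThan_iff order_trans\<close>)
    also have "\<dots> < K" by (simp add: K_def)
    finally have "exp (2 * (l * - t)) < K" using y(1) by (simp add: unit_sphere_def)
    then have "2 * (l * - t) < ln K" using K by (simp add: ln_exp[symmetric] del: ln_exp)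
      (metis exp_less_cancel_iff exp_ln less_le_trans zero_less_one)
    then have "- t < C" using l(1) by (simp add: C_def field_simps)
    then show False using tC by simp
  qed
  moreover have "C \<ge> 0" using K l by (simp add: C_def)
  ultimately show ?thesis using that by blast
qed

definition entry_time :: "(nat \<Rightarrow> real) \<Rightarrow> real" where
  "entry_time y = Inf {t. contract t y \<in> Q}"

text \<open>By forward invariance the times spent in \<open>Q\<close> form an up-closed set, which
  is also closed and bounded below, hence a closed half line.\<close>

lemma contract_in_Q_iff:
  assumes y: "y \<in> unit_sphere"
  shows "contract t y \<in> Q \<longleftrightarrow> entry_time y \<le> t"
proof -
  let ?S = "{t. contract t y \<in> Q}"
  have supy: "\<forall>i\<ge>N. y i = 0" using y by (simp add: unit_sphere_def)
  obtain t0 where "contract t0 y \<in> Q" using eventually_in_Q[OF supy] ..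
  then have ne: "?S \<noteq> {}" by auto
  obtain C where C: "\<And>y t. y \<in> unit_sphere \<Longrightarrow> contract t y \<in> Q \<Longrightarrow> t \<ge> - C"
    by (rule entry_bounded_below) (rule that)
  have bd: "bdd_below ?S" by (rule bdd_belowI[of _ "- C"]) (use C[OF y] in auto)
  have up: "contract s y \<in> Q" if s: "entry_time y < s" for s
  proof -
    obtain r where r: "contract r y \<in> Q" "r < s" using s cInf_less_iff[OF ne bd] by (auto simp: entry_time_def)
    have "contract s y = contract (s - r) (contract r y)" unfolding contract_add[symmetric] by simp
    then show ?thesis using Q_contract[OF r(1), of "s - r"] r(2) by simp
  qed
  have "contract (entry_time y) y \<in> Q"
  proof (rule Q_closed[of "\<lambda>m. contract (entry_time y + 1 / real (Suc m)) y"])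
    show "contract (entry_time y + 1 / real (Suc m)) y \<in> Q" for m by (rule up) simp
    have l: "(\<lambda>m. entry_time y + 1 / real (Suc m)) \<longlonglongrightarrow> entry_time y + 0"
      by (intro tendsto_intros LIMSEQ_inverse_real_of_nat[unfolded inverse_eq_divide])
    show "(\<lambda>m. contract (entry_time y + 1 / real (Suc m)) y i) \<longlonglongrightarrow> contract (entry_time y) y i" for i
      unfolding contract_def using l by (intro tendsto_intros) simp
  qed (use supy in \<open>simp add: contract_def\<close>)
  then show ?thesis using up cInf_lower[OF _ bd, of t] by (cases "t = entry_time y") (auto simp: entry_time_def[symmetric])
qed

lemma closed_Q: "closed Q"
  unfolding closed_sequential_limits
proof (intro allI impI, elim conjE)
  fix X l assume X: "\<forall>n. X n \<in> Q" "X \<longlonglongrightarrow> l"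
  show "l \<in> Q"
  proof (rule Q_closed[of X])
    fix i assume "i \<ge> N"
    then have "(\<lambda>m. X m i) = (\<lambda>m. 0)" using X(1) supp by auto
    then show "l i = 0" using tendsto_fun_coordinate[OF X(2), of i] by (simp add: LIMSEQ_const_iff)
  qed (use X tendsto_fun_coordinate in auto)
qed

lemma continuous_contract: "continuous_on UNIV (contract t)"
  unfolding contract_def
  by (intro continuous_on_coordinatewise_then_product continuous_intros continuous_on_product_coordinates)

text \<open>Before entry the point lies in the open complement of \<open>Q\<close>, which bounds
  nearby entry times below; after entry it is interior to \<open>Q\<close>, which bounds them
  above.\<close>

lemma continuous_entry_time: "continuous_on unit_sphere entry_time"
  unfolding continuous_on_def
proof
  fix y assume y: "y \<in> unit_sphere"
  show "(entry_time \<longlongrightarrow> entry_time y) (at y within unit_sphere)"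
  proof (rule order_tendstoI)
    fix a assume a: "a < entry_time y"
    define b where "b = (a + entry_time y) / 2"
    have b: "a < b" "b < entry_time y" using a by (auto simp: b_def)
    have "open (contract b -` (- Q))" using closed_Q continuous_contract by (intro open_vimage) auto
    moreover have "y \<in> contract b -` (- Q)" using contract_in_Q_iff[OF y, of b] b by auto
    ultimately have "eventually (\<lambda>z. z \<in> contract b -` (- Q)) (at y within unit_sphere)"
      by (intro eventually_at_topological[THEN iffD2]) blast
    moreover have "eventually (\<lambda>z. z \<in> unit_sphere) (at y within unit_sphere)"
      unfolding eventually_at_topological by (intro exI[of _ UNIV]) auto
    ultimately show "eventually (\<lambda>z. a < entry_time z) (at y within unit_sphere)"
    proof eventually_elim
      case (elim z)
      then show ?case using contract_in_Q_iff[of z b] b by auto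
    qed
  next
    fix a assume a: "entry_time y < a"
    define b where "b = (a + entry_time y) / 2"
    have b: "entry_time y < b" "b < a" using a by (auto simp: b_def)
    have "contract (entry_time y) y \<in> Q" using contract_in_Q_iff[OF y] by simp
    from Q_interior[OF this, of "b - entry_time y"] b obtain \<delta> where \<delta>: "\<delta> > 0"
      "\<And>z. \<forall>i\<ge>N. z i = 0 \<Longrightarrow> \<forall>i<N. \<bar>z i - exp (- (lam i * (b - entry_time y))) * contract (entry_time y) y i\<bar> < \<delta> \<Longrightarrow> z \<in> Q"
      by auto
    have e: "exp (- (lam i * (b - entry_time y))) * contract (entry_time y) y i = contract b y i" for i
    proof -
      have h: "contract (b - entry_time y) (contract (entry_time y) y) = contract b y" unfolding contract_add[symmetric] by simp
      show ?thesis using fun_cong[OF h, of i] by (simp only: contract_def[of "b - entry_time y"])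
    qed
    have "((\<lambda>z. contract b z i) \<longlongrightarrow> contract b y i) (at y within unit_sphere)" for i
    proof -
      have "continuous_on UNIV (\<lambda>z. contract b z i)" unfolding contract_def
        by (intro continuous_intros continuous_on_product_coordinates)
      then show ?thesis using continuous_on_subset[of UNIV "\<lambda>z. contract b z i" unit_sphere] y by (auto simp: continuous_on_def)
    qed
    then have "eventually (\<lambda>z. \<bar>contract b z i - contract b y i\<bar> < \<delta>) (at y within unit_sphere)" for i
      using \<delta>(1) by (auto simp: tendsto_iff dist_real_def)
    then have "eventually (\<lambda>z. \<forall>i\<in>{..<N}. \<bar>contract b z i - contract b y i\<bar> < \<delta>) (at y within unit_sphere)"
      by (intro eventually_ball_finite) auto
    moreover have "eventually (\<lambda>z. z \<in> unit_sphere) (at y within unit_sphere)"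
      unfolding eventually_at_topological by (intro exI[of _ UNIV]) auto
    ultimately show "eventually (\<lambda>z. entry_time z < a) (at y within unit_sphere)"
    proof eventually_elim
      case (elim z)
      have "contract b z \<in> Q"
        by (rule \<delta>(2)) (use elim in \<open>auto simp: e unit_sphere_def\<close>, simp add: contract_def)
      then show ?case using contract_in_Q_iff[of z b] elim b by auto
    qed
  qed
qed

section \<open>Polar coordinates along the trajectories\<close>

definition radius :: "(nat \<Rightarrow> real) \<Rightarrow> real" where "radius x = sqrt (sqn x)"

definition direction :: "(nat \<Rightarrow> real) \<Rightarrow> nat \<Rightarrow> real" where "direction x = (\<lambda>i. x i / radius x)"

text \<open>Radius \<open>1\<close> goes to the point of entry into \<open>Q\<close>; as the radius
  tends to \<open>0\<close>, the time tends to infinity and the image to the origin.\<close>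

definition ball_map :: "(nat \<Rightarrow> real) \<Rightarrow> nat \<Rightarrow> real" where
  "ball_map x = (if sqn x = 0 then (\<lambda>_. 0) else contract (entry_time (direction x) - ln (radius x)) (direction x))"

lemma radius_pos: "sqn x \<noteq> 0 \<Longrightarrow> radius x > 0"
  using sqn_nonneg[of x] by (simp add: radius_def)

lemma radius_nonneg: "radius x \<ge> 0"
  by (simp add: radius_def sqn_nonneg)

lemma radius_nz: "sqn x \<noteq> 0 \<Longrightarrow> radius x \<noteq> 0"
  by (simp add: radius_def)

lemma direction_sphere: "\<forall>i\<ge>N. x i = 0 \<Longrightarrow> sqn x \<noteq> 0 \<Longrightarrow> direction x \<in> unit_sphere"
  using sqn_scale[of "1 / radius x" x] sqn_nonneg[of x] by (simp add: unit_sphere_def direction_def radius_def power_divide)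

lemma ball_radius: "x \<in> unit_ball N \<Longrightarrow> radius x \<le> 1"
  by (simp add: unit_ball_def radius_def sqn_def)

lemma ball_supp: "x \<in> unit_ball N \<Longrightarrow> \<forall>i\<ge>N. x i = 0"
  by (simp add: unit_ball_def)

lemma ball_zero: "x \<in> unit_ball N \<Longrightarrow> sqn x = 0 \<Longrightarrow> x = (\<lambda>_. 0)"
  using sqn_eq_0[of x] ball_supp[of x] by (auto simp: fun_eq_iff) (metis not_le)

lemma continuous_sqn: "continuous_on A sqn"
  unfolding sqn_def
  by (rule continuous_on_subset[OF _ subset_UNIV]) (intro continuous_intros continuous_on_product_coordinates)

lemma continuous_coord: "continuous_on A (\<lambda>x. x i :: real)"
  by (rule continuous_on_subset[OF continuous_on_product_coordinates subset_UNIV])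

lemma ball_map_in_Q: assumes "x \<in> unit_ball N" shows "ball_map x \<in> Q"
proof (cases "sqn x = 0")
  case True
  then show ?thesis by (simp add: ball_map_def zero_in_Q)
next
  case False
  have "ln (radius x) \<le> 0" using ball_radius[OF assms] radius_pos[OF False] by simp
  then show ?thesis using False contract_in_Q_iff[OF direction_sphere[OF ball_supp[OF assms] False]] by (simp add: ball_map_def)
qed

text \<open>Away from the origin this is a composition of continuous maps. At the origin a multiple
  of \<open>radius x powr lam i\<close> dominates, by the uniform lower bound on entry
  times.\<close>

lemma continuous_ball_map: "continuous_on (unit_ball N) (\<lambda>x. ball_map x i)"
proof (cases "i < N")
  case False
  have "ball_map x i = 0" if "x \<in> unit_ball N" for x using ball_map_in_Q[OF that] supp False by simp
  then show ?thesis by (simp add: continuous_on_eq[OF continuous_on_const])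
next
  case i: True
  let ?B = "unit_ball N" and ?B' = "unit_ball N - sqn -` {0}"
  have B': "x \<in> ?B \<Longrightarrow> sqn x \<noteq> 0 \<Longrightarrow> at x within ?B = at x within ?B'" for x
  proof (rule at_within_nhd[of x "sqn -` (- {0})"])
    show "open (sqn -` (- {0}))" by (intro open_vimage continuous_sqn) auto
  qed auto
  have cr: "continuous_on ?B' radius" unfolding radius_def by (intro continuous_intros continuous_sqn)
  have cd: "continuous_on ?B' direction" unfolding direction_def
    by (intro continuous_on_coordinatewise_then_product continuous_on_divide continuous_coord cr) (auto simp: radius_nz)
  have "continuous_on ?B' (\<lambda>x. entry_time (direction x))"
    by (rule continuous_on_compose2[OF continuous_entry_time cd]) (use direction_sphere ball_supp in auto)
  moreover have "continuous_on ?B' (\<lambda>x. direction x i)"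
    by (rule continuous_on_compose2[OF continuous_coord[of UNIV] cd]) auto
  ultimately have c1: "continuous_on ?B' (\<lambda>x. exp (- (lam i * (entry_time (direction x) - ln (radius x)))) * direction x i)"
    by (intro continuous_intros cr) (auto simp: radius_nz)
  obtain C where C: "C \<ge> 0" "\<And>y t. y \<in> unit_sphere \<Longrightarrow> contract t y \<in> Q \<Longrightarrow> t \<ge> - C"
    by (rule entry_bounded_below) (rule that)
  have TC: "entry_time y \<ge> - C" if "y \<in> unit_sphere" for y using C(2)[OF that] contract_in_Q_iff[OF that] by blast
  have bound: "\<bar>ball_map x i\<bar> \<le> exp (lam i * C) * radius x powr lam i" if x: "x \<in> ?B" for x
  proof (cases "sqn x = 0")
    case True
    then show ?thesis by (simp add: ball_map_def)
  next
    case False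
    let ?u = "direction x"
    have u: "?u \<in> unit_sphere" using direction_sphere ball_supp[OF x] False by blast
    have "(?u i)\<^sup>2 \<le> 1" using coord_le_sqn[OF i, of ?u] u by (simp add: unit_sphere_def)
    then have ui: "\<bar>?u i\<bar> \<le> 1" by (simp add: abs_square_le_1)
    have "\<bar>ball_map x i\<bar> = exp (- (lam i * (entry_time ?u - ln (radius x)))) * \<bar>?u i\<bar>"
      using False by (simp add: ball_map_def contract_def abs_mult)
    also have "\<dots> \<le> exp (- (lam i * (entry_time ?u - ln (radius x)))) * 1" using ui by (intro mult_left_mono) auto
    also have "\<dots> \<le> exp (lam i * C + lam i * ln (radius x))"
      using mult_left_mono[OF TC[OF u], of "lam i"] lam[OF i] by (simp add: algebra_simps)
    also have "\<dots> = exp (lam i * C) * radius x powr lam i"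
      using radius_pos[OF False] by (simp add: exp_add powr_def)
    finally show ?thesis .
  qed
  show ?thesis
    unfolding continuous_on_def
  proof
    fix x assume x: "x \<in> ?B"
    show "((\<lambda>x. ball_map x i) \<longlongrightarrow> ball_map x i) (at x within ?B)"
    proof (cases "sqn x = 0")
      case False
      have "continuous_on ?B' (\<lambda>x. ball_map x i)"
        by (rule continuous_on_eq[OF c1]) (auto simp: ball_map_def contract_def)
      then show ?thesis using x False unfolding B'[OF x False] by (auto simp: continuous_on_def)
    next
      case True
      have "continuous_on ?B radius" unfolding radius_def by (intro continuous_intros continuous_sqn)
      then have "(radius \<longlongrightarrow> radius x) (at x within ?B)" using x by (auto simp: continuous_on_def)
      then have "((\<lambda>x. radius x powr lam i) \<longlongrightarrow> radius x powr lam i) (at x within ?B)"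
        by (rule tendsto_powr2[OF _ tendsto_const _ lam[OF i]]) (rule always_eventually, rule allI, rule radius_nonneg)
      then have "((\<lambda>x. exp (lam i * C) * radius x powr lam i) \<longlongrightarrow> exp (lam i * C) * radius x powr lam i) (at x within ?B)"
        by (intro tendsto_mult tendsto_const)
      moreover have "exp (lam i * C) * radius x powr lam i = 0" using True by (simp add: radius_def)
      ultimately have lim: "((\<lambda>x. exp (lam i * C) * radius x powr lam i) \<longlongrightarrow> 0) (at x within ?B)"
        by (simp only:)
      have "eventually (\<lambda>z. z \<in> ?B) (at x within ?B)"
        unfolding eventually_at_topological by (intro exI[of _ UNIV]) auto
      then have bd: "eventually (\<lambda>z. norm (ball_map z i) \<le> exp (lam i * C) * radius z powr lam i) (at x within ?B)"
        by (rule eventually_mono) (simp only: real_norm_def, rule bound)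
      have "((\<lambda>x. ball_map x i) \<longlongrightarrow> 0) (at x within ?B)" by (rule Lim_null_comparison[OF bd lim])
      then show ?thesis using True by (simp add: ball_map_def)
    qed
  qed
qed

lemma sqn_contract_less:
  assumes "t > 0" "sqn x \<noteq> 0"
  shows "sqn (contract t x) < sqn x"
proof -
  obtain j where j: "j < N" "x j \<noteq> 0" using sqn_nonzero[OF assms(2)] by blast
  have e: "(exp (- (lam i * t)))\<^sup>2 < 1" if "i < N" for i
    using lam[OF that] assms(1) by (intro power_less_one_iff[THEN iffD2]) auto
  have "(contract t x i)\<^sup>2 \<le> (x i)\<^sup>2" if "i < N" for i
    using e[OF that] unfolding contract_def power_mult_distrib by (intro mult_left_le_one_le) auto
  moreover have "(contract t x j)\<^sup>2 < (x j)\<^sup>2"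
    using e[OF j(1)] j(2) unfolding contract_def power_mult_distrib by simp
  ultimately show ?thesis unfolding sqn_def using j(1) by (intro sum_strict_mono_ex1) auto
qed

lemma contract_minus_contract: "contract (- t) (contract t x) = x"
  using contract_add[of "- t" t x] by simp

text \<open>\<open>sqn\<close> strictly decreases along a nonzero trajectory, so it takes the value
  \<open>1\<close> at most once.\<close>

lemma sphere_contract_unique:
  assumes "u \<in> unit_sphere" "u' \<in> unit_sphere" "contract t u = contract t' u'"
  shows "t = t' \<and> u = u'"
proof -
  have le: "\<not> t < t'" if u: "u \<in> unit_sphere" "u' \<in> unit_sphere" and eq: "contract t u = contract t' u'" for t t' u u'
  proof
    assume tt: "t < t'"
    have "u = contract (- t) (contract t' u')" using contract_minus_contract[of t u] unfolding eq by (rule sym)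
    also have "\<dots> = contract (- t + t') u'" by (rule contract_add[symmetric])
    finally have ueq: "u = contract (- t + t') u'" .
    have "sqn u' = 1" "sqn u = 1" using u by (auto simp: unit_sphere_def)
    moreover have "sqn (contract (- t + t') u') < sqn u'"
      by (rule sqn_contract_less) (use tt \<open>sqn u' = 1\<close> in auto)
    ultimately show False unfolding ueq[symmetric] by linarith
  qed
  have t: "t = t'" using le[OF assms] le[OF assms(2,1) assms(3)[symmetric]] by linarith
  have "u = contract (- t) (contract t' u')" using contract_minus_contract[of t u] unfolding assms(3) by (rule sym)
  also have "\<dots> = u'" using contract_minus_contract[of t' u'] unfolding t .
  finally show ?thesis using t by blast
qed

lemma ball_map_inj: "inj_on ball_map (unit_ball N)"
proof (rule inj_onI)
  fix x x' assume x: "x \<in> unit_ball N" and x': "x' \<in> unit_ball N" and eq: "ball_map x = ball_map x'"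
  have nz: "\<exists>j. ball_map x j \<noteq> 0" if "x \<in> unit_ball N" and n: "sqn x \<noteq> 0" for x
  proof -
    obtain j where j: "j < N" "x j \<noteq> 0" using sqn_nonzero[OF n] by blast
    then have "ball_map x j \<noteq> 0" using n radius_pos[OF n] by (simp add: ball_map_def contract_def direction_def)
    then show ?thesis ..
  qed
  show "x = x'"
  proof (cases "sqn x = 0 \<or> sqn x' = 0")
    case True
    have g0: "ball_map z j = 0" if "sqn z = 0" for z j using that by (simp add: ball_map_def)
    have "ball_map x j = 0" "ball_map x' j = 0" for j
      using True g0[of x j] g0[of x' j] fun_cong[OF eq, of j] by auto
    then have "sqn x = 0 \<and> sqn x' = 0" using nz[OF x] nz[OF x'] by blast
    then show ?thesis using ball_zero x x' by metis
  next
    case False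
    then have n: "sqn x \<noteq> 0" "sqn x' \<noteq> 0" by auto
    have "contract (entry_time (direction x) - ln (radius x)) (direction x) = contract (entry_time (direction x') - ln (radius x')) (direction x')"
      using eq n by (simp add: ball_map_def)
    then have "entry_time (direction x) - ln (radius x) = entry_time (direction x') - ln (radius x') \<and> direction x = direction x'"
      by (intro sphere_contract_unique direction_sphere ball_supp x x' n)
    then have d: "direction x = direction x'" "ln (radius x) = ln (radius x')" by auto
    then have r: "radius x = radius x'" using radius_pos[OF n(1)] radius_pos[OF n(2)] by simp
    have "x i = x' i" for i using fun_cong[OF d(1), of i] r radius_pos[OF n(2)] by (simp add: direction_def)
    then show ?thesis by auto
  qed
qed

lemma ball_map_surj:
  assumes q: "q \<in> Q" shows "\<exists>x\<in>unit_ball N. ball_map x = q"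
proof (cases "sqn q = 0")
  case True
  then have "q = (\<lambda>_. 0)" using sqn_eq_0[of q] supp[OF q] by (auto simp: fun_eq_iff) (metis not_le)
  moreover have "(\<lambda>_. 0) \<in> unit_ball N" by (simp add: unit_ball_def)
  ultimately show ?thesis by (intro bexI[of _ "\<lambda>_. 0"]) (auto simp: ball_map_def sqn_def)
next
  case False
  then have q0: "sqn q > 0" using sqn_nonneg[of q] by simp
  obtain l where l: "l > 0" "\<And>i. i < N \<Longrightarrow> l \<le> lam i" using rate_lower_bound by blast
  \<comment> \<open>Within time \<open>s\<close> the squared norm changes by a factor of at least
    \<open>exp \<bar>ln (sqn q)\<bar>\<close>, so \<open>1\<close> is attained between
    \<open>- s\<close> and \<open>s\<close>.\<close>
  define s where "s = \<bar>ln (sqn q)\<bar> / (2 * l)"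
  have s: "s \<ge> 0" "2 * (l * s) = \<bar>ln (sqn q)\<bar>" using l by (auto simp: s_def)
  have sq: "(contract t q i)\<^sup>2 = exp (- 2 * (lam i * t)) * (q i)\<^sup>2" for t i
    by (simp add: contract_def power_mult_distrib exp_double[symmetric] power2_eq_square exp_add[symmetric])
  have 1: "sqn (contract s q) \<le> 1"
  proof -
    have "sqn (contract s q) \<le> (\<Sum>i<N. exp (- 2 * (l * s)) * (q i)\<^sup>2)"
      unfolding sqn_def sq using l(2) s(1) by (intro sum_mono mult_right_mono) (auto intro!: mult_right_mono)
    also have "\<dots> = exp (- \<bar>ln (sqn q)\<bar>) * exp (ln (sqn q))"
      using q0 s(2) by (simp add: sqn_def sum_distrib_left[symmetric])
    also have "\<dots> \<le> 1" unfolding exp_add[symmetric] by simp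
    finally show ?thesis .
  qed
  have 2: "sqn (contract (- s) q) \<ge> 1"
  proof -
    have "1 \<le> exp \<bar>ln (sqn q)\<bar> * exp (ln (sqn q))" unfolding exp_add[symmetric] by simp
    also have "\<dots> = (\<Sum>i<N. exp (2 * (l * s)) * (q i)\<^sup>2)"
      using q0 s(2) by (simp add: sqn_def sum_distrib_left[symmetric])
    also have "\<dots> \<le> sqn (contract (- s) q)"
      unfolding sqn_def sq using l(2) s(1) by (intro sum_mono mult_right_mono) (auto intro!: mult_right_mono)
    finally show ?thesis .
  qed
  have "continuous_on {-s..s} (\<lambda>t. sqn (contract t q))" unfolding sqn_def contract_def by (intro continuous_intros)
  then obtain r where r: "sqn (contract r q) = 1" using IVT2'[of "\<lambda>t. sqn (contract t q)" s 1 "- s"] 1 2 s(1) by auto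
  define u where "u = contract r q"
  have u: "u \<in> unit_sphere" using r supp[OF q] by (simp add: unit_sphere_def u_def) (simp add: contract_def)
  have qu: "q = contract (- r) u" unfolding u_def contract_add[symmetric] by simp
  have "entry_time u \<le> - r" using contract_in_Q_iff[OF u] q qu by simp
  \<comment> \<open>Solves \<open>entry_time u - ln \<rho> = - r\<close>; since \<open>q\<close>
    lies in \<open>Q\<close>, entry happens by time \<open>- r\<close> and
    \<open>\<rho> \<le> 1\<close>.\<close>
  define \<rho> where "\<rho> = exp (entry_time u + r)"
  have \<rho>: "\<rho> > 0" "\<rho> \<le> 1" "ln \<rho> = entry_time u + r" using \<open>entry_time u \<le> - r\<close> by (auto simp: \<rho>_def)
  define x where "x = (\<lambda>i. \<rho> * u i)"
  have nx: "sqn x = \<rho>\<^sup>2" using u by (simp add: x_def sqn_scale unit_sphere_def)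
  have rx: "radius x = \<rho>" using \<rho> by (simp add: radius_def nx)
  have dx: "direction x = u" unfolding direction_def rx using \<rho> by (simp add: x_def)
  have "ball_map x = contract (- r) u" using nx \<rho> by (simp add: ball_map_def dx rx)
  moreover have "x \<in> unit_ball N"
    using nx \<rho> u power_le_one[of \<rho> 2] by (simp add: unit_ball_def x_def sqn_def[symmetric] unit_sphere_def)
  ultimately show ?thesis using qu by blast
qed

lemma ball_map_bij: "bij_betw ball_map (unit_ball N) Q"
  unfolding bij_betw_def using ball_map_inj ball_map_in_Q ball_map_surj by blast

end

section \<open>The space of stable polynomials\<close>

lemma lookup_exponents: "bij_betw Poly_Mapping.lookup (exponents n d) (expos n d)"
proof -
  have deg: "monom_degree \<alpha> = (\<Sum>i<n. Poly_Mapping.lookup \<alpha> i)" if "Poly_Mapping.keys \<alpha> \<subseteq> {..<n}" for \<alpha>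
    unfolding monom_degree_def using that by (intro sum.mono_neutral_left) (auto simp: in_keys_iff)
  show ?thesis
  proof (rule bij_betwI')
    fix \<alpha> \<beta> assume "\<alpha> \<in> exponents n d" "\<beta> \<in> exponents n d"
    show "(Poly_Mapping.lookup \<alpha> = Poly_Mapping.lookup \<beta>) = (\<alpha> = \<beta>)" by (simp add: lookup_inject)
  next
    fix \<alpha> assume a: "\<alpha> \<in> exponents n d"
    then have "Poly_Mapping.lookup \<alpha> i = 0" if "i \<ge> n" for i
      using that by (auto simp: exponents_def subset_iff in_keys_iff)
    then show "Poly_Mapping.lookup \<alpha> \<in> expos n d" using a deg by (auto simp: exponents_def expos_def)
  next
    fix a assume a: "a \<in> expos n d"
    have sub: "{i. a i \<noteq> 0} \<subseteq> {..<n}" using a by (force simp: expos_def not_less[symmetric])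
    then have l: "Poly_Mapping.lookup (Abs_poly_mapping a) = a" using finite_subset[OF sub] by simp
    have k: "Poly_Mapping.keys (Abs_poly_mapping a) \<subseteq> {..<n}" using sub by (auto simp: in_keys_iff l)
    then have "Abs_poly_mapping a \<in> exponents n d" using deg[OF k] a by (simp add: exponents_def expos_def l)
    then show "\<exists>\<alpha>\<in>exponents n d. a = Poly_Mapping.lookup \<alpha>" using l by metis
  qed
qed

lemma finite_exponents: "finite (exponents n d)"
  using bij_betw_finite[OF lookup_exponents] finite_expos by blast

definition mk_poly :: "nat \<Rightarrow> nat \<Rightarrow> ((nat \<Rightarrow> nat) \<Rightarrow> real) \<Rightarrow> real_mpoly" where
  "mk_poly n d x = Abs_poly_mapping (\<lambda>\<alpha>. if \<alpha> \<in> exponents n d then x (Poly_Mapping.lookup \<alpha>) else 0)"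

lemma lookup_mk_poly:
  "Poly_Mapping.lookup (mk_poly n d x) \<alpha> = (if \<alpha> \<in> exponents n d then x (Poly_Mapping.lookup \<alpha>) else 0)"
proof -
  have "finite {\<alpha>. (if \<alpha> \<in> exponents n d then x (Poly_Mapping.lookup \<alpha>) else 0) \<noteq> 0}"
    by (rule finite_subset[OF _ finite_exponents[of n d]]) auto
  then show ?thesis unfolding mk_poly_def by simp
qed

lemma keys_mk_poly: "Poly_Mapping.keys (mk_poly n d x) \<subseteq> exponents n d"
  by (auto simp: in_keys_iff lookup_mk_poly split: if_splits)

lemma mpoly_eval_mk_poly: "mpoly_eval (mk_poly n d x) w = ev n d x w"
proof -
  let ?L = "Poly_Mapping.lookup"
  have "mpoly_eval (mk_poly n d x) w = (\<Sum>\<alpha>\<in>exponents n d. of_real (?L (mk_poly n d x) \<alpha>) *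
      (\<Prod>i\<in>Poly_Mapping.keys \<alpha>. w i ^ ?L \<alpha> i))"
    unfolding mpoly_eval_def
    by (intro sum.mono_neutral_left finite_exponents keys_mk_poly) (auto simp: in_keys_iff)
  also have "\<dots> = (\<Sum>\<alpha>\<in>exponents n d. of_real (x (?L \<alpha>)) * mon n (?L \<alpha>) w)"
  proof (intro sum.cong refl arg_cong2[where f="(*)"])
    fix \<alpha> assume a: "\<alpha> \<in> exponents n d"
    show "(\<Prod>i\<in>Poly_Mapping.keys \<alpha>. w i ^ ?L \<alpha> i) = mon n (?L \<alpha>) w"
      unfolding mon_def using a by (intro prod.mono_neutral_left) (auto simp: exponents_def in_keys_iff)
    show "of_real (?L (mk_poly n d x) \<alpha>) = of_real (x (?L \<alpha>))" using a by (simp add: lookup_mk_poly)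
  qed
  also have "\<dots> = ev n d x w"
    unfolding msum_def by (rule sum.reindex_bij_betw[OF lookup_exponents])
  finally show ?thesis .
qed

text \<open>The normalisation excludes the zero polynomial, the only point at which stability with
  nonnegative coefficients and membership in the cone differ.\<close>

lemma mk_poly_in_PS:
  assumes "n \<ge> 1"
  shows "mk_poly n d x \<in> PS n d \<longleftrightarrow> stable_cone n d x \<and> (\<Sum>a\<in>expos n d. x a) = 1"
proof -
  have one: "mpoly_eval (mk_poly n d x) (\<lambda>_. 1 :: real) = (\<Sum>a\<in>expos n d. x a)"
    unfolding mpoly_eval_mk_poly by (simp add: msum_def mon_def)
  have st: "real_stable n (mk_poly n d x) \<longleftrightarrow> stable_coeffs n d x"
    unfolding real_stable_def mpoly_eval_mk_poly stable_coeffs_def mpolys_def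
    using keys_mk_poly[of n d x] by (auto simp: exponents_def)
  have hom: "homogeneous d (mk_poly n d x)"
    unfolding homogeneous_def using keys_mk_poly[of n d x] by (auto simp: exponents_def)
  have nnx: "(\<forall>\<alpha>. 0 \<le> Poly_Mapping.lookup (mk_poly n d x) \<alpha>) \<longleftrightarrow> nonneg_coeffs n d x"
    unfolding nonneg_coeffs_def lookup_mk_poly bij_betw_imp_surj_on[OF lookup_exponents[of n d], symmetric] by auto
  have "stable_coeffs n d x \<and> nonneg_coeffs n d x \<longleftrightarrow> stable_cone n d x" if s: "(\<Sum>a\<in>expos n d. x a) = 1"
  proof -
    have "\<exists>a\<in>expos n d. x a \<noteq> 0" using s by (metis sum.neutral zero_neq_one)
    moreover have "stable_cone n d x \<Longrightarrow> nonneg_coeffs n d x" by (simp add: stable_cone_def)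
    ultimately show ?thesis using stable_imp_stable_cone[of n d x] stable_cone_imp_stable[of n d x] by blast
  qed
  then show ?thesis unfolding PS_def using one st hom nnx by auto
qed

lemma PS_is_mk_poly:
  assumes "f \<in> PS n d"
  obtains x where "f = mk_poly n d x"
proof -
  let ?L = "Poly_Mapping.lookup"
  define x where "x a = ?L f (Abs_poly_mapping a)" for a
  have "?L f \<alpha> = ?L (mk_poly n d x) \<alpha>" for \<alpha>
  proof (cases "\<alpha> \<in> exponents n d")
    case True
    then show ?thesis by (simp add: lookup_mk_poly x_def)
  next
    case False
    have "Poly_Mapping.keys f \<subseteq> exponents n d"
      using assms by (auto simp: PS_def real_stable_def mpolys_def homogeneous_def exponents_def)
    then have "\<alpha> \<notin> Poly_Mapping.keys f" using False by blast
    then show ?thesis using False by (simp add: lookup_mk_poly in_keys_iff)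
  qed
  then show ?thesis using that[of x] by (simp add: poly_mapping_eqI)
qed

lemma mk_poly_eq_iff: "mk_poly n d x = mk_poly n d y \<longleftrightarrow> (\<forall>a\<in>expos n d. x a = y a)"
proof -
  have "mk_poly n d x = mk_poly n d y \<longleftrightarrow> (\<forall>\<alpha>\<in>exponents n d. x (Poly_Mapping.lookup \<alpha>) = y (Poly_Mapping.lookup \<alpha>))"
    unfolding poly_mapping_eq_iff fun_eq_iff lookup_mk_poly by auto
  also have "\<dots> \<longleftrightarrow> (\<forall>a\<in>Poly_Mapping.lookup ` exponents n d. x a = y a)" by simp
  finally show ?thesis unfolding bij_betw_imp_surj_on[OF lookup_exponents[of n d]] .
qed

section \<open>The section of the cone transverse to the Perron eigenvector\<close>

context stable_flow
begin

text \<open>The component along \<open>v 0\<close> is fixed at \<open>1\<close>, which costs one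
  dimension and causes the index shift between coordinates and eigenvectors.\<close>

definition slice_dim :: nat where "slice_dim = card (expos n d) - 1"

lemma card_expos: "card (expos n d) = Suc slice_dim"
  using nonempty by (simp add: slice_dim_def card_gt_0_iff)

definition slice_point :: "(nat \<Rightarrow> real) \<Rightarrow> (nat \<Rightarrow> nat) \<Rightarrow> real" where
  "slice_point c a = (\<Sum>k<card (expos n d). (case k of 0 \<Rightarrow> 1 | Suc j \<Rightarrow> c j) * v k a)"

definition slice :: "(nat \<Rightarrow> real) set" where
  "slice = {c. (\<forall>i\<ge>slice_dim. c i = 0) \<and> stable_cone n d (slice_point c)}"

definition decay :: "nat \<Rightarrow> real" where "decay k = \<mu> 0 - \<mu> (Suc k)"

definition coords :: "((nat \<Rightarrow> nat) \<Rightarrow> real) \<Rightarrow> nat \<Rightarrow> real" where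
  "coords x k = (if k < slice_dim then ip x (v (Suc k)) / ip x (v 0) else 0)"

lemma slice_point_alt: "slice_point c a = v 0 a + (\<Sum>k<slice_dim. c k * v (Suc k) a)"
  unfolding slice_point_def card_expos by (simp add: sum.lessThan_Suc_shift del: sum.lessThan_Suc)

lemma ip_slice_point: "k < card (expos n d) \<Longrightarrow> ip (slice_point c) (v k) = (case k of 0 \<Rightarrow> 1 | Suc j \<Rightarrow> c j)"
  unfolding slice_point_def by (rule ip_lincomb_v)

lemma ip_slice_point_0: "ip (slice_point c) (v 0) = 1"
  by (simp add: ip_slice_point card_expos)

lemma ip_slice_point_Suc: "k < slice_dim \<Longrightarrow> ip (slice_point c) (v (Suc k)) = c k"
  by (simp add: ip_slice_point card_expos)

text \<open>In slice coordinates the semigroup is the diagonal contraction of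
  \<open>contracting_flow\<close>, with the spectral gaps as rates.\<close>

lemma flow_slice_point: "flow t (slice_point c) = slice_point (\<lambda>i. exp (- (decay i * t)) * c i)"
proof
  fix a
  show "flow t (slice_point c) a = slice_point (\<lambda>i. exp (- (decay i * t)) * c i) a"
    unfolding flow_def slice_point_def[of "\<lambda>i. exp (- (decay i * t)) * c i"]
    by (intro sum.cong refl) (auto simp: ip_slice_point decay_def algebra_simps split: nat.split)
qed

lemma slice_point_nonzero: "\<exists>a\<in>expos n d. slice_point c a \<noteq> 0"
proof (rule ccontr)
  assume "\<not> ?thesis"
  then have "ip (slice_point c) (v 0) = 0" by (simp add: ip_def)
  then show False by (simp add: ip_slice_point_0)
qed

text \<open>Positivity of this functional lets every nonzero member of the cone be rescaled into the
  slice.\<close>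

lemma ip_v0_pos:
  assumes "nonneg_coeffs n d x" "\<exists>a\<in>expos n d. x a \<noteq> 0"
  shows "ip x (v 0) > 0"
proof -
  obtain a where a: "a \<in> expos n d" "x a \<noteq> 0" using assms(2) by blast
  then have "x a > 0" using assms(1) by (force simp: nonneg_coeffs_def)
  then have "0 < factorial_weight n a * x a * v 0 a" using a(1) factorial_weight_pos v0_pos by simp
  then show ?thesis unfolding ip_def
    by (intro sum_pos2[OF _ a(1)])
      (use assms(1) factorial_weight_pos v0_pos in \<open>auto simp: nonneg_coeffs_def intro!: mult_nonneg_nonneg less_imp_le[OF factorial_weight_pos] less_imp_le[OF v0_pos]\<close>)
qed

lemma slice_point_coords:
  assumes "ip x (v 0) \<noteq> 0" "a \<in> expos n d"
  shows "slice_point (coords x) a = x a / ip x (v 0)"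
proof -
  have "x a = (\<Sum>k<Suc slice_dim. ip x (v k) * v k a)"
    using eigen_family_complete[OF eig assms(2), of x] unfolding card_expos .
  also have "\<dots> = ip x (v 0) * v 0 a + (\<Sum>k<slice_dim. ip x (v (Suc k)) * v (Suc k) a)"
    by (simp add: sum.lessThan_Suc_shift del: sum.lessThan_Suc)
  finally have "x a / ip x (v 0) = v 0 a + (\<Sum>k<slice_dim. ip x (v (Suc k)) / ip x (v 0) * v (Suc k) a)"
    using assms(1) by (simp add: add_divide_distrib sum_divide_distrib)
  then show ?thesis by (simp add: slice_point_alt coords_def)
qed

lemma coords_in_slice:
  assumes "stable_cone n d x" "\<exists>a\<in>expos n d. x a \<noteq> 0"
  shows "coords x \<in> slice"
proof -
  have p: "ip x (v 0) > 0" using ip_v0_pos assms by (auto simp: stable_cone_def)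
  have "stable_cone n d (\<lambda>a. (1 / ip x (v 0)) * x a)" using p by (intro stable_cone_scale assms) auto
  also have "?this \<longleftrightarrow> stable_cone n d (slice_point (coords x))"
    using p by (intro stable_cone_coeff_cong) (simp add: slice_point_coords)
  finally show ?thesis by (simp add: slice_def coords_def)
qed

lemma axis_cone: "stable_cone n d (\<lambda>a. if a = axis_expo d 0 then 1 else 0)"
proof (rule stable_imp_stable_cone)
  have E: "axis_expo d 0 \<in> expos n d" using axis_expo[of 0 n d] n1 by simp
  have m: "mon n (axis_expo d 0) w = w 0 ^ d" for w :: "nat \<Rightarrow> complex"
    using n1 by (simp add: mon_split[of 0] axis_expo_def)
  have "ev n d (\<lambda>a. if a = axis_expo d 0 then 1 else 0) w = w 0 ^ d" for w :: "nat \<Rightarrow> complex"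
    using E by (simp add: msum_def m if_distrib if_distribR sum.delta cong: if_cong)
  moreover have "w 0 \<noteq> 0" if "\<forall>j<n. Im (w j) > 0" for w :: "nat \<Rightarrow> complex" using that n1 by auto
  ultimately show "stable_coeffs n d (\<lambda>a. if a = axis_expo d 0 then 1 else 0)" by (simp add: stable_coeffs_def)
qed (simp add: nonneg_coeffs_def)

lemma slice_contracting: "contracting_flow slice_dim decay slice"
proof
  show "decay i > 0" if "i < slice_dim" for i using mu_less[of "Suc i"] that by (simp add: decay_def card_expos)
  show "x i = 0" if "x \<in> slice" "i \<ge> slice_dim" for x i using that by (simp add: slice_def)
  show "x \<in> slice" if X: "\<And>m. X m \<in> slice" "\<And>i. i < slice_dim \<Longrightarrow> (\<lambda>m. X m i) \<longlonglongrightarrow> x i" "\<And>i. i \<ge> slice_dim \<Longrightarrow> x i = 0" for X x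
  proof -
    have "stable_cone n d (slice_point x)"
    proof (rule stable_cone_limit[of n d "\<lambda>m. slice_point (X m)"])
      show "stable_cone n d (slice_point (X m))" for m using X(1)[of m] by (simp add: slice_def)
      show "(\<lambda>m. slice_point (X m) a) \<longlonglongrightarrow> slice_point x a" for a
        unfolding slice_point_alt by (intro tendsto_intros X(2)) auto
    qed
    then show ?thesis using X(3) by (simp add: slice_def)
  qed
  show "slice \<noteq> {}"
  proof -
    have "\<exists>a\<in>expos n d. (if a = axis_expo d 0 then 1 else 0) \<noteq> (0 :: real)"
      using axis_expo[of 0 n d] n1 by (intro bexI[of _ "axis_expo d 0"]) auto
    from coords_in_slice[OF axis_cone this] show ?thesis by blast
  qed
  show "\<exists>B. \<forall>x\<in>slice. \<forall>i<slice_dim. \<bar>x i\<bar> \<le> B"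
  proof (intro exI ballI allI impI)
    fix c i assume c: "c \<in> slice" and i: "i < slice_dim"
    let ?B = "\<lambda>i. \<Sum>a\<in>expos n d. \<bar>v (Suc i) a\<bar> / v 0 a"
    have nnc: "slice_point c a \<ge> 0" if "a \<in> expos n d" for a using c that by (auto simp: slice_def stable_cone_def nonneg_coeffs_def)
    \<comment> \<open>The terms of \<open>ip (slice_point c) (v 0) = 1\<close> are nonnegative, so
      each is at most \<open>1\<close>; this bounds the coefficients and thereby the
      coordinates.\<close>
    have le1: "factorial_weight n a * slice_point c a * v 0 a \<le> 1" if a: "a \<in> expos n d" for a
    proof -
      have "factorial_weight n a * slice_point c a * v 0 a \<le> ip (slice_point c) (v 0)" unfolding ip_def
        using nnc factorial_weight_pos v0_pos
        by (intro member_le_sum[OF a]) (auto intro!: mult_nonneg_nonneg simp: less_imp_le)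
      then show ?thesis by (simp add: ip_slice_point_0)
    qed
    have "\<bar>c i\<bar> = \<bar>\<Sum>a\<in>expos n d. factorial_weight n a * slice_point c a * v (Suc i) a\<bar>"
      unfolding ip_slice_point_Suc[OF i, symmetric] ip_def ..
    also have "\<dots> \<le> (\<Sum>a\<in>expos n d. \<bar>factorial_weight n a * slice_point c a * v (Suc i) a\<bar>)" by (rule sum_abs)
    also have "\<dots> \<le> ?B i"
    proof (rule sum_mono)
      fix a assume a: "a \<in> expos n d"
      have v0: "v 0 a > 0" by (rule v0_pos[OF a])
      have "factorial_weight n a * slice_point c a \<le> 1 / v 0 a" using le1[OF a] v0 by (simp add: pos_le_divide_eq)
      moreover have "0 \<le> factorial_weight n a * slice_point c a" using nnc[OF a] factorial_weight_pos[of n a] by simp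
      ultimately have "\<bar>factorial_weight n a * slice_point c a\<bar> * \<bar>v (Suc i) a\<bar> \<le> 1 / v 0 a * \<bar>v (Suc i) a\<bar>"
        by (intro mult_right_mono) auto
      then show "\<bar>factorial_weight n a * slice_point c a * v (Suc i) a\<bar> \<le> \<bar>v (Suc i) a\<bar> / v 0 a" by (simp add: abs_mult)
    qed
    also have "\<dots> \<le> (\<Sum>i<slice_dim. ?B i)"
      using i v0_pos by (intro member_le_sum[of i "{..<slice_dim}" ?B]) (auto intro!: sum_nonneg divide_nonneg_nonneg simp: less_imp_le)
    finally show "\<bar>c i\<bar> \<le> (\<Sum>i<slice_dim. ?B i)" .
  qed
  show "\<exists>\<delta>>0. \<forall>y. (\<forall>i\<ge>slice_dim. y i = 0) \<longrightarrow> (\<forall>i<slice_dim. \<bar>y i - exp (- (decay i * t)) * c i\<bar> < \<delta>) \<longrightarrow> y \<in> slice"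
    if c: "c \<in> slice" and t: "t > 0" for c t
  proof -
    let ?x = "slice_point c" and ?c' = "\<lambda>i. exp (- (decay i * t)) * c i"
    have cx: "stable_cone n d ?x" using c by (simp add: slice_def)
    have "\<exists>\<delta>>0. \<forall>x'. (\<forall>a\<in>expos n d. \<bar>x' a - flow t ?x a\<bar> < \<delta>) \<longrightarrow> stable_cone n d x'"
      by (rule stable_cone_interior[OF n1 flow_cone[OF cx less_imp_le[OF t]]
          flow_coeff_pos[OF cx slice_point_nonzero t] simple_zeros[OF cx slice_point_nonzero t]])
    then obtain \<delta> where \<delta>: "\<delta> > 0" "\<And>x'. \<forall>a\<in>expos n d. \<bar>x' a - slice_point ?c' a\<bar> < \<delta> \<Longrightarrow> stable_cone n d x'"
      unfolding flow_slice_point by blast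
    \<comment> \<open>\<open>K\<close> bounds the change of a coefficient per unit change of the
      slice coordinates; the summand \<open>1\<close> makes it positive and the bound
      strict.\<close>
    define K where "K = 1 + (\<Sum>a\<in>expos n d. \<Sum>k<slice_dim. \<bar>v (Suc k) a\<bar>)"
    have K0: "K > 0" unfolding K_def by (intro add_pos_nonneg sum_nonneg) auto
    have K: "(\<Sum>k<slice_dim. \<bar>v (Suc k) a\<bar>) < K" if "a \<in> expos n d" for a
      unfolding K_def using member_le_sum[OF that, of "\<lambda>a. \<Sum>k<slice_dim. \<bar>v (Suc k) a\<bar>"] by (simp add: sum_nonneg)
    show ?thesis
    proof (intro exI[of _ "\<delta> / K"] conjI allI impI)
      show "0 < \<delta> / K" using \<delta> K0 by simp
      fix y assume y: "\<forall>i\<ge>slice_dim. y i = 0" "\<forall>i<slice_dim. \<bar>y i - ?c' i\<bar> < \<delta> / K"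
      have "stable_cone n d (slice_point y)"
      proof (rule \<delta>(2), rule ballI)
        fix a assume a: "a \<in> expos n d"
        have "slice_point y a - slice_point ?c' a = (\<Sum>k<slice_dim. (y k - ?c' k) * v (Suc k) a)"
          by (simp add: slice_point_alt left_diff_distrib sum_subtractf)
        also have "\<bar>\<dots>\<bar> \<le> (\<Sum>k<slice_dim. \<bar>(y k - ?c' k) * v (Suc k) a\<bar>)" by (rule sum_abs)
        also have "\<dots> \<le> (\<Sum>k<slice_dim. \<delta> / K * \<bar>v (Suc k) a\<bar>)"
        proof (rule sum_mono)
          fix k assume "k \<in> {..<slice_dim}"
          then have "\<bar>y k - ?c' k\<bar> \<le> \<delta> / K" using y(2) by (simp add: less_imp_le)
          then show "\<bar>(y k - ?c' k) * v (Suc k) a\<bar> \<le> \<delta> / K * \<bar>v (Suc k) a\<bar>"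
            unfolding abs_mult by (rule mult_right_mono) simp
        qed
        also have "\<dots> = \<delta> / K * (\<Sum>k<slice_dim. \<bar>v (Suc k) a\<bar>)" by (simp add: sum_distrib_left)
        also have "\<dots> < \<delta> / K * K" using K[OF a] \<delta> K0 by (intro mult_strict_left_mono) auto
        also have "\<dots> = \<delta>" using K0 by simp
        finally show "\<bar>slice_point y a - slice_point ?c' a\<bar> < \<delta>" .
      qed
      then show "y \<in> slice" using y(1) by (simp add: slice_def)
    qed
  qed
qed

definition total :: "(nat \<Rightarrow> real) \<Rightarrow> real" where
  "total c = (\<Sum>a\<in>expos n d. slice_point c a)"

text \<open>Rescaling passes from component \<open>1\<close> along \<open>v 0\<close> to coefficient
  sum \<open>1\<close>, between two sections of one cone.\<close>

definition poly_of :: "(nat \<Rightarrow> real) \<Rightarrow> real_mpoly" where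
  "poly_of c = mk_poly n d (\<lambda>a. slice_point c a / total c)"

lemma total_pos: "c \<in> slice \<Longrightarrow> total c > 0"
proof -
  assume c: "c \<in> slice"
  obtain a where a: "a \<in> expos n d" "slice_point c a \<noteq> 0" using slice_point_nonzero by blast
  have nnc: "slice_point c b \<ge> 0" if "b \<in> expos n d" for b using c that by (auto simp: slice_def stable_cone_def nonneg_coeffs_def)
  show ?thesis unfolding total_def
    by (rule sum_pos2[OF _ a(1)]) (use a nnc in \<open>auto simp: order.strict_iff_order\<close>)
qed

lemma poly_of_bij: "bij_betw poly_of slice (PS n d)"
proof (rule bij_betwI')
  fix c c' assume c: "c \<in> slice" and c': "c' \<in> slice"
  show "(poly_of c = poly_of c') = (c = c')"
  proof
    assume "poly_of c = poly_of c'"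
    then have eq: "slice_point c a / total c = slice_point c' a / total c'" if "a \<in> expos n d" for a
      using that by (simp add: poly_of_def mk_poly_eq_iff)
    have ipd: "ip (\<lambda>a. slice_point c a / total c) w = ip (slice_point c) w / total c" for c w
      using ip_mult[of "1 / total c" "slice_point c" w] by simp
    have ipeq: "ip (slice_point c) w / total c = ip (slice_point c') w / total c'" for w
      unfolding ipd[symmetric] by (rule ip_cong) (simp_all add: eq)
    \<comment> \<open>Both slice points have component \<open>1\<close> along \<open>v 0\<close>, so
      pairing with it compares the scaling factors alone.\<close>
    have tt: "total c = total c'" using ipeq[of "v 0"] by (simp add: ip_slice_point_0)
    have "c k = c' k" for k
    proof (cases "k < slice_dim")
      case True
      then show ?thesis using ipeq[of "v (Suc k)"] tt total_pos[OF c'] by (simp add: ip_slice_point_Suc)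
    next
      case False
      then show ?thesis using c c' by (simp add: slice_def)
    qed
    then show "c = c'" by auto
  qed simp
next
  fix c assume c: "c \<in> slice"
  have "stable_cone n d (\<lambda>a. (1 / total c) * slice_point c a)"
    using c total_pos[OF c] by (intro stable_cone_scale) (auto simp: slice_def)
  moreover have "(\<Sum>a\<in>expos n d. slice_point c a / total c) = 1"
    using total_pos[OF c] by (simp add: sum_divide_distrib[symmetric] total_def[symmetric])
  ultimately show "poly_of c \<in> PS n d" unfolding poly_of_def mk_poly_in_PS[OF n1] by simp
next
  fix f assume f: "f \<in> PS n d"
  then obtain x where x: "f = mk_poly n d x" using PS_is_mk_poly by blast
  then have cx: "stable_cone n d x" "(\<Sum>a\<in>expos n d. x a) = 1" using f mk_poly_in_PS[OF n1] by auto
  have nz: "\<exists>a\<in>expos n d. x a \<noteq> 0" using cx(2) by (metis sum.neutral zero_neq_one)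
  have p: "ip x (v 0) > 0" using ip_v0_pos cx nz by (auto simp: stable_cone_def)
  have e: "slice_point (coords x) a = x a / ip x (v 0)" if "a \<in> expos n d" for a using slice_point_coords that p by simp
  have "total (coords x) = 1 / ip x (v 0)"
    unfolding total_def using e cx(2) by (simp add: sum_divide_distrib[symmetric])
  then have "poly_of (coords x) = f"
    unfolding poly_of_def x mk_poly_eq_iff using e p by simp
  then show "\<exists>c\<in>slice. f = poly_of c" using coords_in_slice[OF cx(1) nz] by metis
qed

text \<open>A continuous bijection from a compact space to a Hausdorff space has a continuous
  inverse.\<close>

lemma PS_homeomorphic_ball: "PS_topology n d homeomorphic_space closed_unit_ball slice_dim"
proof -
  interpret cf: contracting_flow slice_dim decay slice by (rule slice_contracting)
  define \<Phi> where "\<Phi> = poly_of \<circ> cf.ball_map"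
  let ?B = "unit_ball slice_dim"
  have bij: "bij_betw \<Phi> ?B (PS n d)"
    unfolding \<Phi>_def by (rule bij_betw_trans[OF cf.ball_map_bij poly_of_bij])
  have ball: "closed_unit_ball slice_dim = top_of_set ?B"
    unfolding closed_unit_ball_def Euclidean_space_def subtopology_subtopology unit_ball_def
      euclidean_product_topology by (simp add: Int_def)
  have cmp: "compact_space (top_of_set ?B)"
  proof -
    have "compactin (product_topology (\<lambda>i. euclidean) UNIV) (PiE UNIV (\<lambda>i::nat. {-1..1::real}))"
      by (subst compactin_PiE) auto
    then have C: "compact (PiE UNIV (\<lambda>i::nat. {-1..1::real}))" by (simp add: euclidean_product_topology)
    have "closed ?B" unfolding unit_ball_def imp_conv_disj
      by (intro closed_Collect_conj closed_Collect_all closed_Collect_disj closed_Collect_eq closed_Collect_le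
          closed_Collect_const continuous_intros continuous_on_product_coordinates)
    moreover have "?B \<subseteq> PiE UNIV (\<lambda>i. {-1..1})"
    proof
      fix x assume x: "x \<in> ?B"
      have "\<bar>x i\<bar> \<le> 1" for i
      proof (cases "i < slice_dim")
        case True
        have "(x i)\<^sup>2 \<le> 1"
          using member_le_sum[of i "{..<slice_dim}" "\<lambda>i. (x i)\<^sup>2"] True x by (auto simp: unit_ball_def)
        then show ?thesis by (simp add: abs_square_le_1)
      qed (use x in \<open>auto simp: unit_ball_def\<close>)
      then show "x \<in> PiE UNIV (\<lambda>i. {-1..1})" by (auto simp: PiE_iff abs_le_iff minus_le_iff)
    qed
    ultimately have "compact ?B" using compact_Int_closed[OF C] by (metis Int_absorb1)
    then show ?thesis by (simp add: compact_space_subtopology)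
  qed
  let ?f = "\<lambda>f. restrict (Poly_Mapping.lookup f) (exponents n d)"
  have top: "topspace (PS_topology n d) = PS n d"
    unfolding PS_topology_def topspace_pullback_topology by auto
  \<comment> \<open>A pullback topology is Hausdorff only if the defining map separates points:
    members of \<open>PS n d\<close> are determined by their coefficients on
    \<open>exponents n d\<close>.\<close>
  have haus: "Hausdorff_space (PS_topology n d)"
    unfolding Hausdorff_space_def top
  proof (intro allI impI, elim conjE)
    fix f g assume f: "f \<in> PS n d" and g: "g \<in> PS n d" and ne: "f \<noteq> g"
    obtain x where x: "f = mk_poly n d x" by (rule PS_is_mk_poly[OF f])
    obtain y where y: "g = mk_poly n d y" by (rule PS_is_mk_poly[OF g])
    have "?f f \<noteq> ?f g"
    proof
      assume "?f f = ?f g"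
      then have "\<forall>\<alpha>. Poly_Mapping.lookup f \<alpha> = Poly_Mapping.lookup g \<alpha>"
        unfolding x y lookup_mk_poly by (auto simp: restrict_def fun_eq_iff lookup_mk_poly split: if_splits)
      then show False using ne by (simp add: poly_mapping_eqI)
    qed
    moreover have "Hausdorff_space (powertop_real (exponents n d))"
      by (simp add: Hausdorff_space_product_topology)
    moreover have "?f f \<in> topspace (powertop_real (exponents n d))" "?f g \<in> topspace (powertop_real (exponents n d))"
      by auto
    ultimately obtain U V where UV: "openin (powertop_real (exponents n d)) U" "openin (powertop_real (exponents n d)) V"
      "?f f \<in> U" "?f g \<in> V" "disjnt U V"
      unfolding Hausdorff_space_def by meson
    show "\<exists>U V. openin (PS_topology n d) U \<and> openin (PS_topology n d) V \<and> f \<in> U \<and> g \<in> V \<and> disjnt U V"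
    proof (intro exI conjI)
      show "openin (PS_topology n d) (?f -` U \<inter> PS n d)" "openin (PS_topology n d) (?f -` V \<inter> PS n d)"
        unfolding PS_topology_def openin_pullback_topology using UV by blast+
      show "f \<in> ?f -` U \<inter> PS n d" "g \<in> ?f -` V \<inter> PS n d" using f g UV by auto
      show "disjnt (?f -` U \<inter> PS n d) (?f -` V \<inter> PS n d)" using UV(5) by (auto simp: disjnt_iff)
    qed
  qed
  have cpt: "continuous_on ?B (\<lambda>z. slice_point (cf.ball_map z) a)" for a
    unfolding slice_point_alt by (intro continuous_intros cf.continuous_ball_map)
  have ct: "continuous_on ?B (\<lambda>z. total (cf.ball_map z))"
    unfolding total_def by (intro continuous_intros cpt)
  have tz: "total (cf.ball_map z) \<noteq> 0" if "z \<in> ?B" for z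
    using total_pos[OF cf.ball_map_in_Q[OF that]] by simp
  have cont: "continuous_map (top_of_set ?B) (PS_topology n d) \<Phi>"
    unfolding PS_topology_def
  proof (rule continuous_map_pullback')
    show "topspace (top_of_set ?B) \<subseteq> \<Phi> -` PS n d" using bij by (auto simp: bij_betw_def)
    show "continuous_map (top_of_set ?B) (powertop_real (exponents n d)) (?f \<circ> \<Phi>)"
      unfolding continuous_map_componentwise
    proof (intro conjI ballI)
      show "(?f \<circ> \<Phi>) ` topspace (top_of_set ?B) \<subseteq> extensional (exponents n d)" by auto
      fix \<alpha> assume a: "\<alpha> \<in> exponents n d"
      have eq: "(\<lambda>z. (?f \<circ> \<Phi>) z \<alpha>) = (\<lambda>z. slice_point (cf.ball_map z) (Poly_Mapping.lookup \<alpha>) / total (cf.ball_map z))"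
        using a by (auto simp: \<Phi>_def poly_of_def lookup_mk_poly fun_eq_iff)
      show "continuous_map (top_of_set ?B) euclideanreal (\<lambda>z. (?f \<circ> \<Phi>) z \<alpha>)"
        unfolding eq continuous_map_iff_continuous by (intro continuous_on_divide cpt ct ballI tz)
    qed
  qed
  have "homeomorphic_map (top_of_set ?B) (PS_topology n d) \<Phi>"
    by (rule continuous_imp_homeomorphic_map[OF cont cmp haus])
      (use bij top in \<open>auto simp: bij_betw_def\<close>)
  then have "top_of_set ?B homeomorphic_space PS_topology n d"
    by (rule homeomorphic_map_imp_homeomorphic_space)
  then show ?thesis unfolding ball by (rule homeomorphic_space_sym[THEN iffD1])
qed

end

theorem theorem4p3:
  fixes n d :: nat
  assumes "n \<ge> 1"
  shows "\<exists>m. PS_topology n d homeomorphic_space closed_unit_ball m"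
proof -
  interpret irr: irreducible_symmetric "expos n d" "factorial_weight n" "exchange_matrix n"
    by (rule irreducible_exchange_matrix[OF assms])
  obtain v \<mu> where v: "irr.eigen_family (card (expos n d)) v \<mu>" "\<And>i. i \<in> expos n d \<Longrightarrow> v 0 i > 0"
    "\<And>k. 0 < k \<Longrightarrow> k < card (expos n d) \<Longrightarrow> \<mu> k < \<mu> 0"
    by (rule irr.perron) (rule that)
  interpret stable_flow n d v \<mu>
    by unfold_locales (rule v(1), erule v(2), erule (1) v(3), rule assms)
  show ?thesis using PS_homeomorphic_ball by blast
qed


end
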